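(* Let $d\ge 1$ be an integer, let $\alpha\in(0,1)$, and let $h:\mathbb{Z}^d\to\mathbb{R}$ and $f:\mathbb{Z}^d\times\mathbb{R}\to\mathbb{R}$ satisfy the following conditions, where $F(x,u)=\int_0^u f(x,t)\,dt$: (h1) there are positive constants $c_1,c_2$ with $c_1\le h(x)\le c_2$ for all $x\in\mathbb{Z}^d$; (f1) $f(x,u)$ is continuous with respect to $u\in\mathbb{R}$; (f2) $|f(x,u)|\le a(1+|u|^{p-1})$ for all $(x,u)\in\mathbb{Z}^d\times\mathbb{R}$, for some $a>0$ and $p>2$; (f3) $f(x,u)=o(u)$ as $|u|\to0$, uniformly in $x$; (f4) for each $x$, $u\mapsto \frac{f(x,u)}{|u|}$ is strictly increasing on $(-\infty,0)$ and on $(0,+\infty)$; (f5) $\frac{F(x,u)}{u^2}\to+\infty$ as $|u|\to+\infty$, uniformly in $x$; (f6) $h$ and $f$ are $1$-periodic in $x_i$ for $1\le i\le d$. Then there exists a ground state solution to the equation $$(-\Delta)^\alpha u+h(x)u=f(x,u),\quad x\in\mathbb{Z}^d.$$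
   Context: For $u:\mathbb{Z}^d\to\mathbb{R}$ in $\ell^2(\mathbb{Z}^d)$, the discrete Fourier transform is $\hat u(\theta)=\sum_{x\in\mathbb{Z}^d}u(x)e^{ix\cdot\theta}$, $\theta\in[-\pi,\pi]^d$ (series in $L^2([-\pi,\pi]^d)$). Put $\Phi(\theta)=\sum_{i=1}^d4\sin^2(\theta_i/2)$. The discrete fractional Laplacian $(-\Delta)^\alpha$ is defined by $\widehat{(-\Delta)^\alpha u}(\theta)=\Phi(\theta)^\alpha\,\hat u(\theta)$. Let $$\|u\|_\alpha^2=\frac1{(2\pi)^d}\int_{[-\pi,\pi]^d}\Phi(\theta)^\alpha|\hat u(\theta)|^2\,d\theta+\sum_{x\in\mathbb{Z}^d}h(x)|u(x)|^2,\qquad H^\alpha=\{u\in\ell^2(\mathbb{Z}^d):\|u\|_\alpha<+\infty\}.$$ The energy functional is $I(u)=\frac12\|u\|_\alpha^2-\sum_{x\in\mathbb{Z}^d}F(x,u(x))$ on $H^\alpha$, and the Nehari manifold is $\mathcal{M}=\{u\in H^\alpha\setminus\{0\}:\langle I'(u),u\rangle=0\}$, where $\langle I'(u),u\rangle=\|u\|_\alpha^2-\sum_{x\in\mathbb{Z}^d}f(x,u(x))u(x)$. A ground state solution of the equation is a function $u\in H^\alpha$ that is a nontrivial critical point of $I$ and satisfies $I(u)=\inf_{\mathcal{M}}I>0$. $1$-periodic in $x_i$ means $h(x+e_i)=h(x)$ and $f(x+e_i,u)=f(x,u)$ for all $x\in\mathbb{Z}^d$, $u\in\mathbb{R}$,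 where $e_i$ is the $i$-th standard unit vector. *)

theory Defs
  imports "HOL-Analysis.Analysis"
begin

text \<open>
  The lattice is \<^typ>\<open>int ^ 'n\<close> with \<open>d = CARD('n)\<close>; as types are nonempty, \<open>d \<ge> 1\<close>.
\<close>

definition torus_cube :: "(real ^ 'n) set" where
  "torus_cube = cbox (\<chi> i. - pi) (\<chi> i. pi)"

definition lattice_l2 :: "((int ^ 'n) \<Rightarrow> real) set" where
  "lattice_l2 = {u. (\<lambda>x. \<bar>u x\<bar>\<^sup>2) summable_on UNIV}"

definition fourier_char :: "int ^ 'n \<Rightarrow> real ^ 'n \<Rightarrow> complex" where
  "fourier_char x \<theta> = exp (\<i> * complex_of_real (\<Sum>i\<in>UNIV. of_int (x $ i) * \<theta> $ i))"

text \<open>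
  \<open>v\<close> represents the sum of the series \<open>\<Sum>x. u x e\<^bsup>i x \<cdot> \<theta>\<^esup>\<close> in \<open>L\<^sup>2([-\<pi>,\<pi>]\<^sup>d)\<close>. Square integrability
  of \<open>v\<close> has to be demanded, because the Bochner integral of a non-integrable function is 0.
\<close>

definition is_dft :: "((int ^ 'n) \<Rightarrow> real) \<Rightarrow> (real ^ 'n \<Rightarrow> complex) \<Rightarrow> bool" where
  "is_dft u v \<longleftrightarrow>
     set_borel_measurable lborel torus_cube v \<and>
     set_integrable lborel torus_cube (\<lambda>\<theta>. (cmod (v \<theta>))\<^sup>2) \<and>
     ((\<lambda>A. LINT \<theta>:torus_cube|lborel.
             (cmod (v \<theta> - (\<Sum>x\<in>A. complex_of_real (u x) * fourier_char x \<theta>)))\<^sup>2)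
        \<longlongrightarrow> 0) (finite_subsets_at_top UNIV)"

text \<open>
  For \<open>u\<close> in \<open>\<ell>\<^sup>2\<close> such a \<open>v\<close> exists and is unique up to null sets; \<open>dft u\<close> is an arbitrary
  representative of the class, and is used below only under integrals and almost everywhere.
\<close>

definition dft :: "((int ^ 'n) \<Rightarrow> real) \<Rightarrow> real ^ 'n \<Rightarrow> complex" where
  "dft u = (SOME v. is_dft u v)"

definition laplace_symbol :: "real ^ 'n \<Rightarrow> real" where
  "laplace_symbol \<theta> = (\<Sum>i\<in>UNIV. 4 * (sin (\<theta> $ i / 2))\<^sup>2)"

definition frac_laplacian :: "real \<Rightarrow> ((int ^ 'n) \<Rightarrow> real) \<Rightarrow> (int ^ 'n) \<Rightarrow> real" where
  "frac_laplacian \<alpha> u = (THE w. w \<in> lattice_l2 \<and>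
     (AE \<theta>\<in>torus_cube in lborel.
        dft w \<theta> = complex_of_real (laplace_symbol \<theta> powr \<alpha>) * dft u \<theta>))"

definition alpha_norm_sq ::
    "real \<Rightarrow> ((int ^ 'n) \<Rightarrow> real) \<Rightarrow> ((int ^ 'n) \<Rightarrow> real) \<Rightarrow> real" where
  "alpha_norm_sq \<alpha> h u =
     1 / (2 * pi) ^ CARD('n) *
       (LINT \<theta>:torus_cube|lborel. laplace_symbol \<theta> powr \<alpha> * (cmod (dft u \<theta>))\<^sup>2)
     + (\<Sum>\<^sub>\<infinity>x. h x * \<bar>u x\<bar>\<^sup>2)"

definition alpha_norm ::
    "real \<Rightarrow> ((int ^ 'n) \<Rightarrow> real) \<Rightarrow> ((int ^ 'n) \<Rightarrow> real) \<Rightarrow> real" where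
  "alpha_norm \<alpha> h u = sqrt (alpha_norm_sq \<alpha> h u)"

text \<open>
  Both terms of \<^const>\<open>alpha_norm_sq\<close> are nonnegative for \<open>h \<ge> 0\<close>, so finiteness of the norm means
  that the integral and the sum both converge.
\<close>

definition H_alpha :: "real \<Rightarrow> ((int ^ 'n) \<Rightarrow> real) \<Rightarrow> ((int ^ 'n) \<Rightarrow> real) set" where
  "H_alpha \<alpha> h = {u \<in> lattice_l2.
     set_integrable lborel torus_cube
       (\<lambda>\<theta>. laplace_symbol \<theta> powr \<alpha> * (cmod (dft u \<theta>))\<^sup>2) \<and>
     (\<lambda>x. h x * \<bar>u x\<bar>\<^sup>2) summable_on UNIV}"

definition primitive :: "('a \<Rightarrow> real \<Rightarrow> real) \<Rightarrow> 'a \<Rightarrow> real \<Rightarrow> real" where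
  "primitive f x u = (LBINT t=0..u. f x t)"

definition energy :: "real \<Rightarrow> ((int ^ 'n) \<Rightarrow> real) \<Rightarrow> ((int ^ 'n) \<Rightarrow> real \<Rightarrow> real)
    \<Rightarrow> ((int ^ 'n) \<Rightarrow> real) \<Rightarrow> real" where
  "energy \<alpha> h f u = 1 / 2 * alpha_norm_sq \<alpha> h u - (\<Sum>\<^sub>\<infinity>x. primitive f x (u x))"

definition nehari :: "real \<Rightarrow> ((int ^ 'n) \<Rightarrow> real) \<Rightarrow> ((int ^ 'n) \<Rightarrow> real \<Rightarrow> real)
    \<Rightarrow> ((int ^ 'n) \<Rightarrow> real) set" where
  "nehari \<alpha> h f = {u \<in> H_alpha \<alpha> h - {\<lambda>_. 0}.
     alpha_norm_sq \<alpha> h u - (\<Sum>\<^sub>\<infinity>x. f x (u x) * u x) = 0}"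

text \<open>
  \<open>I'(u) = 0\<close>: the functional is Frechet differentiable at \<open>u\<close> on \<open>H\<^sup>\<alpha>\<close> with derivative 0.
\<close>

definition critical_point :: "real \<Rightarrow> ((int ^ 'n) \<Rightarrow> real) \<Rightarrow> ((int ^ 'n) \<Rightarrow> real \<Rightarrow> real)
    \<Rightarrow> ((int ^ 'n) \<Rightarrow> real) \<Rightarrow> bool" where
  "critical_point \<alpha> h f u \<longleftrightarrow> u \<in> H_alpha \<alpha> h \<and>
     (\<forall>\<epsilon>>0. \<exists>\<delta>>0. \<forall>v\<in>H_alpha \<alpha> h. alpha_norm \<alpha> h v < \<delta> \<longrightarrow>
        \<bar>energy \<alpha> h f (\<lambda>x. u x + v x) - energy \<alpha> h f u\<bar> \<le> \<epsilon> * alpha_norm \<alpha> h v)"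

text \<open>
  The infimum is taken in the extended reals, where it has its usual meaning for every set.
\<close>

definition ground_state :: "real \<Rightarrow> ((int ^ 'n) \<Rightarrow> real) \<Rightarrow> ((int ^ 'n) \<Rightarrow> real \<Rightarrow> real)
    \<Rightarrow> ((int ^ 'n) \<Rightarrow> real) \<Rightarrow> bool" where
  "ground_state \<alpha> h f u \<longleftrightarrow>
     critical_point \<alpha> h f u \<and> u \<noteq> (\<lambda>_. 0) \<and>
     ereal (energy \<alpha> h f u) = (INF v\<in>nehari \<alpha> h f. ereal (energy \<alpha> h f v)) \<and>
     energy \<alpha> h f u > 0"

end

theory Submission
  imports Defs "HOL-Complex_Analysis.Great_Picard"
begin

text \<open>
Since the period is 1 in every coordinate, \<open>h\<close> is constant and \<open>f x\<close> does not depend on \<open>x\<close>; the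
problem is invariant under all translations of the lattice. The ground state is found by minimizing
the energy \<open>I\<close> on the Nehari manifold \<open>N = {u \<noteq> 0. J u = 0}\<close>, where \<open>J u = \<langle>I'(u), u\<rangle>\<close>.

On the lattice a square-summable function is bounded, which simplifies the analysis. Write
\<open>f x s = s * m s\<close>. The hypotheses say that \<open>m\<close> is continuous with \<open>m 0 = 0\<close>, strictly increasing along
rays from the origin, and unbounded. On \<open>N\<close> the energy is \<open>\<Sum>x. K (u x)\<close> for the density
\<open>K s = s\<^sup>2 m s / 2 - G s\<close>, which is positive off 0, increases along rays and tends to infinity.
Smallness of \<open>m\<close> near 0 shows that every \<open>u\<close> in \<open>N\<close> has a value of size at least some fixed \<open>r > 0\<close>
(\<open>N_nonvanishing\<close>), so the energy is bounded away from 0 on \<open>N\<close>; growth of \<open>K\<close> shows that bounded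
energy implies bounded norm (\<open>N_bounded\<close>).

Existence of a minimizer (\<open>minimizer_exists\<close>): translate a minimizing sequence so that it stays away
from 0 at the origin and pass to a pointwise limit \<open>v \<noteq> 0\<close>. By a Brezis--Lieb splitting
(\<open>quad_sum_split\<close>) both \<open>J\<close> and the energy decompose into the parts of \<open>v\<close> and of the remainders.
Whenever \<open>J\<close> is negative, scaling down reaches \<open>N\<close> and lowers \<open>\<Sum>x. K (u x)\<close>; so \<open>J v < 0\<close>, and likewise
\<open>J v > 0\<close>, would produce an element of \<open>N\<close> with energy below the infimum.

A minimizer is a critical point (\<open>minimizer_critical\<close>): as \<open>f x\<close> is only continuous, \<open>N\<close> is not known to
be smooth. Instead one perturbs \<open>u\<close> to \<open>u + s v\<close>, uses the sign change of \<open>J\<close> along the ray through \<open>u\<close>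
to return to \<open>N\<close> by a scaling close to 1, and uses that \<open>u\<close> maximizes the energy on its own ray.

The linear part rests on the Fourier transform. Parseval's identity and completeness of the
space of square-integrable functions give existence and uniqueness of transforms. The operator with
symbol \<open>\<Phi>\<^sup>\<alpha>\<close> exists because \<open>\<Phi>\<close> is a combination of cosines, which act as translations, and \<open>\<Phi>\<^sup>\<alpha>\<close> is a
uniform limit of polynomials in \<open>\<Phi>\<close> (\<open>multiplier_symbol_powr\<close>). Symmetry, nonnegativity and translation
invariance of its form are read off on the Fourier side.
\<close>

section \<open>Square-summable functions\<close>

definition l2 :: "('a \<Rightarrow> real) set" where
  "l2 = {u. (\<lambda>x. (u x)^2) summable_on UNIV}"

definition l2sq :: "('a \<Rightarrow> real) \<Rightarrow> real" where
  "l2sq u = (\<Sum>\<^sub>\<infinity>x. (u x)^2)"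

definition l2ip :: "('a \<Rightarrow> real) \<Rightarrow> ('a \<Rightarrow> real) \<Rightarrow> real" where
  "l2ip u v = (\<Sum>\<^sub>\<infinity>x. u x * v x)"

lemma divide_mult_cancel: "c \<noteq> 0 \<Longrightarrow> a / (k * c) * c = a / k" for a c k :: real
  by simp

lemma summable_on_dominated:
  fixes f g :: "'a \<Rightarrow> real"
  assumes "g summable_on A" "\<And>x. x \<in> A \<Longrightarrow> \<bar>f x\<bar> \<le> g x"
  shows "f summable_on A"
  using Infinite_Sum.abs_summable_on_comparison_test'[OF assms(1), of f] assms(2)
  by (auto intro!: abs_summable_summable[of f])

lemma summable_on_diff_real:
  fixes f g :: "'a \<Rightarrow> real"
  assumes "f summable_on A" "g summable_on A"
  shows "(\<lambda>x. f x - g x) summable_on A"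
  using summable_on_add[OF assms(1), of "\<lambda>x. - g x"] assms(2) by (simp add: summable_on_uminus)

lemma infsum_diff_real:
  fixes f g :: "'a \<Rightarrow> real"
  assumes "f summable_on A" "g summable_on A"
  shows "infsum (\<lambda>x. f x - g x) A = infsum f A - infsum g A"
  using infsum_add[OF assms(1), of "\<lambda>x. - g x"] assms(2)
  by (simp add: summable_on_uminus infsum_uminus)

lemma abs_infsum_le:
  fixes f g :: "'a \<Rightarrow> real"
  assumes "g summable_on A" "\<And>x. x \<in> A \<Longrightarrow> \<bar>f x\<bar> \<le> g x"
  shows "\<bar>infsum f A\<bar> \<le> infsum g A"
proof -
  have f: "f summable_on A" by (rule summable_on_dominated[OF assms])
  have "infsum f A \<le> infsum g A"
    by (rule infsum_mono[OF f assms(1)]) (use assms(2) in force)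
  moreover have "infsum (\<lambda>x. - f x) A \<le> infsum g A"
    by (rule infsum_mono) (use assms f in \<open>force simp: summable_on_uminus\<close>)+
  ultimately show ?thesis by (simp add: infsum_uminus)
qed

lemma infsum_strict_mono:
  fixes f g :: "'a \<Rightarrow> real"
  assumes "f summable_on UNIV" "g summable_on UNIV" "\<And>x. f x \<le> g x" "f y < g y"
  shows "infsum f UNIV < infsum g UNIV"
proof -
  have "sum (\<lambda>x. g x - f x) {y} \<le> infsum (\<lambda>x. g x - f x) UNIV"
    by (rule finite_sum_le_infsum) (use assms in \<open>auto intro: summable_on_diff_real\<close>)
  then show ?thesis using assms by (simp add: infsum_diff_real)
qed

lemma term_le_infsum:
  fixes f :: "'a \<Rightarrow> real"
  assumes "f summable_on UNIV" "\<And>x. 0 \<le> f x"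
  shows "f y \<le> infsum f UNIV"
  using finite_sum_le_infsum[OF assms(1), of "{y}"] assms(2) by simp

lemma bounded_finite_sums_imp:
  fixes f :: "'a \<Rightarrow> real"
  assumes "\<And>x. 0 \<le> f x" "\<And>F. finite F \<Longrightarrow> sum f F \<le> b"
  shows "f summable_on UNIV" "infsum f UNIV \<le> b"
proof -
  show "f summable_on UNIV"
    by (rule nonneg_bdd_above_summable_on) (use assms in \<open>auto intro!: bdd_aboveI[of _ b]\<close>)
  then show "infsum f UNIV \<le> b"
    by (rule infsum_le_finite_sums) (use assms in auto)
qed

lemma l2_summable: "u \<in> l2 \<Longrightarrow> (\<lambda>x. (u x)^2) summable_on UNIV"
  by (simp add: l2_def)

lemma l2sq_nonneg [simp]: "0 \<le> l2sq u"
  unfolding l2sq_def by (rule infsum_nonneg) simp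

lemma l2_pointwise_le: "u \<in> l2 \<Longrightarrow> \<bar>u x\<bar> \<le> sqrt (l2sq u)"
  unfolding l2sq_def
  by (rule real_le_rsqrt) (use term_le_infsum[OF l2_summable] in auto)

lemma l2_mult_summable:
  assumes "u \<in> l2" "v \<in> l2"
  shows "(\<lambda>x. u x * v x) summable_on UNIV" "(\<lambda>x. \<bar>u x\<bar> * \<bar>v x\<bar>) summable_on UNIV"
proof -
  have s: "(\<lambda>x. (u x)^2 + (v x)^2) summable_on UNIV"
    using assms by (intro summable_on_add) (auto simp: l2_def)
  have b: "\<bar>u x\<bar> * \<bar>v x\<bar> \<le> (u x)^2 + (v x)^2" for x
  proof -
    have "0 \<le> \<bar>u x\<bar> * \<bar>v x\<bar>" by simp
    moreover have "2 * (\<bar>u x\<bar> * \<bar>v x\<bar>) \<le> (u x)^2 + (v x)^2"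
      using sum_squares_bound[of "\<bar>u x\<bar>" "\<bar>v x\<bar>"] by (simp add: mult.assoc)
    ultimately show ?thesis by linarith
  qed
  show "(\<lambda>x. u x * v x) summable_on UNIV" "(\<lambda>x. \<bar>u x\<bar> * \<bar>v x\<bar>) summable_on UNIV"
    by (rule summable_on_dominated[OF s], use b in \<open>simp add: abs_mult\<close>)+
qed

lemma l2_scale: "u \<in> l2 \<Longrightarrow> (\<lambda>x. c * u x) \<in> l2"
  by (simp add: l2_def power_mult_distrib summable_on_cmult_right)

lemma l2_add:
  assumes "u \<in> l2" "v \<in> l2" shows "(\<lambda>x. u x + v x) \<in> l2"
proof -
  have "(\<lambda>x. (u x)^2 + (v x)^2 + 2 * (u x * v x)) summable_on UNIV"
    using assms l2_mult_summable(1)[OF assms]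
    by (intro summable_on_add summable_on_cmult_right) (auto simp: l2_def)
  then show ?thesis by (simp add: l2_def power2_sum algebra_simps)
qed

lemma l2_diff:
  assumes "u \<in> l2" "v \<in> l2" shows "(\<lambda>x. u x - v x) \<in> l2"
  using l2_add[OF assms(1) l2_scale[OF assms(2), of "-1"]] by simp

lemma l2_finite_support:
  assumes "finite A" "\<And>x. x \<notin> A \<Longrightarrow> u x = 0" shows "u \<in> l2"
proof -
  have "finite {x. (u x)^2 \<noteq> 0}" by (rule finite_subset[OF _ assms(1)]) (use assms(2) in auto)
  then show ?thesis
    unfolding l2_def mem_Collect_eq by (intro finite_nonzero_values_imp_summable_on) simp
qed

lemma l2ip_commute: "l2ip u v = l2ip v u"
  by (simp add: l2ip_def mult.commute)

lemma l2ip_self: "l2ip u u = l2sq u"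
  by (simp add: l2ip_def l2sq_def power2_eq_square)

lemma l2ip_add_right:
  assumes "u \<in> l2" "v \<in> l2" "w \<in> l2"
  shows "l2ip u (\<lambda>x. v x + w x) = l2ip u v + l2ip u w"
  unfolding l2ip_def distrib_left
  by (rule infsum_add) (use assms in \<open>auto intro: l2_mult_summable\<close>)

lemma l2ip_scale_right: "l2ip u (\<lambda>x. c * v x) = c * l2ip u v"
  unfolding l2ip_def by (subst infsum_cmult_right'[symmetric]) (simp add: mult.left_commute)

lemma l2sq_scale: "l2sq (\<lambda>x. c * u x) = c^2 * l2sq u"
  by (simp add: l2sq_def power_mult_distrib infsum_cmult_right')

lemma l2sq_add:
  assumes "u \<in> l2" "v \<in> l2"
  shows "l2sq (\<lambda>x. u x + v x) = l2sq u + 2 * l2ip u v + l2sq v"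
proof -
  have "l2sq (\<lambda>x. u x + v x) = (\<Sum>\<^sub>\<infinity>x. ((u x)^2 + 2 * (u x * v x)) + (v x)^2)"
    unfolding l2sq_def by (intro infsum_cong) (simp add: power2_sum)
  also have "\<dots> = l2sq u + 2 * l2ip u v + l2sq v"
    using assms l2_mult_summable(1)[OF assms] unfolding l2sq_def l2ip_def
    by (simp add: infsum_add summable_on_add summable_on_cmult_right infsum_cmult_right' l2_def)
  finally show ?thesis .
qed

lemma l2_Cauchy_Schwarz:
  assumes "u \<in> l2" "v \<in> l2"
  shows "(\<Sum>\<^sub>\<infinity>x. \<bar>u x\<bar> * \<bar>v x\<bar>) \<le> sqrt (l2sq u) * sqrt (l2sq v)"
proof (rule infsum_le_finite_sums[OF l2_mult_summable(2)[OF assms]])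
  fix F :: "'a set" assume F: "finite F"
  have "(\<Sum>x\<in>F. \<bar>u x\<bar> * \<bar>v x\<bar>) \<le> L2_set u F * L2_set v F"
    by (rule L2_set_mult_ineq)
  also have "\<dots> \<le> sqrt (l2sq u) * sqrt (l2sq v)"
    unfolding L2_set_def l2sq_def
    by (intro mult_mono real_sqrt_le_mono finite_sum_le_infsum)
       (use F assms in \<open>auto simp: l2_def intro: infsum_nonneg sum_nonneg\<close>)
  finally show "(\<Sum>x\<in>F. \<bar>u x\<bar> * \<bar>v x\<bar>) \<le> sqrt (l2sq u) * sqrt (l2sq v)" .
qed

lemma l2sq_add_le:
  assumes "u \<in> l2" "v \<in> l2"
  shows "l2sq (\<lambda>x. u x + v x) \<le> 2 * l2sq u + 2 * l2sq v"
proof -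
  have "(u x + v x)^2 \<le> 2 * (u x)^2 + 2 * (v x)^2" for x
    using sum_squares_bound[of "u x" "v x"] by (simp add: power2_sum)
  then have "l2sq (\<lambda>x. u x + v x) \<le> (\<Sum>\<^sub>\<infinity>x. 2 * (u x)^2 + 2 * (v x)^2)"
    unfolding l2sq_def
    using l2_add[OF assms] assms
    by (intro infsum_mono summable_on_add summable_on_cmult_right) (simp_all add: l2_def)
  also have "\<dots> = 2 * l2sq u + 2 * l2sq v"
    using assms unfolding l2sq_def by (simp add: infsum_add summable_on_cmult_right infsum_cmult_right' l2_def)
  finally show ?thesis .
qed

lemma l2_shift:
  fixes u :: "'a::group_add \<Rightarrow> real"
  shows "(\<lambda>x. u (x + y)) \<in> l2 \<longleftrightarrow> u \<in> l2"
  using summable_on_reindex_bij_betw[OF bij_plus_right, of "\<lambda>x. (u x)^2" y]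
  by (simp add: l2_def)

lemma infsum_shift:
  fixes f :: "'a::group_add \<Rightarrow> real"
  shows "(\<Sum>\<^sub>\<infinity>x. f (x + y)) = infsum f UNIV"
  by (rule infsum_reindex_bij_betw[OF bij_plus_right])

text \<open>Fatou's lemma for sums: a bound on all finite partial sums survives pointwise limits.\<close>

lemma l2_pointwise_limit:
  assumes "\<And>n. u n \<in> l2" "\<And>n. l2sq (u n) \<le> b" "\<And>x. (\<lambda>n. u n x) \<longlonglongrightarrow> v x"
  shows "v \<in> l2" "l2sq v \<le> b"
proof -
  have "(\<Sum>x\<in>F. (v x)^2) \<le> b" if "finite F" for F
  proof (rule LIMSEQ_le_const2)
    show "(\<lambda>n. \<Sum>x\<in>F. (u n x)^2) \<longlonglongrightarrow> (\<Sum>x\<in>F. (v x)^2)"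
      using assms(3) by (intro tendsto_intros)
    have "(\<Sum>x\<in>F. (u n x)^2) \<le> l2sq (u n)" for n
      unfolding l2sq_def by (rule finite_sum_le_infsum) (use assms that in \<open>auto simp: l2_def\<close>)
    then show "\<exists>N. \<forall>n\<ge>N. (\<Sum>x\<in>F. (u n x)^2) \<le> b"
      using assms(2) order_trans by blast
  qed
  from bounded_finite_sums_imp[OF _ this] show "v \<in> l2" "l2sq v \<le> b"
    by (auto simp: l2_def l2sq_def)
qed

text \<open>The approximation behind all the weak-limit arguments below: on the finite set \<open>A\<close> pointwise
convergence is uniform, and off \<open>A\<close> the fixed function is small.\<close>

lemma l2_truncate:
  assumes "u \<in> l2" "0 < (e::real)"
  obtains A where "finite A" "(\<lambda>x. if x \<in> A then 0 else u x) \<in> l2"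
    "l2sq (\<lambda>x. if x \<in> A then 0 else u x) \<le> e"
proof -
  obtain A where A: "finite A" "dist (\<Sum>x\<in>A. (u x)^2) (l2sq u) \<le> e"
    using infsum_finite_approximation[OF l2_summable[OF assms(1)] assms(2)]
    unfolding l2sq_def by blast
  let ?w = "\<lambda>x. if x \<in> A then 0 else u x" and ?a = "\<lambda>x. if x \<in> A then u x else 0"
  have a: "?a \<in> l2" by (rule l2_finite_support[OF A(1)]) auto
  have w: "?w \<in> l2" using l2_diff[OF assms(1) a] by (rule back_subst[where P="\<lambda>f. f \<in> l2"]) auto
  have "l2sq ?w = (\<Sum>\<^sub>\<infinity>x. (u x)^2 - (?a x)^2)"
    unfolding l2sq_def by (intro infsum_cong) auto
  also have "\<dots> = l2sq u - (\<Sum>\<^sub>\<infinity>x. (?a x)^2)"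
    using assms(1) a unfolding l2sq_def by (intro infsum_diff_real) (auto simp: l2_def)
  also have "(\<Sum>\<^sub>\<infinity>x. (?a x)^2) = (\<Sum>\<^sub>\<infinity>x\<in>A. (u x)^2)"
    by (rule infsum_cong_neutral) auto
  finally have "l2sq ?w \<le> e" using A by (simp add: dist_real_def)
  then show ?thesis using that A w by blast
qed

text \<open>Bounded pointwise null sequences are weakly null in \<open>l2\<close>: cut \<open>v\<close> off outside a finite set and
estimate the remainder by Cauchy--Schwarz.\<close>

lemma l2ip_tendsto_0:
  assumes "v \<in> l2" and "\<And>n. w n \<in> l2" and "\<And>n. l2sq (w n) \<le> b" and "\<And>x. (\<lambda>n. w n x) \<longlonglongrightarrow> 0"
  shows "(\<lambda>n. l2ip v (w n)) \<longlonglongrightarrow> 0"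
proof (rule LIMSEQ_I)
  fix r :: real assume r: "0 < r"
  have b: "0 \<le> b" using assms(3)[of 0] l2sq_nonneg[of "w 0"] by linarith
  define e where "e = (r / (2 * (sqrt b + 1)))^2"
  have e: "0 < e" using r b unfolding e_def by (smt (verit, best) divide_pos_pos real_sqrt_ge_zero zero_less_power)
  obtain A where A: "finite A" "(\<lambda>x. if x \<in> A then 0 else v x) \<in> l2"
    "l2sq (\<lambda>x. if x \<in> A then 0 else v x) \<le> e" (is "l2sq ?v \<le> e")
    using l2_truncate[OF assms(1) e] by blast
  have sp: "l2ip v (w n) = (\<Sum>x\<in>A. v x * w n x) + l2ip ?v (w n)" for n
  proof -
    have "(\<Sum>\<^sub>\<infinity>x. v x * w n x) = (\<Sum>\<^sub>\<infinity>x. (if x \<in> A then v x * w n x else 0) + ?v x * w n x)"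
      by (intro infsum_cong) auto
    also have "\<dots> = (\<Sum>\<^sub>\<infinity>x. if x \<in> A then v x * w n x else 0) + (\<Sum>\<^sub>\<infinity>x. ?v x * w n x)"
      by (rule infsum_add[OF finite_nonzero_values_imp_summable_on l2_mult_summable(1)[OF A(2) assms(2)]])
         (auto intro: finite_subset[OF _ A(1)])
    also have "(\<Sum>\<^sub>\<infinity>x. if x \<in> A then v x * w n x else 0) = (\<Sum>\<^sub>\<infinity>x\<in>A. v x * w n x)"
      by (rule infsum_cong_neutral) auto
    finally show ?thesis using A(1) by (simp add: l2ip_def)
  qed
  have tail: "\<bar>l2ip ?v (w n)\<bar> \<le> r / 2" for n
  proof -
    have "\<bar>l2ip ?v (w n)\<bar> \<le> (\<Sum>\<^sub>\<infinity>x. \<bar>?v x\<bar> * \<bar>w n x\<bar>)"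
      unfolding l2ip_def by (rule abs_infsum_le[OF l2_mult_summable(2)[OF A(2) assms(2)]]) (simp add: abs_mult)
    also have "\<dots> \<le> sqrt (l2sq ?v) * sqrt (l2sq (w n))"
      by (rule l2_Cauchy_Schwarz[OF A(2) assms(2)])
    also have "\<dots> \<le> sqrt e * (sqrt b + 1)"
    proof (rule mult_mono)
      have "sqrt (l2sq (w n)) \<le> sqrt b" using assms(3) by simp
      then show "sqrt (l2sq (w n)) \<le> sqrt b + 1" by linarith
    qed (use A(3) e in auto)
    also have "sqrt e = r / (2 * (sqrt b + 1))" using r b unfolding e_def by (simp add: )
    also have "r / (2 * (sqrt b + 1)) * (sqrt b + 1) = r / 2"
      using b real_sqrt_ge_zero[of b] by (simp add: field_simps add_nonneg_eq_0_iff)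
    finally show ?thesis .
  qed
  have "(\<lambda>n. \<Sum>x\<in>A. v x * w n x) \<longlonglongrightarrow> (\<Sum>x\<in>A. v x * 0)"
    using assms(4) by (intro tendsto_intros)
  from LIMSEQ_D[OF this, of "r / 2"] obtain N where "\<And>n. n \<ge> N \<Longrightarrow> \<bar>\<Sum>x\<in>A. v x * w n x\<bar> < r / 2"
    using r by auto
  then show "\<exists>N. \<forall>n\<ge>N. norm (l2ip v (w n) - 0) < r"
    using tail sp by (intro exI[of _ N]) (smt (verit) real_norm_def field_sum_of_halves)
qed

section \<open>Sums of quadratic type\<close>

text \<open>All nonlinear terms of the problem have this form, with a weight \<open>\<mu>\<close> that is continuous and
vanishes at 0. The factor \<open>(u x)\<^sup>2\<close> carries the summability, so that continuity of \<open>\<mu>\<close> suffices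
for the analysis; an element of \<open>l2\<close> is bounded, and \<open>\<mu>\<close> matters only on a compact interval.\<close>

definition quad_sum :: "(real \<Rightarrow> real) \<Rightarrow> ('a \<Rightarrow> real) \<Rightarrow> real" where
  "quad_sum \<mu> u = (\<Sum>\<^sub>\<infinity>x. (u x)^2 * \<mu> (u x))"

lemma quad_summable:
  assumes "continuous_on UNIV \<mu>" "u \<in> l2"
  shows "(\<lambda>x. (u x)^2 * \<mu> (u x :: real) :: real) summable_on UNIV"
proof -
  let ?R = "sqrt (l2sq u)"
  have "compact (\<mu> ` {-?R..?R})"
    by (intro compact_continuous_image continuous_on_subset[OF assms(1)]) auto
  then obtain C where C: "\<And>s. s \<in> {-?R..?R} \<Longrightarrow> \<bar>\<mu> s\<bar> \<le> C"
    using compact_imp_bounded bounded_iff by (metis imageI real_norm_def)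
  have "u x \<in> {-?R..?R}" for x
    using l2_pointwise_le[OF assms(2), of x] by (auto simp: abs_le_iff)
  then have b: "\<bar>(u x)^2 * \<mu> (u x)\<bar> \<le> C * (u x)^2" for x
    using mult_left_mono[OF C, of "u x" "(u x)^2"] by (simp add: abs_mult mult.commute)
  show ?thesis
    by (rule summable_on_dominated[OF summable_on_cmult_right[OF l2_summable[OF assms(2)]] b])
qed

lemma continuous_bounded_on_interval:
  fixes \<mu> :: "real \<Rightarrow> real"
  assumes "continuous_on UNIV \<mu>"
  obtains C where "0 < C" "\<And>s. \<bar>s\<bar> \<le> R \<Longrightarrow> \<bar>\<mu> s\<bar> \<le> C"
proof -
  have "compact (\<mu> ` {-R..R})"
    by (intro compact_continuous_image continuous_on_subset[OF assms(1)]) auto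
  then obtain C where C: "0 < C" "\<forall>y\<in>\<mu> ` {-R..R}. \<bar>y\<bar> \<le> C"
    using compact_imp_bounded bounded_pos by (metis real_norm_def)
  then show ?thesis by (intro that[of C]) (auto simp: abs_le_iff)
qed

lemma continuous_uniform_on_interval:
  fixes \<mu> :: "real \<Rightarrow> real"
  assumes "continuous_on UNIV \<mu>" "0 < e"
  obtains d where "0 < d" "\<And>a b. \<bar>a\<bar> \<le> R \<Longrightarrow> \<bar>b\<bar> \<le> R \<Longrightarrow> \<bar>a - b\<bar> < d \<Longrightarrow> \<bar>\<mu> a - \<mu> b\<bar> < e"
proof -
  have "uniformly_continuous_on {-R..R} \<mu>"
    by (intro compact_uniformly_continuous continuous_on_subset[OF assms(1)]) auto
  then obtain d where "0 < d" "\<forall>a\<in>{-R..R}. \<forall>b\<in>{-R..R}. dist b a < d \<longrightarrow> dist (\<mu> b) (\<mu> a) < e"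
    using assms(2) unfolding uniformly_continuous_on_def by blast
  then show ?thesis by (intro that[of d]) (auto simp: abs_le_iff dist_real_def)
qed

text \<open>This pointwise bound is chosen so that it can be summed over the lattice: write
\<open>a\<^sup>2 \<mu> a - b\<^sup>2 \<mu> b = (a\<^sup>2 - b\<^sup>2) \<mu> a + b\<^sup>2 (\<mu> a - \<mu> b)\<close>, bound \<open>\<mu>\<close> in the first term, use its uniform
continuity in the second one, and absorb the mixed product \<open>\<bar>b\<bar> \<bar>a - b\<bar>\<close> by Young's inequality.\<close>

lemma quadratic_increment:
  fixes \<mu> :: "real \<Rightarrow> real"
  assumes "continuous_on UNIV \<mu>" "0 < e"
  obtains C d where "0 < C" "0 < d"
    "\<And>a b. \<bar>a\<bar> \<le> R \<Longrightarrow> \<bar>b\<bar> \<le> R \<Longrightarrow> \<bar>a - b\<bar> < d \<Longrightarrow>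
       \<bar>a^2 * \<mu> a - b^2 * \<mu> b\<bar> \<le> C * (a - b)^2 + e * b^2"
proof -
  obtain C where C: "0 < C" "\<And>s. \<bar>s\<bar> \<le> R \<Longrightarrow> \<bar>\<mu> s\<bar> \<le> C"
    using continuous_bounded_on_interval[OF assms(1)] by blast
  obtain d where d: "0 < d" "\<And>a b. \<bar>a\<bar> \<le> R \<Longrightarrow> \<bar>b\<bar> \<le> R \<Longrightarrow> \<bar>a - b\<bar> < d \<Longrightarrow> \<bar>\<mu> a - \<mu> b\<bar> < e/2"
    using continuous_uniform_on_interval[OF assms(1), of "e/2"] assms(2) by auto
  define D where "D = C + 2 * C^2 / e"
  show ?thesis
  proof (rule that[of D d])
    show "0 < D" "0 < d" using C(1) d(1) assms(2) by (auto simp: D_def add_pos_nonneg)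
    fix a b :: real assume ab: "\<bar>a\<bar> \<le> R" "\<bar>b\<bar> \<le> R" "\<bar>a - b\<bar> < d"
    have "a^2 * \<mu> a - b^2 * \<mu> b = ((a - b)^2 + 2 * (b * (a - b))) * \<mu> a + b^2 * (\<mu> a - \<mu> b)"
      by (simp add: algebra_simps power2_eq_square)
    also have "\<bar>\<dots>\<bar> \<le> ((a - b)^2 + 2 * (\<bar>b\<bar> * \<bar>a - b\<bar>)) * C + b^2 * (e / 2)"
    proof -
      have "\<bar>((a - b)^2 + 2 * (b * (a - b))) * \<mu> a\<bar> \<le> ((a - b)^2 + 2 * (\<bar>b\<bar> * \<bar>a - b\<bar>)) * C"
        unfolding abs_mult
      proof (rule mult_mono)
        show "\<bar>(a - b)^2 + 2 * (b * (a - b))\<bar> \<le> (a - b)^2 + 2 * (\<bar>b\<bar> * \<bar>a - b\<bar>)"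
          by (rule order_trans[OF abs_triangle_ineq]) (simp add: abs_mult)
      qed (use C(2)[OF ab(1)] in auto)
      moreover have "\<bar>b^2 * (\<mu> a - \<mu> b)\<bar> \<le> b^2 * (e / 2)"
        unfolding abs_mult using mult_left_mono[OF less_imp_le[OF d(2)[OF ab]], of "b^2"] by simp
      ultimately show ?thesis by linarith
    qed
    also have "2 * (\<bar>b\<bar> * \<bar>a - b\<bar>) * C \<le> 2 * C^2 / e * (a - b)^2 + e / 2 * b^2"
    proof -
      have "0 \<le> (2 * C * \<bar>a - b\<bar> - e * \<bar>b\<bar>)^2" by simp
      then have "4 * C * e * (\<bar>b\<bar> * \<bar>a - b\<bar>) \<le> 4 * C^2 * (a - b)^2 + e^2 * b^2"
        by (simp add: power2_diff power_mult_distrib algebra_simps)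
      then show ?thesis using assms(2) by (simp add: field_simps power2_eq_square)
    qed
    then have "((a - b)^2 + 2 * (\<bar>b\<bar> * \<bar>a - b\<bar>)) * C + b^2 * (e / 2) \<le> D * (a - b)^2 + e * b^2"
      unfolding D_def by (simp add: algebra_simps)
    finally show "\<bar>a^2 * \<mu> a - b^2 * \<mu> b\<bar> \<le> D * (a - b)^2 + e * b^2" .
  qed
qed

lemma quad_sum_uniformly_continuous:
  fixes \<mu> :: "real \<Rightarrow> real"
  assumes "continuous_on UNIV \<mu>" "0 < e"
  obtains d where "0 < d"
    "\<And>u v. u \<in> l2 \<Longrightarrow> v \<in> l2 \<Longrightarrow> l2sq u \<le> M \<Longrightarrow> l2sq v \<le> M \<Longrightarrow> l2sq (\<lambda>x. u x - v x) < d \<Longrightarrow>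
       \<bar>quad_sum \<mu> u - quad_sum \<mu> v\<bar> < e"
proof -
  define e' where "e' = e / (2 * (\<bar>M\<bar> + 1))"
  have e': "0 < e'" using assms(2) by (simp add: e'_def)
  obtain C d where Cd: "0 < C" "0 < d"
    "\<And>a b. \<bar>a\<bar> \<le> sqrt M \<Longrightarrow> \<bar>b\<bar> \<le> sqrt M \<Longrightarrow> \<bar>a - b\<bar> < d \<Longrightarrow>
       \<bar>a^2 * \<mu> a - b^2 * \<mu> b\<bar> \<le> C * (a - b)^2 + e' * b^2"
    using quadratic_increment[OF assms(1) e'] by blast
  show ?thesis
  proof (rule that[of "min (d^2) (e / (2 * C))"])
    show "0 < min (d^2) (e / (2 * C))" using Cd assms(2) by simp
    fix u v :: "'b \<Rightarrow> real"
    assume uv: "u \<in> l2" "v \<in> l2" "l2sq u \<le> M" "l2sq v \<le> M" "l2sq (\<lambda>x. u x - v x) < min (d^2) (e / (2 * C))"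
    note w = l2_diff[OF uv(1,2)]
    have b: "\<bar>u x\<bar> \<le> sqrt M" "\<bar>v x\<bar> \<le> sqrt M" "\<bar>u x - v x\<bar> < d" for x
    proof -
      show "\<bar>u x\<bar> \<le> sqrt M" "\<bar>v x\<bar> \<le> sqrt M"
        using l2_pointwise_le[OF uv(1), of x] l2_pointwise_le[OF uv(2), of x] uv(3,4)
        by (meson order_trans real_sqrt_le_mono)+
      have "\<bar>u x - v x\<bar> \<le> sqrt (l2sq (\<lambda>x. u x - v x))" using l2_pointwise_le[OF w, of x] by simp
      also have "\<dots> < d" using uv(5) Cd(2) by (intro real_less_lsqrt) auto
      finally show "\<bar>u x - v x\<bar> < d" .
    qed
    note s = quad_summable[OF assms(1)]
    have "quad_sum \<mu> u - quad_sum \<mu> v =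
        (\<Sum>\<^sub>\<infinity>x. (u x)^2 * \<mu> (u x) - (v x)^2 * \<mu> (v x))"
      unfolding quad_sum_def by (rule infsum_diff_real[symmetric, OF s[OF uv(1)] s[OF uv(2)]])
    also have "\<bar>\<dots>\<bar> \<le> (\<Sum>\<^sub>\<infinity>x. C * (u x - v x)^2 + e' * (v x)^2)"
      by (rule abs_infsum_le[OF summable_on_add[OF summable_on_cmult_right[OF l2_summable[OF w]]
                summable_on_cmult_right[OF l2_summable[OF uv(2)]]]]) (use Cd(3)[OF b] in auto)
    also have "\<dots> = C * l2sq (\<lambda>x. u x - v x) + e' * l2sq v"
      using l2_summable[OF w] l2_summable[OF uv(2)]
      by (simp add: infsum_add summable_on_cmult_right infsum_cmult_right' l2sq_def)
    also have "\<dots> < e / 2 + e / 2"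
    proof (rule add_less_le_mono)
      show "C * l2sq (\<lambda>x. u x - v x) < e / 2" using uv(5) Cd(1) by (simp add: field_simps)
      have "e' * l2sq v \<le> e' * (\<bar>M\<bar> + 1)" using uv(4) e' by (intro mult_left_mono) auto
      also have "\<dots> = e / 2"
        unfolding e'_def by (rule divide_mult_cancel) linarith
      finally show "e' * l2sq v \<le> e / 2" .
    qed
    finally show "\<bar>quad_sum \<mu> u - quad_sum \<mu> v\<bar> < e" by simp
  qed
qed

text \<open>A Brezis--Lieb lemma. Replace \<open>v\<close> by a truncation \<open>t\<close> of finite support; by uniform continuity this
changes every sum by little. For \<open>t\<close> the difference \<open>quad_sum \<mu> (u n) - quad_sum \<mu> (u n - t) - quad_sum \<mu> t\<close>
is a finite sum, to which pointwise convergence applies.\<close>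

lemma quad_sum_split:
  fixes \<mu> :: "real \<Rightarrow> real" and u :: "nat \<Rightarrow> 'a \<Rightarrow> real"
  assumes \<mu>: "continuous_on UNIV \<mu>"
    and u: "\<And>n. u n \<in> l2" "\<And>n. l2sq (u n) \<le> M" "\<And>x. (\<lambda>n. u n x) \<longlonglongrightarrow> v x"
  shows "(\<lambda>n. quad_sum \<mu> (u n) - quad_sum \<mu> (\<lambda>x. u n x - v x)) \<longlonglongrightarrow> quad_sum \<mu> v"
proof (rule LIMSEQ_I)
  let ?S = "quad_sum \<mu> :: ('a \<Rightarrow> real) \<Rightarrow> real"
  fix r :: real assume r: "0 < r"
  have v: "v \<in> l2" "l2sq v \<le> M" using l2_pointwise_limit[OF u] by auto
  have M: "0 \<le> M" using v(2) l2sq_nonneg order_trans by blast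
  have "0 < r/4" using r by simp
  from quad_sum_uniformly_continuous[OF \<mu> this, of "4 * M"]
  obtain d where d: "0 < d" "\<And>u v :: 'a \<Rightarrow> real. u \<in> l2 \<Longrightarrow> v \<in> l2 \<Longrightarrow> l2sq u \<le> 4 * M \<Longrightarrow> l2sq v \<le> 4 * M \<Longrightarrow>
      l2sq (\<lambda>x. u x - v x) < d \<Longrightarrow> \<bar>?S u - ?S v\<bar> < r/4"
    by blast
  have "0 < d / 2" using d(1) by simp
  from l2_truncate[OF v(1) this]
  obtain A where A: "finite A" "(\<lambda>x. if x \<in> A then 0 else v x) \<in> l2" "l2sq (\<lambda>x. if x \<in> A then 0 else v x) \<le> d/2"
    by blast
  define t where "t x = (if x \<in> A then v x else 0)" for x
  have t: "t \<in> l2" "l2sq t \<le> M"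
  proof -
    show "t \<in> l2" by (rule l2_finite_support[OF A(1)]) (simp add: t_def)
    then show "l2sq t \<le> M"
      unfolding l2sq_def
      by (intro order_trans[OF infsum_mono v(2)[unfolded l2sq_def]]) (use v(1) in \<open>auto simp: l2_def t_def\<close>)
  qed
  have vt: "(\<lambda>x. v x - t x) = (\<lambda>x. if x \<in> A then 0 else v x)" by (auto simp: t_def)
  have diff_le: "l2sq (\<lambda>x. u n x - w x) \<le> 4 * M" if "w \<in> l2" "l2sq w \<le> M" for w n
    using l2sq_add_le[OF u(1) l2_scale[OF that(1), of "-1"], of n] u(2)[of n] that(2) l2sq_scale[of "-1" w]
    by simp
  have s: "(\<lambda>x. (w x)^2 * \<mu> (w x)) summable_on UNIV" if "w \<in> l2" for w :: "'a \<Rightarrow> real"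
    by (rule quad_summable[OF \<mu> that])
  define \<phi> where "\<phi> y = y^2 * \<mu> y" for y
  have split: "?S (u n) - ?S (\<lambda>x. u n x - t x) - ?S t = (\<Sum>x\<in>A. \<phi> (u n x) - \<phi> (u n x - v x) - \<phi> (v x))" for n
  proof -
    have "?S (u n) - ?S (\<lambda>x. u n x - t x) - ?S t = (\<Sum>\<^sub>\<infinity>x. \<phi> (u n x) - \<phi> (u n x - t x) - \<phi> (t x))"
      unfolding quad_sum_def \<phi>_def using s[OF u(1)] s[OF l2_diff[OF u(1) t(1)]] s[OF t(1)]
      by (simp add: infsum_diff_real summable_on_diff_real)
    also have "\<dots> = (\<Sum>\<^sub>\<infinity>x\<in>A. \<phi> (u n x) - \<phi> (u n x - v x) - \<phi> (v x))"
      by (rule infsum_cong_neutral) (auto simp: t_def \<phi>_def)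
    finally show ?thesis using A(1) by simp
  qed
  have \<phi>: "isCont \<phi> y" for y
    unfolding \<phi>_def using \<mu> by (auto intro!: continuous_intros simp: continuous_on_eq_continuous_at)
  have "(\<lambda>n. \<Sum>x\<in>A. \<phi> (u n x) - \<phi> (u n x - v x) - \<phi> (v x)) \<longlonglongrightarrow> (\<Sum>x\<in>A. \<phi> (v x) - \<phi> (v x - v x) - \<phi> (v x))"
    by (intro tendsto_sum tendsto_diff isCont_tendsto_compose[OF \<phi>] tendsto_const u(3))
  from LIMSEQ_D[OF this, of "r/4"] r obtain N where
    N: "\<And>n. n \<ge> N \<Longrightarrow> \<bar>\<Sum>x\<in>A. \<phi> (u n x) - \<phi> (u n x - v x) - \<phi> (v x)\<bar> < r/4"
    by (auto simp: \<phi>_def)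
  show "\<exists>N. \<forall>n\<ge>N. norm (?S (u n) - ?S (\<lambda>x. u n x - v x) - ?S v) < r"
  proof (intro exI[of _ N] allI impI)
    fix n assume n: "n \<ge> N"
    have 1: "\<bar>?S v - ?S t\<bar> < r/4"
      by (rule d(2)) (use v t M A(3) vt d(1) in auto)
    have "(\<lambda>x. (u n x - t x) - (u n x - v x)) = (\<lambda>x. v x - t x)" by auto
    then have 2: "\<bar>?S (\<lambda>x. u n x - t x) - ?S (\<lambda>x. u n x - v x)\<bar> < r/4"
      by (intro d(2) l2_diff u t v diff_le) (use A(3) vt d(1) in auto)
    show "norm (?S (u n) - ?S (\<lambda>x. u n x - v x) - ?S v) < r"
      using 1 2 N[OF n] split[of n] r unfolding real_norm_def by linarith
  qed
qed

text \<open>Scaling a function and perturbing it in a fixed direction are the only deformations in the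
variational argument; continuity along lines serves the intermediate value theorem for both.\<close>

lemma quad_sum_isCont_line:
  fixes \<mu> :: "real \<Rightarrow> real"
  assumes \<mu>: "continuous_on UNIV \<mu>" and u: "u \<in> l2" and v: "v \<in> l2"
  shows "isCont (\<lambda>s. quad_sum \<mu> (\<lambda>x. u x + s * v x)) s0"
  unfolding isCont_def
proof (rule LIM_I)
  fix e :: real assume e: "0 < e"
  define M where "M = 2 * l2sq u + 2 * ((\<bar>s0\<bar> + 1)^2 * l2sq v)"
  have M: "l2sq (\<lambda>x. u x + s * v x) \<le> M" if "\<bar>s\<bar> \<le> \<bar>s0\<bar> + 1" for s
  proof -
    have "s^2 \<le> (\<bar>s0\<bar> + 1)^2" using that by (metis abs_ge_zero power2_abs power_mono)
    then have "s^2 * l2sq v \<le> (\<bar>s0\<bar> + 1)^2 * l2sq v" by (intro mult_right_mono) auto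
    then show ?thesis
      using l2sq_add_le[OF u l2_scale[OF v, of s]] unfolding M_def l2sq_scale by linarith
  qed
  obtain d where d: "0 < d" "\<And>u v :: 'a \<Rightarrow> real. u \<in> l2 \<Longrightarrow> v \<in> l2 \<Longrightarrow> l2sq u \<le> M \<Longrightarrow> l2sq v \<le> M \<Longrightarrow>
      l2sq (\<lambda>x. u x - v x) < d \<Longrightarrow> \<bar>quad_sum \<mu> u - quad_sum \<mu> v\<bar> < e"
    using quad_sum_uniformly_continuous[OF \<mu> e, of M] by blast
  define r where "r = min 1 (sqrt (d / (l2sq v + 1)))"
  show "\<exists>r>0. \<forall>s. s \<noteq> s0 \<and> norm (s - s0) < r \<longrightarrow>
      norm (quad_sum \<mu> (\<lambda>x. u x + s * v x) - quad_sum \<mu> (\<lambda>x. u x + s0 * v x)) < e"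
  proof (intro exI[of _ r] conjI allI impI)
    show "0 < r" using d(1) by (simp add: r_def add_nonneg_pos)
    fix s assume s: "s \<noteq> s0 \<and> norm (s - s0) < r"
    then have s1: "\<bar>s - s0\<bar> < 1" "\<bar>s - s0\<bar> < sqrt (d / (l2sq v + 1))" by (auto simp: r_def)
    have "(s - s0)^2 * (l2sq v + 1) < d"
      using real_sqrt_less_iff[of "(s-s0)^2" "d / (l2sq v + 1)"] s1(2)
      by (simp add: pos_less_divide_eq add_nonneg_pos)
    then have "l2sq (\<lambda>x. (s - s0) * v x) < d"
      unfolding l2sq_scale distrib_left mult_1_right using zero_le_power2[of "s - s0"] by linarith
    moreover have "(\<lambda>x. (s - s0) * v x) = (\<lambda>x. (u x + s * v x) - (u x + s0 * v x))"
      by (simp add: algebra_simps)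
    ultimately show "norm (quad_sum \<mu> (\<lambda>x. u x + s * v x) - quad_sum \<mu> (\<lambda>x. u x + s0 * v x)) < e"
      unfolding real_norm_def by (intro d(2) l2_add l2_scale u v M) (use s1(1) in auto)
  qed
qed

section \<open>Superquadratic potentials\<close>

lemma continuous_real_if_small_at:
  fixes f :: "real \<Rightarrow> real"
  assumes "continuous_on UNIV f" "f 0 = 0" "0 < e"
  obtains r where "0 < r" "\<And>s. \<bar>s\<bar> \<le> r \<Longrightarrow> \<bar>f s\<bar> \<le> e"
proof -
  have "isCont f 0" using assms(1) by (simp add: continuous_on_eq_continuous_at)
  from LIM_D[OF this[unfolded isCont_def] assms(3)] obtain r where
    r: "0 < r" "\<And>s. s \<noteq> 0 \<Longrightarrow> \<bar>s\<bar> < r \<Longrightarrow> \<bar>f s\<bar> < e" using assms(2) by auto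
  show ?thesis
  proof (rule that[of "r/2"])
    show "0 < r/2" using r(1) by simp
    fix s assume "\<bar>s\<bar> \<le> r/2"
    then have "\<bar>s\<bar> < r" using r(1) by linarith
    then show "\<bar>f s\<bar> \<le> e" using r(2)[of s] assms(2,3) by (cases "s = 0") simp_all
  qed
qed

text \<open>For the nonlinearity \<open>g\<close> take \<open>m s = g s / s\<close> and let \<open>G\<close> be its primitive. Monotonicity along rays
from the origin treats both signs of \<open>s\<close> at once: \<open>m\<close> increases on the positive and decreases on
the negative axis.\<close>

locale superquadratic_potential =
  fixes m G :: "real \<Rightarrow> real"
  assumes m_cont: "continuous_on UNIV m"
    and m0: "m 0 = 0"
    and m_ray: "\<And>s t1 t2. s \<noteq> 0 \<Longrightarrow> 0 \<le> t1 \<Longrightarrow> t1 < t2 \<Longrightarrow> m (t1 * s) < m (t2 * s)"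
    and G0: "G 0 = 0"
    and G_deriv: "\<And>s. (G has_real_derivative s * m s) (at s)"
    and G_super: "\<And>C. \<exists>R. \<forall>s. R \<le> \<bar>s\<bar> \<longrightarrow> C * s^2 \<le> G s"
begin

lemma m_ray_le: "0 \<le> t1 \<Longrightarrow> t1 \<le> t2 \<Longrightarrow> m (t1 * s) \<le> m (t2 * s)"
  using m_ray[of s t1 t2] by (cases "s = 0"; cases "t1 = t2") auto

lemma m_nonneg: "0 \<le> m s"
  using m_ray_le[of 0 1 s] by (simp add: m0)

text \<open>The derivative of \<open>t \<mapsto> G (t * s)\<close> is \<open>s\<^sup>2 t m (t s)\<close>, and on \<open>[t1, t2]\<close> the value of \<open>m\<close> lies between
its values at the end points.\<close>

lemma G_ray:
  assumes "0 \<le> t1" "t1 \<le> t2"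
  shows "s^2 * m (t1 * s) * (t2^2 - t1^2) / 2 \<le> G (t2 * s) - G (t1 * s)"
    and "G (t2 * s) - G (t1 * s) \<le> s^2 * m (t2 * s) * (t2^2 - t1^2) / 2"
proof -
  have d: "((\<lambda>t. G (t * s)) has_real_derivative s^2 * t * m (t * s)) (at t)" for t
    by (rule DERIV_cong[OF DERIV_chain2[OF G_deriv]]) (auto intro!: derivative_eq_intros simp: power2_eq_square)
  have "G (t1 * s) - s^2 * m (t1 * s) * t1^2 / 2 \<le> G (t2 * s) - s^2 * m (t1 * s) * t2^2 / 2"
  proof (rule DERIV_nonneg_imp_nondecreasing[OF assms(2)])
    fix t assume t: "t1 \<le> t" "t \<le> t2"
    have "((\<lambda>t. G (t * s) - s^2 * m (t1 * s) * t^2 / 2) has_real_derivative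
        s^2 * t * m (t * s) - s^2 * m (t1 * s) * t) (at t)"
      by (rule DERIV_diff[OF d]) (auto intro!: derivative_eq_intros)
    moreover have "s^2 * t * m (t * s) - s^2 * m (t1 * s) * t = s^2 * t * (m (t * s) - m (t1 * s))"
      by (simp add: algebra_simps)
    moreover have "0 \<le> s^2 * t * (m (t * s) - m (t1 * s))"
      using m_ray_le[of t1 t s] t assms by (intro mult_nonneg_nonneg) auto
    ultimately show "\<exists>y. ((\<lambda>t. G (t * s) - s^2 * m (t1 * s) * t^2 / 2) has_real_derivative y) (at t) \<and> 0 \<le> y"
      by (intro exI conjI) (assumption, simp only:)
  qed
  then show "s^2 * m (t1 * s) * (t2^2 - t1^2) / 2 \<le> G (t2 * s) - G (t1 * s)"
    by (simp add: field_simps)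
  have "s^2 * m (t2 * s) * t1^2 / 2 - G (t1 * s) \<le> s^2 * m (t2 * s) * t2^2 / 2 - G (t2 * s)"
  proof (rule DERIV_nonneg_imp_nondecreasing[OF assms(2)])
    fix t assume t: "t1 \<le> t" "t \<le> t2"
    have "((\<lambda>t. s^2 * m (t2 * s) * t^2 / 2 - G (t * s)) has_real_derivative
        s^2 * m (t2 * s) * t - s^2 * t * m (t * s)) (at t)"
      by (rule DERIV_diff[OF _ d]) (auto intro!: derivative_eq_intros)
    moreover have "s^2 * m (t2 * s) * t - s^2 * t * m (t * s) = s^2 * t * (m (t2 * s) - m (t * s))"
      by (simp add: algebra_simps)
    moreover have "0 \<le> s^2 * t * (m (t2 * s) - m (t * s))"
      using m_ray_le[of t t2 s] t assms by (intro mult_nonneg_nonneg) auto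
    ultimately show "\<exists>y. ((\<lambda>t. s^2 * m (t2 * s) * t^2 / 2 - G (t * s)) has_real_derivative y) (at t) \<and> 0 \<le> y"
      by (intro exI conjI) (assumption, simp only:)
  qed
  then show "G (t2 * s) - G (t1 * s) \<le> s^2 * m (t2 * s) * (t2^2 - t1^2) / 2"
    by (simp add: field_simps)
qed

lemma G_bounds: "0 \<le> G s" "G s \<le> s^2 * m s / 2"
  using G_ray[of 0 1 s] by (simp_all add: G0 m0)

text \<open>
\<open>K s = g s * s / 2 - G s\<close> is the density of the energy on the Nehari manifold. It and \<open>G\<close> are
\<open>s\<^sup>2\<close> times the continuous weights \<open>kq\<close> and \<open>gq\<close>; at \<open>s = 0\<close> the quotient is 0, which is also the
limit there.
\<close>

definition gq :: "real \<Rightarrow> real" where "gq s = G s / s^2"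

definition kq :: "real \<Rightarrow> real" where "kq s = m s / 2 - gq s"

definition K :: "real \<Rightarrow> real" where "K s = s^2 * m s / 2 - G s"

lemma G_eq_gq: "G s = s^2 * gq s"
  by (cases "s = 0") (simp_all add: gq_def G0)

lemma K_eq_kq: "K s = s^2 * kq s"
  by (simp add: K_def kq_def G_eq_gq right_diff_distrib)

lemma gq_cont: "continuous_on UNIV gq"
proof -
  have "isCont gq s" for s
  proof (cases "s = 0")
    case False
    then show ?thesis
      unfolding gq_def using DERIV_isCont[OF G_deriv] by (intro continuous_intros) auto
  next
    case True
    have "(\<lambda>s. m s) \<midarrow>0\<rightarrow> m 0"
      using m_cont by (simp add: continuous_on_eq_continuous_at isCont_def)
    then have "m \<midarrow>0\<rightarrow> 0" by (simp add: m0)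
    then have "gq \<midarrow>0\<rightarrow> 0"
    proof (rule Lim_null_comparison[rotated])
      have "norm (gq s) \<le> m s" if "s \<noteq> 0" for s
        using G_bounds[of s] that m_nonneg[of s] by (simp add: gq_def field_simps)
      then show "\<forall>\<^sub>F s in at 0. norm (gq s) \<le> m s"
        by (auto simp: eventually_at intro!: exI[of _ 1])
    qed
    then show ?thesis unfolding isCont_def True by (simp add: gq_def G0)
  qed
  then show ?thesis by (simp add: continuous_on_eq_continuous_at)
qed

lemma kq_cont: "continuous_on UNIV kq"
  unfolding kq_def by (intro continuous_intros gq_cont m_cont) auto

lemma m_unbounded: "\<exists>R. \<forall>s. R \<le> \<bar>s\<bar> \<longrightarrow> C \<le> m s"
proof -
  obtain R where R: "\<And>s. R \<le> \<bar>s\<bar> \<Longrightarrow> \<bar>C\<bar> * s^2 \<le> G s" using G_super by blast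
  have "C \<le> m s" if "max R 1 \<le> \<bar>s\<bar>" for s
  proof -
    have "s^2 * \<bar>C\<bar> \<le> s^2 * (m s / 2)" using R[of s] that G_bounds(2)[of s] by (simp add: mult.commute)
    moreover have "0 < s^2" using that by auto
    ultimately have "\<bar>C\<bar> \<le> m s / 2" by (simp only: mult_le_cancel_left_pos)
    then show ?thesis by linarith
  qed
  then show ?thesis by blast
qed

text \<open>Insert the upper bound for \<open>G (t2 * s) - G (t1 * s)\<close>; what remains is the increment of \<open>m\<close>, weighted
at the smaller parameter. Both the monotonicity and the growth of \<open>K\<close> come from this estimate.\<close>

lemma K_ray:
  assumes "0 \<le> t1" "t1 \<le> t2"
  shows "t1^2 * s^2 * (m (t2 * s) - m (t1 * s)) / 2 \<le> K (t2 * s) - K (t1 * s)"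
  using G_ray(2)[OF assms, of s] unfolding K_def by (simp add: field_simps power_mult_distrib)

lemma K_ray_le:
  assumes "0 \<le> t1" "t1 \<le> t2" shows "K (t1 * s) \<le> K (t2 * s)"
proof -
  have "0 \<le> t1^2 * s^2 * (m (t2 * s) - m (t1 * s)) / 2"
    using m_ray_le[OF assms, of s] by simp
  then show ?thesis using K_ray[OF assms, of s] by linarith
qed

lemma K_ray_less:
  assumes "0 < t1" "t1 < t2" "s \<noteq> 0" shows "K (t1 * s) < K (t2 * s)"
proof -
  have "0 < t1^2 * s^2 * (m (t2 * s) - m (t1 * s)) / 2"
    using m_ray[OF assms(3), of t1 t2] assms by simp
  then show ?thesis using K_ray[of t1 t2 s] assms by linarith
qed

lemma K_0 [simp]: "K 0 = 0" by (simp add: K_def G0)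

lemma K_nonneg: "0 \<le> K s"
  using K_ray_le[of 0 1 s] by simp

lemma K_pos: "s \<noteq> 0 \<Longrightarrow> 0 < K s"
  using K_ray_less[of "1/2" 1 s] K_nonneg[of "1/2 * s"] by simp

lemma ray_through: "0 < r \<Longrightarrow> r \<le> \<bar>s\<bar> \<Longrightarrow> \<exists>t e. 1 \<le> t \<and> (e = r \<or> e = - r) \<and> s = t * e" for r s :: real
  by (intro exI[of _ "\<bar>s\<bar> / r"] exI[of _ "sgn s * r"]) (auto simp: sgn_if abs_if)

lemma K_bounded_below:
  assumes "0 < r"
  obtains k where "0 < k" "\<And>s. r \<le> \<bar>s\<bar> \<Longrightarrow> k \<le> K s"
proof (rule that[of "min (K r) (K (-r))"])
  show "0 < min (K r) (K (-r))" using assms K_pos[of r] K_pos[of "-r"] by simp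
  fix s assume "r \<le> \<bar>s\<bar>"
  then obtain t e where "1 \<le> t" "e = r \<or> e = - r" "s = t * e" using ray_through[OF assms] by blast
  then show "min (K r) (K (-r)) \<le> K s" using K_ray_le[of 1 t e] by auto
qed

text \<open>Compared with the points \<open>1\<close> and \<open>-1\<close>, \<open>K s\<close> exceeds half the increment of \<open>m\<close>, and \<open>m\<close> is unbounded
because \<open>G s \<le> s\<^sup>2 m s / 2\<close> and \<open>G\<close> is superquadratic. Hence an energy bound on the Nehari manifold bounds functions uniformly.\<close>

lemma K_coercive: "\<exists>R. \<forall>s. K s \<le> e \<longrightarrow> \<bar>s\<bar> \<le> R"
proof -
  obtain R where R: "\<And>s. R \<le> \<bar>s\<bar> \<Longrightarrow> 2 * e + max (m 1) (m (-1)) + 1 \<le> m s"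
    using m_unbounded by blast
  have "e < K s" if s: "max R 1 \<le> \<bar>s\<bar>" for s
  proof -
    obtain t d where td: "1 \<le> t" "d = 1 \<or> d = - 1" "s = t * d"
      using ray_through[of 1 s] s by auto
    have "(m s - m d) / 2 \<le> K s - K d"
      using K_ray[of 1 t d] td by (auto simp: )
    then have "m s - m d \<le> 2 * K s" using K_nonneg[of d] by (simp add: field_simps)
    moreover have "m d \<le> max (m 1) (m (-1))" using td(2) by auto
    ultimately show ?thesis using R[of s] s by linarith
  qed
  then have "\<forall>s. K s \<le> e \<longrightarrow> \<bar>s\<bar> \<le> max R 1" by (meson linear not_le)
  then show ?thesis by blast
qed

text \<open>A first-order expansion of \<open>G\<close> at \<open>b\<close> with the derivative frozen at a nearby point \<open>a\<close>. For \<open>b = a\<close>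
it gives Frechet differentiability of the energy; for \<open>b = t * a\<close> with \<open>t\<close> near 1 it gives the
increments along the curves projected to the Nehari manifold.\<close>

lemma G_increment:
  obtains C where "0 < C" "\<And>e. 0 < e \<Longrightarrow> \<exists>d>0. \<forall>a b r. \<bar>a\<bar> \<le> R \<and> \<bar>b - a\<bar> + \<bar>r\<bar> < d \<longrightarrow>
      \<bar>G (b + r) - G b - a * m a * r\<bar> \<le> \<bar>r\<bar> * (C * (\<bar>b - a\<bar> + \<bar>r\<bar>) + e * \<bar>a\<bar>)"
proof -
  obtain C where C: "0 < C" "\<And>s. \<bar>s\<bar> \<le> R + 1 \<Longrightarrow> \<bar>m s\<bar> \<le> C"
    using continuous_bounded_on_interval[OF m_cont] by blast
  have "\<exists>d>0. \<forall>a b r. \<bar>a\<bar> \<le> R \<and> \<bar>b - a\<bar> + \<bar>r\<bar> < d \<longrightarrow>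
      \<bar>G (b + r) - G b - a * m a * r\<bar> \<le> \<bar>r\<bar> * (C * (\<bar>b - a\<bar> + \<bar>r\<bar>) + e * \<bar>a\<bar>)" if e: "0 < e" for e
  proof -
    obtain d where d: "0 < d" "\<And>a b. \<bar>a\<bar> \<le> R + 1 \<Longrightarrow> \<bar>b\<bar> \<le> R + 1 \<Longrightarrow> \<bar>a - b\<bar> < d \<Longrightarrow> \<bar>m a - m b\<bar> < e"
      using continuous_uniform_on_interval[OF m_cont e] by blast
    show ?thesis
    proof (intro exI[of _ "min d 1"] conjI allI impI)
      show "0 < min d 1" using d(1) by simp
      fix a b r assume "\<bar>a\<bar> \<le> R \<and> \<bar>b - a\<bar> + \<bar>r\<bar> < min d 1"
      then have a: "\<bar>a\<bar> \<le> R" "\<bar>b - a\<bar> + \<bar>r\<bar> < d" "\<bar>b - a\<bar> + \<bar>r\<bar> < 1" by auto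
      have "((\<lambda>t. G (b + t * r)) has_real_derivative r * ((b + t * r) * m (b + t * r))) (at t)" for t
        by (rule DERIV_cong[OF DERIV_chain2[OF G_deriv]]) (auto intro!: derivative_eq_intros)
      from MVT2[of 0 1, OF _ this] obtain z where
        z: "0 < z" "z < 1" "G (b + r) - G b = r * ((b + z * r) * m (b + z * r))" by auto
      define x where "x = b + z * r"
      have "\<bar>z * r\<bar> \<le> 1 * \<bar>r\<bar>" unfolding abs_mult using z by (intro mult_right_mono) auto
      then have xa: "\<bar>x - a\<bar> \<le> \<bar>b - a\<bar> + \<bar>r\<bar>" unfolding x_def by linarith
      have x: "\<bar>x\<bar> \<le> R + 1" "\<bar>x - a\<bar> < d" using xa a by linarith+
      have "x * m x - a * m a = (x - a) * m x + a * (m x - m a)" by (simp add: algebra_simps)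
      also have "\<bar>\<dots>\<bar> \<le> \<bar>x - a\<bar> * \<bar>m x\<bar> + \<bar>a\<bar> * \<bar>m x - m a\<bar>"
        unfolding abs_mult[symmetric] by (rule abs_triangle_ineq)
      also have "\<dots> \<le> (\<bar>b - a\<bar> + \<bar>r\<bar>) * C + \<bar>a\<bar> * e"
        using C(2)[OF x(1)] d(2)[OF x(1) _ x(2)] a(1) xa by (intro add_mono mult_mono) auto
      finally have "\<bar>r\<bar> * \<bar>x * m x - a * m a\<bar> \<le> \<bar>r\<bar> * (C * (\<bar>b - a\<bar> + \<bar>r\<bar>) + e * \<bar>a\<bar>)"
        by (intro mult_left_mono) (simp_all add: mult.commute)
      moreover have "G (b + r) - G b - a * m a * r = r * (x * m x - a * m a)"
        unfolding z(3) x_def by (simp add: algebra_simps)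
      ultimately show "\<bar>G (b + r) - G b - a * m a * r\<bar> \<le> \<bar>r\<bar> * (C * (\<bar>b - a\<bar> + \<bar>r\<bar>) + e * \<bar>a\<bar>)"
        by (simp add: abs_mult)
    qed
  qed
  then show ?thesis using that C(1) by blast
qed

end

section \<open>The infimum over the Nehari manifold is attained\<close>

text \<open>Only these properties of the linear part enter the variational argument: the operator \<open>E\<close> is
bounded from below by \<open>c\<close>, symmetric on \<open>l2\<close>, and its quadratic form is invariant under the
translations of the lattice.\<close>

locale nehari_problem = superquadratic_potential m G for m G :: "real \<Rightarrow> real" +
  fixes E :: "('a::{countable,group_add} \<Rightarrow> real) \<Rightarrow> 'a \<Rightarrow> real" and c :: real
  assumes c_pos: "0 < c"
    and E_l2: "\<And>u. u \<in> l2 \<Longrightarrow> E u \<in> l2"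
    and E_sym: "\<And>u v. u \<in> l2 \<Longrightarrow> v \<in> l2 \<Longrightarrow> l2ip (E u) v = l2ip u (E v)"
    and E_coercive: "\<And>u. u \<in> l2 \<Longrightarrow> c * l2sq u \<le> l2ip (E u) u"
    and E_shift: "\<And>u y. u \<in> l2 \<Longrightarrow> l2ip (E (\<lambda>x. u (x + y))) (\<lambda>x. u (x + y)) = l2ip (E u) u"
begin

text \<open>The letters follow the usual notation: \<open>I\<close> is the energy, \<open>J u\<close> the derivative of \<open>I\<close> at \<open>u\<close> in the
direction \<open>u\<close>, and \<open>N\<close> the Nehari manifold.\<close>

definition Q :: "('a \<Rightarrow> real) \<Rightarrow> real" where "Q u = l2ip (E u) u"

definition J :: "('a \<Rightarrow> real) \<Rightarrow> real" where "J u = Q u - quad_sum m u"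

definition I :: "('a \<Rightarrow> real) \<Rightarrow> real" where "I u = Q u / 2 - quad_sum gq u"

definition N :: "('a \<Rightarrow> real) set" where "N = {u \<in> l2. u \<noteq> (\<lambda>_. 0) \<and> J u = 0}"

lemma form_add:
  assumes "u \<in> l2" "v \<in> l2" "w \<in> l2"
  shows "l2ip (E u) (\<lambda>x. v x + w x) = l2ip (E u) v + l2ip (E u) w"
    and "l2ip (E (\<lambda>x. v x + w x)) u = l2ip (E v) u + l2ip (E w) u"
proof -
  show "l2ip (E u) (\<lambda>x. v x + w x) = l2ip (E u) v + l2ip (E u) w"
    by (rule l2ip_add_right) (use assms E_l2 in auto)
  then show "l2ip (E (\<lambda>x. v x + w x)) u = l2ip (E v) u + l2ip (E w) u"
    using assms by (simp add: E_sym l2_add l2ip_commute[of _ "E u"])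
qed

lemma form_scale:
  assumes "u \<in> l2" "v \<in> l2"
  shows "l2ip (E u) (\<lambda>x. t * v x) = t * l2ip (E u) v"
    and "l2ip (E (\<lambda>x. t * v x)) u = t * l2ip (E v) u"
proof -
  show "l2ip (E u) (\<lambda>x. t * v x) = t * l2ip (E u) v" by (rule l2ip_scale_right)
  then show "l2ip (E (\<lambda>x. t * v x)) u = t * l2ip (E v) u"
    using assms by (simp add: E_sym l2_scale l2ip_commute[of _ "E u"])
qed

lemma Q_add:
  assumes "u \<in> l2" "v \<in> l2"
  shows "Q (\<lambda>x. u x + v x) = Q u + 2 * l2ip (E u) v + Q v"
proof -
  have "l2ip (E v) u = l2ip (E u) v" using E_sym[OF assms(2,1)] l2ip_commute[of v "E u"] by simp
  then show ?thesis using assms by (simp add: Q_def form_add l2_add)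
qed

lemma Q_scale: "u \<in> l2 \<Longrightarrow> Q (\<lambda>x. t * u x) = t^2 * Q u"
  by (simp add: Q_def form_scale l2_scale power2_eq_square)

lemma Q_ge: "u \<in> l2 \<Longrightarrow> c * l2sq u \<le> Q u"
  using E_coercive by (simp add: Q_def)

lemma Q_nonneg: "u \<in> l2 \<Longrightarrow> 0 \<le> Q u"
  using Q_ge[of u] c_pos by (meson l2sq_nonneg less_imp_le mult_nonneg_nonneg order_trans)

lemma l2sq_pos:
  assumes "u \<in> l2" "u \<noteq> (\<lambda>_. 0)" shows "0 < l2sq u"
proof -
  obtain z where z: "u z \<noteq> 0" using assms(2) by blast
  then have "0 < (u z)^2" by simp
  also have "(u z)^2 \<le> l2sq u"
    unfolding l2sq_def by (rule term_le_infsum[OF l2_summable[OF assms(1)]]) simp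
  finally show ?thesis .
qed

lemma quad_sum_gq: "quad_sum gq u = (\<Sum>\<^sub>\<infinity>x. G (u x))"
  by (simp add: quad_sum_def G_eq_gq)

lemma quad_sum_kq: "quad_sum kq u = (\<Sum>\<^sub>\<infinity>x. K (u x))"
  by (simp add: quad_sum_def K_eq_kq)

lemma K_summable: "u \<in> l2 \<Longrightarrow> (\<lambda>x. K (u x)) summable_on UNIV"
  using quad_summable[OF kq_cont] by (simp add: K_eq_kq)

lemma G_summable: "u \<in> l2 \<Longrightarrow> (\<lambda>x. G (u x)) summable_on UNIV"
  using quad_summable[OF gq_cont] by (simp add: G_eq_gq)

lemma quad_sum_kq_eq:
  assumes "u \<in> l2" shows "quad_sum kq u = quad_sum m u / 2 - quad_sum gq u"
proof -
  have "quad_sum kq u = (\<Sum>\<^sub>\<infinity>x. 1/2 * ((u x)^2 * m (u x)) - (u x)^2 * gq (u x))"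
    unfolding quad_sum_def kq_def by (simp add: algebra_simps)
  also have "\<dots> = 1/2 * quad_sum m u - quad_sum gq u"
    unfolding quad_sum_def infsum_cmult_right'[symmetric]
    by (rule infsum_diff_real[OF summable_on_cmult_right[OF quad_summable[OF m_cont assms]]
          quad_summable[OF gq_cont assms]])
  finally show ?thesis by simp
qed

text \<open>Where \<open>J\<close> vanishes, the energy is a sum of nonnegative terms that increase along rays. This does
the work of weak lower semicontinuity.\<close>

lemma I_eq: "u \<in> l2 \<Longrightarrow> I u = J u / 2 + quad_sum kq u"
  by (simp add: I_def J_def quad_sum_kq_eq field_simps)

lemma I_on_N: "u \<in> N \<Longrightarrow> I u = quad_sum kq u"
  by (simp add: N_def I_eq)

lemma quad_sum_m_scaled:
  "quad_sum m (\<lambda>x. t * u x) = t^2 * (\<Sum>\<^sub>\<infinity>x. (u x)^2 * m (t * u x))"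
  unfolding quad_sum_def power_mult_distrib mult.assoc infsum_cmult_right' ..

lemma scaled_summable:
  assumes "u \<in> l2" "t \<noteq> 0"
  shows "(\<lambda>x. (u x)^2 * m (t * u x)) summable_on UNIV"
proof -
  have "(\<lambda>x. t^2 * ((u x)^2 * m (t * u x))) summable_on UNIV"
    using quad_summable[OF m_cont l2_scale[OF assms(1), of t]] by (simp add: power_mult_distrib mult.assoc)
  then show ?thesis using assms(2) by (subst (asm) summable_on_cmult_right') auto
qed

lemma J_scaled:
  assumes "u \<in> l2"
  shows "J (\<lambda>x. t * u x) = t^2 * (Q u - (\<Sum>\<^sub>\<infinity>x. (u x)^2 * m (t * u x)))"
  using assms by (simp add: J_def Q_scale quad_sum_m_scaled right_diff_distrib)

lemma J_shift: "u \<in> l2 \<Longrightarrow> J (\<lambda>x. u (x + y)) = J u"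
  using infsum_shift[of "\<lambda>x. (u x)^2 * m (u x)" y] by (simp add: J_def Q_def E_shift quad_sum_def)

lemma quad_sum_shift: "quad_sum \<mu> (\<lambda>x. u (x + y)) = quad_sum \<mu> (u :: 'a \<Rightarrow> real)"
  using infsum_shift[of "\<lambda>x. (u x)^2 * \<mu> (u x)" y] by (simp add: quad_sum_def)

lemma N_shift: "u \<in> N \<Longrightarrow> (\<lambda>x. u (x + y)) \<in> N"
proof -
  assume u: "u \<in> N"
  then obtain z where "u z \<noteq> 0" unfolding N_def by fastforce
  then have "(\<lambda>x. u (x + y)) (z - y) \<noteq> 0" by (simp add: diff_add_cancel)
  then have "(\<lambda>x. u (x + y)) \<noteq> (\<lambda>_. 0)" by metis
  with u show ?thesis by (simp add: N_def l2_shift J_shift)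
qed

lemma J_isCont_scale:
  assumes "u \<in> l2" shows "isCont (\<lambda>t. J (\<lambda>x. t * u x)) t"
proof -
  have "isCont (\<lambda>t. quad_sum m (\<lambda>x. 0 + t * u x)) t"
    by (rule quad_sum_isCont_line[OF m_cont _ assms]) (auto intro: l2_finite_support)
  then show ?thesis
    unfolding J_def Q_scale[OF assms] by (intro continuous_intros) simp
qed

lemma J_isCont_line:
  assumes "u \<in> l2" "v \<in> l2" shows "isCont (\<lambda>s. J (\<lambda>x. u x + s * v x)) s"
proof -
  have "Q (\<lambda>x. u x + s * v x) = Q u + 2 * (s * l2ip (E u) v) + s^2 * Q v" for s
    using Q_add[OF assms(1) l2_scale[OF assms(2)], of s] assms by (simp add: form_scale Q_scale)
  then show ?thesis
    unfolding J_def by (auto intro!: continuous_intros quad_sum_isCont_line[OF m_cont assms])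
qed

text \<open>Where \<open>\<bar>u x\<bar> \<le> r\<close> holds throughout, \<open>m\<close> stays below \<open>c / 2\<close> and the quadratic part dominates.\<close>

lemma J_pos_if_small:
  obtains r where "0 < r"
    "\<And>u. u \<in> l2 \<Longrightarrow> u \<noteq> (\<lambda>_. 0) \<Longrightarrow> (\<And>x. \<bar>u x\<bar> \<le> r) \<Longrightarrow> 0 < J u"
proof -
  obtain r where r: "0 < r" "\<And>s. \<bar>s\<bar> \<le> r \<Longrightarrow> \<bar>m s\<bar> \<le> c/2"
    using continuous_real_if_small_at[OF m_cont m0, of "c/2"] c_pos by auto
  show ?thesis
  proof (rule that[OF r(1)])
    fix u :: "'a \<Rightarrow> real" assume u: "u \<in> l2" "u \<noteq> (\<lambda>_. 0)" "\<And>x. \<bar>u x\<bar> \<le> r"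
    have "quad_sum m u \<le> (\<Sum>\<^sub>\<infinity>x. c/2 * (u x)^2)"
      unfolding quad_sum_def
    proof (rule infsum_mono[OF quad_summable[OF m_cont u(1)] summable_on_cmult_right[OF l2_summable[OF u(1)]]])
      fix x
      have "m (u x) \<le> c/2" using r(2)[OF u(3)[of x]] by linarith
      then show "(u x)^2 * m (u x) \<le> c/2 * (u x)^2"
        using mult_left_mono[of "m (u x)" "c/2" "(u x)^2"] by (simp add: mult.commute)
    qed
    also have "\<dots> = c/2 * l2sq u" by (simp only: infsum_cmult_right' l2sq_def)
    finally have "quad_sum m u \<le> c/2 * l2sq u" .
    moreover have "0 < c * l2sq u" using l2sq_pos[OF u(1,2)] c_pos by simp
    ultimately show "0 < J u" using Q_ge[OF u(1)] by (simp add: J_def)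
  qed
qed

text \<open>On a lattice this excludes vanishing of a sequence in \<open>N\<close> outright, and a translation then moves
a value of size at least \<open>r\<close> to the origin.\<close>

lemma N_nonvanishing:
  obtains r where "0 < r" "\<And>u. u \<in> N \<Longrightarrow> \<exists>x. r \<le> \<bar>u x\<bar>"
proof -
  obtain r where r: "0 < r" "\<And>u. u \<in> l2 \<Longrightarrow> u \<noteq> (\<lambda>_. 0) \<Longrightarrow> (\<And>x. \<bar>u x\<bar> \<le> r) \<Longrightarrow> 0 < J u"
    using J_pos_if_small by blast
  show ?thesis
  proof (rule that[OF r(1)], rule ccontr)
    fix u assume u: "u \<in> N" and "\<not> (\<exists>x. r \<le> \<bar>u x\<bar>)"
    then have "0 < J u" using r(2)[of u] by (simp add: N_def not_le less_imp_le)
    with u show False by (simp add: N_def)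
  qed
qed

text \<open>Below the Nehari manifold (\<open>J w < 0\<close>) the ray through \<open>w\<close> meets it at a parameter less than 1, since
\<open>J\<close> is positive near the origin.\<close>

lemma project_down:
  assumes "w \<in> l2" "J w < 0"
  obtains t where "0 < t" "t < 1" "(\<lambda>x. t * w x) \<in> N"
proof -
  have w0: "w \<noteq> (\<lambda>_. 0)"
  proof
    assume "w = (\<lambda>_. 0)"
    then have "J w = 0" by (simp add: J_def Q_def l2ip_def quad_sum_def)
    with assms(2) show False by simp
  qed
  obtain r where r: "0 < r" "\<And>u. u \<in> l2 \<Longrightarrow> u \<noteq> (\<lambda>_. 0) \<Longrightarrow> (\<And>x. \<bar>u x\<bar> \<le> r) \<Longrightarrow> 0 < J u"
    using J_pos_if_small by blast
  define q where "q = min (1/2) (r / (sqrt (l2sq w) + 1))"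
  have q: "0 < q" "q < 1" using r(1) by (auto simp: q_def add_nonneg_pos)
  have nz: "(\<lambda>x. t * w x) \<noteq> (\<lambda>_. 0)" if "t \<noteq> 0" for t using w0 that by (metis mult_eq_0_iff)
  have "0 < J (\<lambda>x. q * w x)"
  proof (rule r(2)[OF l2_scale[OF assms(1)] nz])
    fix x
    have "q * \<bar>w x\<bar> \<le> r / (sqrt (l2sq w) + 1) * (sqrt (l2sq w) + 1)"
      using l2_pointwise_le[OF assms(1), of x] q r(1) by (intro mult_mono) (auto simp: q_def)
    also have "\<dots> = r" by (simp add: add_nonneg_eq_0_iff)
    finally show "\<bar>q * w x\<bar> \<le> r" using q by (simp add: abs_mult)
  qed (use q in auto)
  moreover have "J (\<lambda>x. 1 * w x) < 0" using assms(2) by simp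
  ultimately obtain t where t: "q \<le> t" "t \<le> 1" "J (\<lambda>x. t * w x) = 0"
    using IVT2[of "\<lambda>t. J (\<lambda>x. t * w x)" 1 0 q] J_isCont_scale[OF assms(1)] q by force
  with assms(2) have "t \<noteq> 1" by auto
  then show ?thesis using that[of t] t q nz[of t] l2_scale[OF assms(1)] by (simp add: N_def)
qed

text \<open>A large multiple of a point mass lies below the Nehari manifold because \<open>m\<close> is unbounded.\<close>

lemma N_nonempty: "N \<noteq> {}"
proof -
  define \<delta> :: "'a \<Rightarrow> real" where "\<delta> x = (if x = 0 then 1 else 0)" for x
  have d: "\<delta> \<in> l2" by (rule l2_finite_support[of "{0}"]) (auto simp: \<delta>_def)
  obtain R where R: "\<And>s. R \<le> \<bar>s\<bar> \<Longrightarrow> Q \<delta> + 1 \<le> m s" using m_unbounded by blast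
  define t where "t = max R 1"
  have "Q \<delta> + 1 \<le> m t" by (rule R) (auto simp: t_def)
  also have "m t = (\<delta> 0)^2 * m (t * \<delta> 0)" by (simp add: \<delta>_def)
  also have "\<dots> \<le> (\<Sum>\<^sub>\<infinity>x. (\<delta> x)^2 * m (t * \<delta> x))"
    by (rule term_le_infsum[OF scaled_summable[OF d]]) (auto simp: t_def m_nonneg)
  finally have "Q \<delta> - (\<Sum>\<^sub>\<infinity>x. (\<delta> x)^2 * m (t * \<delta> x)) < 0" by linarith
  then have "J (\<lambda>x. t * \<delta> x) < 0"
    unfolding J_scaled[OF d] by (intro mult_pos_neg) (auto simp: t_def)
  from project_down[OF l2_scale[OF d] this] show ?thesis by blast
qed

lemma K_le_quad_sum: "u \<in> l2 \<Longrightarrow> K (u x) \<le> quad_sum kq u"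
  unfolding quad_sum_kq by (rule term_le_infsum[OF K_summable]) (auto simp: K_nonneg)

lemma quad_sum_kq_nonneg: "0 \<le> quad_sum kq u"
  unfolding quad_sum_kq by (rule infsum_nonneg) (rule K_nonneg)

lemma I_pos_on_N: "u \<in> N \<Longrightarrow> 0 < I u"
proof -
  assume u: "u \<in> N"
  then obtain z where "u z \<noteq> 0" unfolding N_def by fastforce
  then have "0 < K (u z)" by (rule K_pos)
  also have "\<dots> \<le> quad_sum kq u" using u by (intro K_le_quad_sum) (simp add: N_def)
  finally show ?thesis using u by (simp add: I_on_N)
qed

text \<open>An energy bound makes \<open>u\<close> uniformly bounded by coercivity of \<open>K\<close>. Then
\<open>s\<^sup>2 m s \<le> (c / 2) s\<^sup>2 + P K s\<close> for all values \<open>s\<close> of \<open>u\<close>: for small \<open>s\<close> by the first term, for the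
others because \<open>K\<close> is bounded away from 0. Summation turns \<open>J u = 0\<close> into a bound for the norm.\<close>

lemma N_bounded:
  obtains M where "\<And>u. u \<in> N \<Longrightarrow> I u \<le> e \<Longrightarrow> l2sq u \<le> M"
proof -
  obtain R where R: "\<And>s. K s \<le> e \<Longrightarrow> \<bar>s\<bar> \<le> R" using K_coercive by blast
  obtain C where C: "0 < C" "\<And>s. \<bar>s\<bar> \<le> R \<Longrightarrow> \<bar>m s\<bar> \<le> C"
    using continuous_bounded_on_interval[OF m_cont] by blast
  obtain r where r: "0 < r" "\<And>s. \<bar>s\<bar> \<le> r \<Longrightarrow> \<bar>m s\<bar> \<le> c/2"
    using continuous_real_if_small_at[OF m_cont m0, of "c/2"] c_pos by auto
  obtain k where k: "0 < k" "\<And>s. r \<le> \<bar>s\<bar> \<Longrightarrow> k \<le> K s"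
    using K_bounded_below[OF r(1)] by blast
  define P where "P = R^2 * C / k"
  have P: "0 \<le> P" using C(1) k(1) by (simp add: P_def)
  have pt: "s^2 * m s \<le> c/2 * s^2 + P * K s" if s: "\<bar>s\<bar> \<le> R" for s
  proof (cases "\<bar>s\<bar> \<le> r")
    case True
    then have "m s \<le> c/2" using r(2)[of s] by linarith
    then have "s^2 * m s \<le> c/2 * s^2" using mult_left_mono[of "m s" "c/2" "s^2"] by (simp add: mult.commute)
    moreover have "0 \<le> P * K s" using P K_nonneg by simp
    ultimately show ?thesis by linarith
  next
    case False
    have "s^2 \<le> R^2" using s by (metis abs_ge_zero power2_abs power_mono)
    then have "s^2 * m s \<le> R^2 * C" using C(2)[OF s] m_nonneg[of s] by (intro mult_mono) auto
    also have "\<dots> = P * k" using k(1) by (simp add: P_def)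
    also have "\<dots> \<le> P * K s" using k(2)[of s] False P by (intro mult_left_mono) auto
    also have "\<dots> \<le> c/2 * s^2 + P * K s" using c_pos by simp
    finally show ?thesis .
  qed
  show ?thesis
  proof (rule that[of "2 * (P * e) / c"])
    fix u assume u: "u \<in> N" and Iu: "I u \<le> e"
    have ul: "u \<in> l2" using u by (simp add: N_def)
    have Ke: "quad_sum kq u \<le> e" using Iu I_on_N[OF u] by simp
    have b: "\<bar>u x\<bar> \<le> R" for x using R K_le_quad_sum[OF ul, of x] Ke by force
    note s2 = summable_on_cmult_right[OF l2_summable[OF ul], of "c/2"]
    note sK = summable_on_cmult_right[OF K_summable[OF ul], of P]
    have "quad_sum m u \<le> (\<Sum>\<^sub>\<infinity>x. c/2 * (u x)^2 + P * K (u x))"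
      unfolding quad_sum_def
      by (rule infsum_mono[OF quad_summable[OF m_cont ul] summable_on_add[OF s2 sK]]) (rule pt[OF b])
    also have "\<dots> = c/2 * l2sq u + P * quad_sum kq u"
      unfolding infsum_add[OF s2 sK] infsum_cmult_right' quad_sum_kq l2sq_def ..
    also have "P * quad_sum kq u \<le> P * e" using Ke P by (rule mult_left_mono)
    finally have "quad_sum m u \<le> c/2 * l2sq u + P * e" by simp
    moreover have "quad_sum m u = Q u" using u by (simp add: N_def J_def)
    ultimately have "c/2 * l2sq u \<le> P * e" using Q_ge[OF ul] by linarith
    then show "l2sq u \<le> 2 * (P * e) / c" using c_pos by (simp add: field_simps)
  qed
qed

lemma quad_sum_kq_scale_le:
  assumes "u \<in> l2" "0 \<le> t" "t \<le> 1" shows "quad_sum kq (\<lambda>x. t * u x) \<le> quad_sum kq u"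
  unfolding quad_sum_kq
  by (rule infsum_mono[OF K_summable[OF l2_scale[OF assms(1)]] K_summable[OF assms(1)]])
     (use K_ray_le[OF assms(2,3)] in simp)

lemma quad_sum_kq_scale_less:
  assumes "u \<in> l2" "0 < t" "t < 1" "u y \<noteq> 0" shows "quad_sum kq (\<lambda>x. t * u x) < quad_sum kq u"
  unfolding quad_sum_kq
  by (rule infsum_strict_mono[OF K_summable[OF l2_scale[OF assms(1)]] K_summable[OF assms(1)], of _ y])
     (use K_ray_le[of t 1] K_ray_less[OF assms(2,3,4)] assms in auto)

text \<open>A minimizing sequence, translated so that it does not vanish at the origin, has a pointwise limit
\<open>v \<noteq> 0\<close>. Both \<open>J\<close> and the energy split into the contributions of \<open>v\<close> and of the remainders \<open>w n\<close>.
If \<open>J v < 0\<close>, projecting \<open>v\<close> gives an element of \<open>N\<close> with energy below the infimum; if \<open>J v > 0\<close>, then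
\<open>J (w n) < 0\<close> eventually, and projecting \<open>w n\<close> does, since \<open>v\<close> has taken away a positive amount of
energy. So \<open>v\<close> lies in \<open>N\<close>.\<close>

theorem minimizer_exists: "\<exists>u\<in>N. \<forall>w\<in>N. I u \<le> I w"
proof -
  define c0 where "c0 = Inf (I ` N)"
  have bdd: "bdd_below (I ` N)" using I_pos_on_N by (auto intro!: bdd_belowI[of _ 0] less_imp_le)
  have c0: "c0 \<le> I w" if "w \<in> N" for w
    unfolding c0_def by (rule cInf_lower[OF _ bdd]) (use that in auto)
  have "\<exists>u\<in>N. I u < c0 + 1 / (real n + 1)" for n
    using cInf_less_iff[of "I ` N" "c0 + 1 / (real n + 1)"] N_nonempty bdd
    by (auto simp: c0_def[symmetric])
  moreover obtain r where r: "0 < r" "\<And>u. u \<in> N \<Longrightarrow> \<exists>x. r \<le> \<bar>u x\<bar>"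
    using N_nonvanishing by blast
  ultimately have "\<exists>u\<in>N. I u < c0 + 1 / (real n + 1) \<and> r \<le> \<bar>u 0\<bar>" for n
  proof -
    obtain u x where u: "u \<in> N" "I u < c0 + 1 / (real n + 1)" "r \<le> \<bar>u x\<bar>"
      using \<open>\<And>n. \<exists>u\<in>N. I u < c0 + 1 / (real n + 1)\<close> r(2) by blast
    then have "I (\<lambda>y. u (y + x)) = I u"
      using N_shift[OF u(1), of x] by (simp add: I_on_N quad_sum_shift)
    then show ?thesis using u N_shift[OF u(1), of x] by (intro bexI[of _ "\<lambda>y. u (y + x)"]) auto
  qed
  then obtain u' where u': "\<And>n. u' n \<in> N" "\<And>n. I (u' n) < c0 + 1 / (real n + 1)" "\<And>n. r \<le> \<bar>u' n 0\<bar>"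
    by metis
  obtain M where M: "\<And>u. u \<in> N \<Longrightarrow> I u \<le> c0 + 1 \<Longrightarrow> l2sq u \<le> M" using N_bounded by blast
  have l2': "u' n \<in> l2" for n using u'(1) by (simp add: N_def)
  have M': "l2sq (u' n) \<le> M" for n
    by (rule M[OF u'(1)]) (use u'(2)[of n] in \<open>auto intro: less_imp_le order_trans\<close>)
  have "norm (u' n x) \<le> sqrt M" for n x
    using order_trans[OF l2_pointwise_le[OF l2'] real_sqrt_le_mono[OF M']] by simp
  then obtain k where k: "strict_mono k" "\<And>x. x \<in> UNIV \<Longrightarrow> \<exists>l. (\<lambda>n. u' (k n) x) \<longlonglongrightarrow> l"
    using function_convergent_subsequence[OF countableI_type, of UNIV u' "sqrt M"] by blast
  define u where "u n = u' (k n)" for n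
  obtain v where v: "\<And>x. (\<lambda>n. u n x) \<longlonglongrightarrow> v x" using k(2)[OF UNIV_I] unfolding u_def by metis
  have un: "u n \<in> l2" "l2sq (u n) \<le> M" "u n \<in> N" for n using l2' M' u' by (auto simp: u_def)
  note vl = l2_pointwise_limit[OF un(1,2) v]
  have "r \<le> \<bar>v 0\<bar>"
    by (rule LIMSEQ_le_const[OF tendsto_rabs[OF v[of 0]]]) (use u'(3) in \<open>auto simp: u_def\<close>)
  then have v0: "v 0 \<noteq> 0" using r(1) by auto
  have "(\<lambda>n. I (u' n)) \<longlonglongrightarrow> c0"
  proof (rule tendsto_sandwich[OF _ _ tendsto_const])
    show "(\<lambda>n. c0 + 1 / (real n + 1)) \<longlonglongrightarrow> c0"
      using tendsto_add[OF tendsto_const LIMSEQ_inverse_real_of_nat, of c0]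
      by (simp add: inverse_eq_divide add.commute)
  qed (use c0[OF u'(1)] u'(2) in \<open>auto intro!: always_eventually less_imp_le\<close>)
  from LIMSEQ_subseq_LIMSEQ[OF this k(1)] have Iu: "(\<lambda>n. quad_sum kq (u n)) \<longlonglongrightarrow> c0"
    using I_on_N[OF un(3)] by (simp add: u_def o_def)
  define w where "w n = (\<lambda>x. u n x - v x)" for n
  have wl: "w n \<in> l2" for n unfolding w_def by (rule l2_diff[OF un(1) vl(1)])
  have wM: "l2sq (w n) \<le> 4 * M" for n
    using l2sq_add_le[OF un(1) l2_scale[OF vl(1), of "-1"], of n] un(2)[of n] vl(2) l2sq_scale[of "-1" v]
    by (simp add: w_def)
  have w0: "(\<lambda>n. w n x) \<longlonglongrightarrow> 0" for x
    using tendsto_diff[OF v tendsto_const, of x "v x"] by (simp add: w_def)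
  have split: "(\<lambda>n. quad_sum \<mu> (u n) - quad_sum \<mu> (w n)) \<longlonglongrightarrow> quad_sum \<mu> v"
    if "continuous_on UNIV \<mu>" for \<mu>
    unfolding w_def by (rule quad_sum_split[OF that un(1,2) v])
  have Jw: "(\<lambda>n. J (w n)) \<longlonglongrightarrow> - J v"
  proof -
    have "Q (u n) = Q v + 2 * l2ip (E v) (w n) + Q (w n)" for n
      using Q_add[OF vl(1) wl, of n] by (simp add: w_def)
    moreover have "Q (u n) = quad_sum m (u n)" for n using un(3) by (simp add: N_def J_def)
    ultimately have "J (w n) = (quad_sum m (u n) - quad_sum m (w n)) - Q v - 2 * l2ip (E v) (w n)" for n
      unfolding J_def by (smt (verit))
    moreover have "(\<lambda>n. (quad_sum m (u n) - quad_sum m (w n)) - Q v - 2 * l2ip (E v) (w n))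
        \<longlonglongrightarrow> quad_sum m v - Q v - 2 * 0"
      by (intro tendsto_intros split m_cont l2ip_tendsto_0[OF E_l2[OF vl(1)] wl wM w0])
    ultimately have "(\<lambda>n. J (w n)) \<longlonglongrightarrow> quad_sum m v - Q v - 2 * 0" by (simp only:)
    then show ?thesis by (simp add: J_def)
  qed
  have Kw: "(\<lambda>n. quad_sum kq (w n)) \<longlonglongrightarrow> c0 - quad_sum kq v"
    using tendsto_diff[OF Iu split[OF kq_cont]] by simp
  then have Kv: "quad_sum kq v \<le> c0"
    using LIMSEQ_le_const[OF Kw, of 0] quad_sum_kq_nonneg by auto
  have "J v = 0"
  proof (rule ccontr)
    assume "J v \<noteq> 0"
    then consider "J v < 0" | "0 < J v" by linarith
    then show False
    proof cases
      case 1
      obtain t where t: "0 < t" "t < 1" "(\<lambda>x. t * v x) \<in> N" using project_down[OF vl(1) 1] by blast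
      have "c0 \<le> quad_sum kq (\<lambda>x. t * v x)" using c0[OF t(3)] I_on_N[OF t(3)] by simp
      also have "\<dots> < quad_sum kq v" by (rule quad_sum_kq_scale_less[of v t 0, OF vl(1) t(1,2) v0])
      finally show False using Kv by simp
    next
      case 2
      have "\<forall>\<^sub>F n in sequentially. J (w n) < 0"
        using order_tendstoD(2)[OF Jw, of 0] 2 by simp
      then have "\<forall>\<^sub>F n in sequentially. c0 \<le> quad_sum kq (w n)"
      proof eventually_elim
        fix n assume "J (w n) < 0"
        from project_down[OF wl this] obtain t where t: "0 < t" "t < 1" "(\<lambda>x. t * w n x) \<in> N" by blast
        have "c0 \<le> quad_sum kq (\<lambda>x. t * w n x)" using c0[OF t(3)] I_on_N[OF t(3)] by simp
        also have "\<dots> \<le> quad_sum kq (w n)" by (rule quad_sum_kq_scale_le) (use wl t in auto)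
        finally show "c0 \<le> quad_sum kq (w n)" .
      qed
      then have "c0 \<le> c0 - quad_sum kq v"
        by (rule tendsto_lowerbound[OF Kw]) simp
      moreover have "0 < K (v 0)" using v0 by (rule K_pos)
      ultimately show False using K_le_quad_sum[OF vl(1), of 0] by linarith
    qed
  qed
  with vl(1) v0 have vN: "v \<in> N" by (auto simp: N_def fun_eq_iff)
  have "I v \<le> I w" if "w \<in> N" for w using Kv I_on_N[OF vN] c0[OF that] by simp
  with vN show ?thesis by blast
qed

end

section \<open>Minimizers are critical points\<close>

context nehari_problem begin

lemma weighted_summable:
  assumes "u \<in> l2" "v \<in> l2"
  shows "(\<lambda>x. u x * m (u x) * v x) summable_on UNIV"
proof -
  obtain C where C: "0 < C" "\<And>s. \<bar>s\<bar> \<le> sqrt (l2sq u) \<Longrightarrow> \<bar>m s\<bar> \<le> C"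
    using continuous_bounded_on_interval[OF m_cont] by blast
  have "\<bar>u x * m (u x) * v x\<bar> \<le> C * (\<bar>u x\<bar> * \<bar>v x\<bar>)" for x
    using mult_right_mono[OF C(2)[OF l2_pointwise_le[OF assms(1)]], of "\<bar>u x\<bar> * \<bar>v x\<bar>"]
    by (simp add: abs_mult mult_ac)
  then show ?thesis
    by (rule summable_on_dominated[OF summable_on_cmult_right[OF l2_mult_summable(2)[OF assms]]])
qed

text \<open>
The derivative of \<open>u \<mapsto> \<Sum>x. G (u x)\<close> at \<open>u\<close> in the direction \<open>v\<close>.
\<close>

definition dpot :: "('a \<Rightarrow> real) \<Rightarrow> ('a \<Rightarrow> real) \<Rightarrow> real" where
  "dpot u v = (\<Sum>\<^sub>\<infinity>x. u x * m (u x) * v x)"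

abbreviation remainder :: "('a \<Rightarrow> real) \<Rightarrow> real \<Rightarrow> ('a \<Rightarrow> real) \<Rightarrow> real" where
  "remainder u t v \<equiv> quad_sum gq (\<lambda>x. t * u x + v x) - quad_sum gq (\<lambda>x. t * u x) - dpot u v"

text \<open>The error is small relative to the norm of \<open>v\<close>, uniformly for \<open>t\<close> near 1: the summed form of
\<open>G_increment\<close>, with Cauchy--Schwarz for the products \<open>\<bar>u x\<bar> \<bar>v x\<bar>\<close>.\<close>

lemma potential_increment:
  assumes u: "u \<in> l2" and e: "0 < e"
  obtains d where "0 < d" "\<And>t v. v \<in> l2 \<Longrightarrow> \<bar>t - 1\<bar> < d \<Longrightarrow> sqrt (l2sq v) < d \<Longrightarrow>
      \<bar>remainder u t v\<bar> \<le> e * sqrt (l2sq v)"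
proof -
  define U where "U = sqrt (l2sq u)"
  have U: "0 \<le> U" by (simp add: U_def)
  obtain C where C: "0 < C" "\<And>e. 0 < e \<Longrightarrow> \<exists>d>0. \<forall>a b r. \<bar>a\<bar> \<le> U \<and> \<bar>b - a\<bar> + \<bar>r\<bar> < d \<longrightarrow>
      \<bar>G (b + r) - G b - a * m a * r\<bar> \<le> \<bar>r\<bar> * (C * (\<bar>b - a\<bar> + \<bar>r\<bar>) + e * \<bar>a\<bar>)"
    using G_increment[of U] by blast
  define e' where "e' = e / (3 * (U + 1))"
  have e': "0 < e'" using e U by (simp add: e'_def)
  obtain d0 where d0: "0 < d0" "\<And>a b r. \<bar>a\<bar> \<le> U \<Longrightarrow> \<bar>b - a\<bar> + \<bar>r\<bar> < d0 \<Longrightarrow>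
      \<bar>G (b + r) - G b - a * m a * r\<bar> \<le> \<bar>r\<bar> * (C * (\<bar>b - a\<bar> + \<bar>r\<bar>) + e' * \<bar>a\<bar>)"
    using C(2)[OF e'] by blast
  \<comment> \<open>Each of the three error terms \<open>C d U\<close>, \<open>C d\<close>, \<open>e' U\<close> has to fit into \<open>e\<close>; the summand 1 covers \<open>U = 0\<close>.\<close>
  define d where "d = min (d0 / (U + 1)) (e / (3 * C * (U + 1)))"
  have dpos: "0 < d" using d0(1) e C(1) U by (simp add: d_def)
  have dU: "d * U + d \<le> d0"
  proof -
    have "d * (U + 1) \<le> d0 / (U + 1) * (U + 1)" using U by (intro mult_right_mono) (auto simp: d_def)
    also have "\<dots> = d0" using U by simp
    finally show ?thesis by (simp add: distrib_left)
  qed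
  have dC: "C * d * U + C * d \<le> e / 3"
  proof -
    have "C * (d * (U + 1)) \<le> C * (e / (3 * C * (U + 1)) * (U + 1))"
      using U C(1) by (intro mult_left_mono mult_right_mono) (auto simp: d_def)
    also have "\<dots> = e / 3"
      using divide_mult_cancel[of "U + 1" e "3 * C"] U C(1) by (simp only:) simp
    finally show ?thesis by (simp add: distrib_left mult.assoc)
  qed
  have eU: "e' * U \<le> e / 3"
  proof -
    have "e' * U \<le> e' * (U + 1)" using e' by (intro mult_left_mono) auto
    also have "\<dots> = e / 3"
      unfolding e'_def by (rule divide_mult_cancel) (use U in simp)
    finally show ?thesis .
  qed
  show ?thesis
  proof (rule that[OF dpos])
    fix t :: real and v :: "'a \<Rightarrow> real" assume v: "v \<in> l2" and t: "\<bar>t - 1\<bar> < d" and vd: "sqrt (l2sq v) < d"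
    define V where "V = sqrt (l2sq v)"
    have V: "0 \<le> V" "V^2 = l2sq v" by (simp_all add: V_def)
    have pt: "\<bar>G (t * u x + v x) - G (t * u x) - u x * m (u x) * v x\<bar>
        \<le> (C * d + e') * (\<bar>u x\<bar> * \<bar>v x\<bar>) + C * (v x)^2" for x
    proof -
      have ux: "\<bar>u x\<bar> \<le> U" unfolding U_def by (rule l2_pointwise_le[OF u])
      have vx: "\<bar>v x\<bar> < d" using l2_pointwise_le[OF v, of x] vd by linarith
      have tu: "\<bar>t * u x - u x\<bar> \<le> d * \<bar>u x\<bar>"
      proof -
        have "t * u x - u x = (t - 1) * u x" by (simp add: left_diff_distrib)
        then have "\<bar>t * u x - u x\<bar> = \<bar>t - 1\<bar> * \<bar>u x\<bar>" by (simp only: abs_mult)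
        also have "\<dots> \<le> d * \<bar>u x\<bar>" using t by (intro mult_right_mono) auto
        finally show ?thesis .
      qed
      have "\<bar>t * u x - u x\<bar> + \<bar>v x\<bar> < d0"
      proof -
        have "d * \<bar>u x\<bar> \<le> d * U" using ux dpos by (intro mult_left_mono) auto
        then show ?thesis using tu vx dU by linarith
      qed
      from d0(2)[OF ux this]
      have "\<bar>G (t * u x + v x) - G (t * u x) - u x * m (u x) * v x\<bar>
          \<le> \<bar>v x\<bar> * (C * (\<bar>t * u x - u x\<bar> + \<bar>v x\<bar>) + e' * \<bar>u x\<bar>)" .
      also have "\<dots> \<le> \<bar>v x\<bar> * (C * (d * \<bar>u x\<bar> + \<bar>v x\<bar>) + e' * \<bar>u x\<bar>)"
        using tu C(1) e' by (intro mult_left_mono add_mono) auto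
      also have "\<dots> = (C * d + e') * (\<bar>u x\<bar> * \<bar>v x\<bar>) + C * (v x)^2"
        by (simp add: algebra_simps power2_eq_square)
      finally show ?thesis .
    qed
    have tu: "(\<lambda>x. t * u x) \<in> l2" by (rule l2_scale[OF u])
    have tuv: "(\<lambda>x. t * u x + v x) \<in> l2" by (rule l2_add[OF tu v])
    note s1 = summable_on_cmult_right[OF l2_mult_summable(2)[OF u v], of "C * d + e'"]
    note s2 = summable_on_cmult_right[OF l2_summable[OF v], of C]
    have eq: "remainder u t v
        = (\<Sum>\<^sub>\<infinity>x. G (t * u x + v x) - G (t * u x) - u x * m (u x) * v x)"
      unfolding quad_sum_gq dpot_def
      using G_summable[OF tu] G_summable[OF tuv] weighted_summable[OF u v]
      by (simp add: infsum_diff_real summable_on_diff_real)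
    have "\<bar>remainder u t v\<bar>
        \<le> (\<Sum>\<^sub>\<infinity>x. (C * d + e') * (\<bar>u x\<bar> * \<bar>v x\<bar>) + C * (v x)^2)"
      unfolding eq by (rule abs_infsum_le[OF summable_on_add[OF s1 s2]]) (rule pt)
    also have "\<dots> = (C * d + e') * (\<Sum>\<^sub>\<infinity>x. \<bar>u x\<bar> * \<bar>v x\<bar>) + C * V^2"
      unfolding infsum_add[OF s1 s2] infsum_cmult_right' V(2) l2sq_def ..
    also have "\<dots> \<le> (C * d + e') * (U * V) + C * (d * V)"
    proof (rule add_mono)
      show "(C * d + e') * (\<Sum>\<^sub>\<infinity>x. \<bar>u x\<bar> * \<bar>v x\<bar>) \<le> (C * d + e') * (U * V)"
        using l2_Cauchy_Schwarz[OF u v] C(1) dpos e' unfolding U_def V_def by (intro mult_left_mono) auto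
      have "V * V \<le> d * V" using vd V(1) unfolding V_def by (intro mult_right_mono) auto
      then show "C * V^2 \<le> C * (d * V)" using C(1) by (simp add: power2_eq_square)
    qed
    also have "\<dots> = (C * d * U + C * d + e' * U) * V" by (simp add: algebra_simps)
    also have "\<dots> \<le> e * V" using dC eU e V(1) by (intro mult_right_mono) linarith+
    finally show "\<bar>remainder u t v\<bar> \<le> e * sqrt (l2sq v)"
      unfolding V_def .
  qed
qed

text \<open>On the ray through a point of the Nehari manifold the energy is largest at that point: replace
\<open>Q u\<close> by \<open>quad_sum m u\<close> and compare the summands by the two halves of \<open>G_ray\<close>.\<close>

lemma I_ray_le:
  assumes "u \<in> N" "0 \<le> t" shows "I (\<lambda>x. t * u x) \<le> I u"
proof -
  have u: "u \<in> l2" "Q u = quad_sum m u" using assms(1) by (auto simp: N_def J_def)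
  have pt: "G (u x) - G (t * u x) \<le> (1 - t^2) / 2 * ((u x)^2 * m (u x))" for x
  proof (cases "t \<le> 1")
    case True
    then show ?thesis using G_ray(2)[OF assms(2) True, of "u x"] by (simp add: field_simps)
  next
    case False
    then show ?thesis using G_ray(1)[of 1 t "u x"] by (simp add: field_simps)
  qed
  note Gs = G_summable[OF u(1)] G_summable[OF l2_scale[OF u(1), of t]]
  have "quad_sum gq u - quad_sum gq (\<lambda>x. t * u x) = (\<Sum>\<^sub>\<infinity>x. G (u x) - G (t * u x))"
    unfolding quad_sum_gq by (rule infsum_diff_real[OF Gs, symmetric])
  also have "\<dots> \<le> (\<Sum>\<^sub>\<infinity>x. (1 - t^2) / 2 * ((u x)^2 * m (u x)))"
    by (rule infsum_mono[OF summable_on_diff_real[OF Gs]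
          summable_on_cmult_right[OF quad_summable[OF m_cont u(1)]]]) (rule pt)
  also have "\<dots> = (1 - t^2) / 2 * Q u" unfolding infsum_cmult_right' u(2) quad_sum_def ..
  finally show ?thesis by (simp add: I_def Q_scale[OF u(1)] field_simps)
qed

lemma ray_sum_strict_mono:
  assumes "u \<in> N" "0 < t1" "t1 < t2"
  shows "(\<Sum>\<^sub>\<infinity>x. (u x)^2 * m (t1 * u x)) < (\<Sum>\<^sub>\<infinity>x. (u x)^2 * m (t2 * u x))"
proof -
  have u: "u \<in> l2" using assms(1) by (simp add: N_def)
  obtain z where z: "u z \<noteq> 0" using assms(1) unfolding N_def by fastforce
  show ?thesis
  proof (rule infsum_strict_mono[OF scaled_summable[OF u] scaled_summable[OF u]])
    show "(u x)^2 * m (t1 * u x) \<le> (u x)^2 * m (t2 * u x)" for x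
      using m_ray_le[of t1 t2 "u x"] assms by (intro mult_left_mono) auto
    show "(u z)^2 * m (t1 * u z) < (u z)^2 * m (t2 * u z)"
      using m_ray[OF z, of t1 t2] assms z by simp
  qed (use assms in auto)
qed

lemma J_along_ray:
  assumes "u \<in> N"
  shows "0 < t \<Longrightarrow> t < 1 \<Longrightarrow> 0 < J (\<lambda>x. t * u x)" and "1 < t \<Longrightarrow> J (\<lambda>x. t * u x) < 0"
proof -
  have u: "u \<in> l2" "Q u = (\<Sum>\<^sub>\<infinity>x. (u x)^2 * m (1 * u x))"
    using assms by (auto simp: N_def J_def quad_sum_def)
  show "0 < J (\<lambda>x. t * u x)" if t: "0 < t" "t < 1"
    unfolding J_scaled[OF u(1)] u(2) using ray_sum_strict_mono[OF assms t] t by simp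
  show "J (\<lambda>x. t * u x) < 0" if t: "1 < t"
    unfolding J_scaled[OF u(1)] u(2) using ray_sum_strict_mono[OF assms zero_less_one t] t
    by (intro mult_pos_neg) auto
qed

text \<open>The Nehari manifold need not be a differentiable submanifold, as \<open>m\<close> is merely continuous, so
Lagrange multipliers do not apply directly. If the derivative of the energy at \<open>u\<close> in the direction \<open>v\<close> were
negative, then for small \<open>s > 0\<close> and all \<open>t\<close> near 1 the energy of \<open>t (u + s v)\<close> would be less than that
of \<open>t u\<close>, hence less than that of \<open>u\<close>. But \<open>J\<close> changes sign along \<open>t \<mapsto> t u\<close> at \<open>t = 1\<close>, and this persists
for small \<open>s\<close>; so some \<open>t (u + s v)\<close> with \<open>t\<close> near 1 lies in \<open>N\<close>, contradicting minimality.\<close>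

lemma minimizer_one_sided:
  assumes u: "u \<in> N" and min: "\<And>w. w \<in> N \<Longrightarrow> I u \<le> I w" and v: "v \<in> l2"
  shows "dpot u v \<le> l2ip (E u) v"
proof (rule ccontr)
  assume less: "\<not> ?thesis"
  define b where "b = l2ip (E u) v"
  define L where "L = dpot u v - b"
  have L: "0 < L" using less by (simp add: L_def b_def)
  have ul: "u \<in> l2" using u by (simp add: N_def)
  define V where "V = sqrt (l2sq v)"
  have V: "0 \<le> V" by (simp add: V_def)
  define e where "e = L / (4 * (V + 1))"
  have e: "0 < e" using L V by (simp add: e_def)
  have eV: "e * V \<le> L / 4"
  proof -
    have "e * V \<le> e * (V + 1)" using e by (intro mult_left_mono) auto
    also have "\<dots> = L / 4"
      unfolding e_def by (rule divide_mult_cancel) (use V in simp)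
    finally show ?thesis .
  qed
  obtain d where d: "0 < d" "\<And>t v. v \<in> l2 \<Longrightarrow> \<bar>t - 1\<bar> < d \<Longrightarrow> sqrt (l2sq v) < d \<Longrightarrow>
      \<bar>remainder u t v\<bar> \<le> e * sqrt (l2sq v)"
    using potential_increment[OF ul e] by blast
  \<comment> \<open>\<open>\<eta>\<close> bounds \<open>\<bar>t - 1\<bar>\<close> and \<open>\<sigma>\<close> bounds \<open>s\<close>: the errors from \<open>t \<noteq> 1\<close>, from \<open>Q v\<close> and from the potential cost at
most \<open>L / 4\<close> each, which leaves a decrease of at least \<open>L / 4\<close>.\<close>
  define \<eta> where "\<eta> = min (1/2) (min (d/2) (L / (4 * (\<bar>b\<bar> + 1))))"
  have \<eta>: "0 < \<eta>" "\<eta> \<le> 1/2" "\<eta> < d" "\<eta> * \<bar>b\<bar> \<le> L / 4"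
  proof -
    show \<eta>0: "0 < \<eta>" using d(1) L by (simp add: \<eta>_def)
    show "\<eta> \<le> 1/2" unfolding \<eta>_def by (rule min.cobounded1)
    show "\<eta> < d" using d(1) by (simp add: \<eta>_def min_less_iff_disj)
    have "\<eta> * \<bar>b\<bar> \<le> \<eta> * (\<bar>b\<bar> + 1)" using \<eta>0 by (intro mult_left_mono) auto
    also have "\<dots> \<le> L / (4 * (\<bar>b\<bar> + 1)) * (\<bar>b\<bar> + 1)" by (intro mult_right_mono) (auto simp: \<eta>_def)
    also have "\<dots> = L / 4"
      by (rule divide_mult_cancel) (simp add: add_nonneg_eq_0_iff)
    finally show "\<eta> * \<bar>b\<bar> \<le> L / 4" .
  qed
  have Qv: "0 \<le> Q v" by (rule Q_nonneg[OF v])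
  define \<sigma> where "\<sigma> = min (d / (2 * (V + 1))) (L / (4 * (Q v + 1)))"
  have \<sigma>: "0 < \<sigma>" using d(1) L V Qv by (simp add: \<sigma>_def)
  have decrease: "I (\<lambda>x. t * (u x + s * v x)) < I (\<lambda>x. t * u x)"
    if t: "\<bar>t - 1\<bar> \<le> \<eta>" and s: "0 < s" "s < \<sigma>" for t s
  proof -
    have t2: "1/2 \<le> t" "t \<le> 2" using t \<eta>(2) by linarith+
    define r where "r = t * s"
    have r: "0 < r" "r \<le> 2 * s" using t2 s by (auto simp: r_def)
    have rV: "r * V < d"
    proof -
      have "r * V \<le> 2 * s * V" using r V by (intro mult_right_mono) auto
      also have "\<dots> \<le> 2 * s * (V + 1)" using s by simp
      also have "\<dots> < 2 * (d / (2 * (V + 1))) * (V + 1)"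
        using s V by (intro mult_strict_right_mono) (auto simp: \<sigma>_def)
      also have "\<dots> = d"
        using divide_mult_cancel[of "V + 1" d 2] V by (simp only: mult.assoc)
      finally show ?thesis .
    qed
    have rQ: "r * Q v / 2 \<le> L / 4"
    proof -
      have "r * Q v \<le> 2 * s * Q v" using r Qv by (intro mult_right_mono) auto
      also have "\<dots> \<le> 2 * s * (Q v + 1)" using s by simp
      also have "\<dots> \<le> 2 * (L / (4 * (Q v + 1))) * (Q v + 1)"
        using s Qv by (intro mult_right_mono) (auto simp: \<sigma>_def)
      also have "\<dots> = L / 2"
        using divide_mult_cancel[of "Q v + 1" L 4] Qv by (simp only: mult.assoc)
      finally show ?thesis by simp
    qed
    have tb: "t * b \<le> b + L / 4"
    proof -
      have "t * b - b = (t - 1) * b" by (simp add: left_diff_distrib)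
      also have "\<dots> \<le> \<bar>t - 1\<bar> * \<bar>b\<bar>" unfolding abs_mult[symmetric] by (rule abs_ge_self)
      also have "\<dots> \<le> \<eta> * \<bar>b\<bar>" using t by (intro mult_right_mono) auto
      finally show ?thesis using \<eta>(4) by linarith
    qed
    have rv: "(\<lambda>x. r * v x) \<in> l2" by (rule l2_scale[OF v])
    have srv: "sqrt (l2sq (\<lambda>x. r * v x)) = r * V"
      using r unfolding l2sq_scale V_def by (simp add: real_sqrt_mult)
    have tu: "(\<lambda>x. t * u x) \<in> l2" by (rule l2_scale[OF ul])
    have eq: "(\<lambda>x. t * (u x + s * v x)) = (\<lambda>x. t * u x + r * v x)"
      by (simp add: r_def algebra_simps)
    have Qd: "Q (\<lambda>x. t * u x + r * v x) = Q (\<lambda>x. t * u x) + 2 * (r * (t * b)) + r * (r * Q v)"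
      unfolding Q_add[OF tu rv] Q_scale[OF v] b_def
      using form_scale[OF tu v, of r] form_scale[OF v ul, of t] by (simp add: power2_eq_square)
    have dp: "dpot u (\<lambda>x. r * v x) = r * dpot u v"
      unfolding dpot_def infsum_cmult_right'[symmetric] by (simp add: mult_ac)
    have pot: "r * dpot u v - e * (r * V) \<le> quad_sum gq (\<lambda>x. t * u x + r * v x) - quad_sum gq (\<lambda>x. t * u x)"
      using d(2)[OF rv, of t] t \<eta>(3) rV unfolding srv dp by auto
    have "I (\<lambda>x. t * u x + r * v x) - I (\<lambda>x. t * u x) \<le>
        r * (t * b) + r * (r * Q v) / 2 - (r * dpot u v - e * (r * V))"
      unfolding I_def Qd using pot by (simp add: field_simps)
    also have "\<dots> = r * (t * b + r * Q v / 2 - dpot u v + e * V)" by (simp add: algebra_simps)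
    also have "\<dots> < 0"
    proof (rule mult_pos_neg[OF r(1)])
      have "dpot u v = b + L" by (simp add: L_def)
      then show "t * b + r * Q v / 2 - dpot u v + e * V < 0" using tb rQ eV L by linarith
    qed
    finally show ?thesis unfolding eq by simp
  qed
  \<comment> \<open>The sign change of \<open>J\<close> between \<open>lo\<close> and \<open>hi\<close> survives a small perturbation of \<open>u\<close>.\<close>
  define lo where "lo = 1 - \<eta>"
  define hi where "hi = 1 + \<eta>"
  have lohi: "0 < lo" "lo < 1" "1 < hi" using \<eta> by (auto simp: lo_def hi_def)
  have near: "\<forall>\<^sub>F s in at_right 0. P (J (\<lambda>x. t * (u x + s * v x)))"
    if P: "open {y. P y}" "P (J (\<lambda>x. t * u x))" for P t
  proof -
    have "isCont (\<lambda>s. J (\<lambda>x. t * u x + s * (t * v x))) 0"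
      by (rule J_isCont_line[OF l2_scale[OF ul] l2_scale[OF v]])
    then have "((\<lambda>s. J (\<lambda>x. t * u x + s * (t * v x))) \<longlongrightarrow> J (\<lambda>x. t * u x)) (at 0)"
      by (simp add: isCont_def)
    then have "((\<lambda>s. J (\<lambda>x. t * u x + s * (t * v x))) \<longlongrightarrow> J (\<lambda>x. t * u x)) (at_right 0)"
      by (rule filterlim_mono) (auto intro: at_le)
    from topological_tendstoD[OF this P(1)] P(2)
    show ?thesis by (simp add: distrib_left mult.left_commute)
  qed
  have "\<forall>\<^sub>F s in at_right (0::real). 0 < J (\<lambda>x. lo * (u x + s * v x))"
    by (rule near) (use J_along_ray(1)[OF u lohi(1,2)] in \<open>auto intro: open_Collect_less\<close>)
  moreover have "\<forall>\<^sub>F s in at_right (0::real). J (\<lambda>x. hi * (u x + s * v x)) < 0"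
    by (rule near) (use J_along_ray(2)[OF u lohi(3)] in \<open>auto intro: open_Collect_less\<close>)
  moreover have "\<forall>\<^sub>F s in at_right (0::real). s \<in> {0<..<\<sigma>}"
    by (rule eventually_at_right_real[OF \<sigma>])
  ultimately have "\<forall>\<^sub>F s in at_right (0::real). 0 < J (\<lambda>x. lo * (u x + s * v x)) \<and>
      J (\<lambda>x. hi * (u x + s * v x)) < 0 \<and> s \<in> {0<..<\<sigma>}"
    by eventually_elim auto
  then obtain s where s: "0 < J (\<lambda>x. lo * (u x + s * v x))" "J (\<lambda>x. hi * (u x + s * v x)) < 0"
      "0 < s" "s < \<sigma>"
    using eventually_happens'[of "at_right (0::real)"] by fastforce
  define w where "w = (\<lambda>x. u x + s * v x)"
  have wl: "w \<in> l2" unfolding w_def by (intro l2_add l2_scale ul v)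
  have "\<exists>t\<ge>lo. t \<le> hi \<and> J (\<lambda>x. t * w x) = 0"
    by (rule IVT2) (use s J_isCont_scale[OF wl] lohi in \<open>auto simp: w_def\<close>)
  then obtain t where t: "lo \<le> t" "t \<le> hi" "J (\<lambda>x. t * w x) = 0" by blast
  have "(\<lambda>x. t * w x) \<noteq> (\<lambda>_. 0)"
  proof
    assume a: "(\<lambda>x. t * w x) = (\<lambda>_. 0)"
    have "w x = 0" for x using fun_cong[OF a, of x] t(1) lohi(1) by simp
    then have "(\<lambda>x. lo * w x) = (\<lambda>x. t * w x)" by simp
    then show False using s(1) t(3) unfolding w_def by simp
  qed
  then have "(\<lambda>x. t * w x) \<in> N" using t(3) l2_scale[OF wl] by (simp add: N_def)
  then have "I u \<le> I (\<lambda>x. t * w x)" by (rule min)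
  also have "\<dots> < I (\<lambda>x. t * u x)"
    unfolding w_def by (rule decrease) (use s t in \<open>auto simp: lo_def hi_def abs_le_iff\<close>)
  also have "\<dots> \<le> I u" by (rule I_ray_le[OF u]) (use t lohi in simp)
  finally show False by simp
qed

text \<open>The one-sided inequality for \<open>v\<close> and for \<open>- v\<close>.\<close>

theorem minimizer_critical:
  assumes u: "u \<in> N" and min: "\<And>w. w \<in> N \<Longrightarrow> I u \<le> I w" and v: "v \<in> l2"
  shows "l2ip (E u) v = dpot u v"
proof (rule antisym)
  show "dpot u v \<le> l2ip (E u) v" by (rule minimizer_one_sided[OF assms])
  have "dpot u (\<lambda>x. - 1 * v x) \<le> l2ip (E u) (\<lambda>x. - 1 * v x)"
    by (rule minimizer_one_sided[OF u min l2_scale[OF v]])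
  also have "dpot u (\<lambda>x. - 1 * v x) = - dpot u v"
    unfolding dpot_def by (simp add: infsum_uminus)
  finally show "l2ip (E u) v \<le> dpot u v" unfolding l2ip_scale_right by simp
qed

text \<open>Test with the point mass at \<open>y\<close>.\<close>

lemma minimizer_equation:
  assumes u: "u \<in> N" and min: "\<And>w. w \<in> N \<Longrightarrow> I u \<le> I w"
  shows "E u y = u y * m (u y)"
proof -
  define \<delta> :: "'a \<Rightarrow> real" where "\<delta> x = (if x = y then 1 else 0)" for x
  have d: "\<delta> \<in> l2" by (rule l2_finite_support[of "{y}"]) (auto simp: \<delta>_def)
  have s: "(\<Sum>\<^sub>\<infinity>x. f x * \<delta> x) = f y" for f :: "'a \<Rightarrow> real"
  proof -
    have "(\<Sum>\<^sub>\<infinity>x. f x * \<delta> x) = (\<Sum>\<^sub>\<infinity>x\<in>{y}. f x)"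
      by (rule infsum_cong_neutral) (auto simp: \<delta>_def)
    then show ?thesis by simp
  qed
  from minimizer_critical[OF u min d] show ?thesis by (simp add: l2ip_def dpot_def s)
qed

text \<open>Stationarity in every direction leaves \<open>Q v / 2\<close> and the error of \<open>potential_increment\<close> with
\<open>t = 1\<close>; coercivity converts the \<open>l2\<close> norm in that error into the energy norm.\<close>

lemma stationary_differentiable:
  assumes u: "u \<in> l2" and st: "\<And>v. v \<in> l2 \<Longrightarrow> l2ip (E u) v = dpot u v" and e: "0 < e"
  shows "\<exists>d>0. \<forall>v\<in>l2. sqrt (Q v) < d \<longrightarrow> \<bar>I (\<lambda>x. u x + v x) - I u\<bar> \<le> e * sqrt (Q v)"
proof -
  define e' where "e' = e * sqrt c / 2"
  have e': "0 < e'" using e c_pos by (simp add: e'_def)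
  obtain d where d: "0 < d" "\<And>t v. v \<in> l2 \<Longrightarrow> \<bar>t - 1\<bar> < d \<Longrightarrow> sqrt (l2sq v) < d \<Longrightarrow>
      \<bar>remainder u t v\<bar> \<le> e' * sqrt (l2sq v)"
    using potential_increment[OF u e'] by blast
  show ?thesis
  proof (intro exI[of _ "min (d * sqrt c) e"] conjI ballI impI)
    show "0 < min (d * sqrt c) e" using d(1) c_pos e by simp
    fix v assume v: "v \<in> l2" and Qv: "sqrt (Q v) < min (d * sqrt c) e"
    have n: "sqrt c * sqrt (l2sq v) \<le> sqrt (Q v)"
      unfolding real_sqrt_mult[symmetric] by (rule real_sqrt_le_mono[OF Q_ge[OF v]])
    have "sqrt c * sqrt (l2sq v) < sqrt c * d" using n Qv by (simp add: mult.commute)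
    then have vd: "sqrt (l2sq v) < d" using c_pos by (subst (asm) mult_less_cancel_left_pos) auto
    have "\<bar>quad_sum gq (\<lambda>x. 1 * u x + v x) - quad_sum gq (\<lambda>x. 1 * u x) - dpot u v\<bar> \<le> e' * sqrt (l2sq v)"
      by (rule d(2)[OF v _ vd]) (use d(1) in simp)
    also have "\<dots> = e / 2 * (sqrt c * sqrt (l2sq v))" by (simp add: e'_def)
    also have "\<dots> \<le> e / 2 * sqrt (Q v)" using n e by (intro mult_left_mono) auto
    finally have 1: "\<bar>quad_sum gq (\<lambda>x. u x + v x) - quad_sum gq u - dpot u v\<bar> \<le> e / 2 * sqrt (Q v)" by simp
    have 2: "I (\<lambda>x. u x + v x) - I u = Q v / 2 - (quad_sum gq (\<lambda>x. u x + v x) - quad_sum gq u - dpot u v)"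
      unfolding I_def Q_add[OF u v] st[OF v] by (simp add: field_simps)
    have "Q v = sqrt (Q v) * sqrt (Q v)" using Q_nonneg[OF v] by simp
    also have "\<dots> \<le> e * sqrt (Q v)" using Qv Q_nonneg[OF v] by (intro mult_right_mono) auto
    finally have "Q v / 2 \<le> e / 2 * sqrt (Q v)" by simp
    then show "\<bar>I (\<lambda>x. u x + v x) - I u\<bar> \<le> e * sqrt (Q v)"
      using 1 2 Q_nonneg[OF v] by linarith
  qed
qed

end

section \<open>Convergence in the mean\<close>

definition sq_int :: "'b measure \<Rightarrow> ('b \<Rightarrow> complex) \<Rightarrow> bool" where
  "sq_int M v \<longleftrightarrow> v \<in> borel_measurable M \<and> integrable M (\<lambda>x. (cmod (v x))^2)"

text \<open>The squared norm suffices throughout; the triangle inequality is used with the constant 2.\<close>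

definition L2sq :: "'b measure \<Rightarrow> ('b \<Rightarrow> complex) \<Rightarrow> real" where
  "L2sq M v = (\<integral>x. (cmod (v x))^2 \<partial>M)"

lemma cmod_add_sq_le: "(cmod (a + b))^2 \<le> 2 * (cmod a)^2 + 2 * (cmod b)^2"
proof -
  have "(cmod (a + b))^2 \<le> (cmod a + cmod b)^2" by (intro power_mono norm_triangle_ineq) auto
  also have "\<dots> \<le> 2 * (cmod a)^2 + 2 * (cmod b)^2"
    using sum_squares_bound[of "cmod a" "cmod b"] by (simp add: power2_sum)
  finally show ?thesis .
qed

lemma L2sq_nonneg [simp]: "0 \<le> L2sq M v"
  by (simp add: L2sq_def)

lemma sq_int_measurable: "sq_int M v \<Longrightarrow> v \<in> borel_measurable M"
  by (simp add: sq_int_def)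

lemma sq_int_add:
  assumes "sq_int M v" "sq_int M w" shows "sq_int M (\<lambda>x. v x + w x)"
proof -
  have [measurable]: "v \<in> borel_measurable M" "w \<in> borel_measurable M" using assms by (auto simp: sq_int_def)
  have i: "integrable M (\<lambda>x. 2 * (cmod (v x))^2 + 2 * (cmod (w x))^2)"
    using assms by (auto simp: sq_int_def)
  have "integrable M (\<lambda>x. (cmod (v x + w x))^2)"
    by (rule Bochner_Integration.integrable_bound[OF i]) (auto intro!: cmod_add_sq_le)
  then show ?thesis by (simp add: sq_int_def)
qed

lemma sq_int_mult:
  assumes v: "sq_int M v" and b: "b \<in> borel_measurable M" "\<And>x. x \<in> space M \<Longrightarrow> cmod (b x) \<le> C"
  shows "sq_int M (\<lambda>x. b x * v x)" "L2sq M (\<lambda>x. b x * v x) \<le> C^2 * L2sq M v"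
proof -
  have [measurable]: "v \<in> borel_measurable M" using v by (simp add: sq_int_def)
  note [measurable] = b(1)
  have i: "integrable M (\<lambda>x. C^2 * (cmod (v x))^2)" using v by (auto simp: sq_int_def)
  have le: "(cmod (b x * v x))^2 \<le> C^2 * (cmod (v x))^2" if "x \<in> space M" for x
    unfolding norm_mult power_mult_distrib using b(2)[OF that]
    by (intro mult_right_mono power_mono) auto
  have i2: "integrable M (\<lambda>x. (cmod (b x * v x))^2)"
    by (rule Bochner_Integration.integrable_bound[OF i]) (auto intro!: AE_I2 le)
  then show "sq_int M (\<lambda>x. b x * v x)" by (simp add: sq_int_def)
  have "L2sq M (\<lambda>x. b x * v x) \<le> (\<integral>x. C^2 * (cmod (v x))^2 \<partial>M)"
    unfolding L2sq_def by (rule integral_mono[OF i2 i le])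
  then show "L2sq M (\<lambda>x. b x * v x) \<le> C^2 * L2sq M v" by (simp add: L2sq_def)
qed

lemma sq_int_cmult: "sq_int M v \<Longrightarrow> sq_int M (\<lambda>x. k * v x)"
  by (rule sq_int_mult(1)[of M v "\<lambda>_. k" "cmod k"]) auto

lemma sq_int_diff: "sq_int M v \<Longrightarrow> sq_int M w \<Longrightarrow> sq_int M (\<lambda>x. v x - w x)"
  using sq_int_add[of M v "\<lambda>x. -1 * w x"] sq_int_cmult[of M w "-1"] by simp

lemma sq_int_sum: "finite A \<Longrightarrow> (\<And>i. i \<in> A \<Longrightarrow> sq_int M (v i)) \<Longrightarrow> sq_int M (\<lambda>x. \<Sum>i\<in>A. v i x)"
proof (induction A rule: finite_induct)
  case empty then show ?case by (simp add: sq_int_def)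
next
  case (insert i A) then show ?case by (simp add: sq_int_add)
qed

lemma L2sq_cmult: "L2sq M (\<lambda>x. k * v x) = (cmod k)^2 * L2sq M v"
  by (simp add: L2sq_def norm_mult power_mult_distrib)

lemma L2sq_minus_commute: "L2sq M (\<lambda>x. v x - w x) = L2sq M (\<lambda>x. w x - v x)"
  by (simp add: L2sq_def norm_minus_commute)

lemma L2sq_add_le:
  assumes "sq_int M v" "sq_int M w"
  shows "L2sq M (\<lambda>x. v x + w x) \<le> 2 * L2sq M v + 2 * L2sq M w"
proof -
  have "L2sq M (\<lambda>x. v x + w x) \<le> (\<integral>x. 2 * (cmod (v x))^2 + 2 * (cmod (w x))^2 \<partial>M)"
    unfolding L2sq_def
    by (rule integral_mono) (use assms sq_int_add[OF assms] cmod_add_sq_le in \<open>auto simp: sq_int_def\<close>)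
  also have "\<dots> = 2 * L2sq M v + 2 * L2sq M w"
    using assms by (simp add: L2sq_def sq_int_def)
  finally show ?thesis .
qed

lemma L2sq_triangle:
  assumes "sq_int M u" "sq_int M v" "sq_int M w"
  shows "L2sq M (\<lambda>x. u x - w x) \<le> 2 * L2sq M (\<lambda>x. u x - v x) + 2 * L2sq M (\<lambda>x. v x - w x)"
  using L2sq_add_le[OF sq_int_diff[OF assms(1,2)] sq_int_diff[OF assms(2,3)]] by simp

lemma L2sq_eq_0_AE:
  assumes "sq_int M v" "L2sq M v = 0" shows "AE x in M. v x = 0"
proof -
  have "AE x in M. (cmod (v x))^2 = 0"
    using assms integral_nonneg_eq_0_iff_AE[of M "\<lambda>x. (cmod (v x))^2"] by (auto simp: L2sq_def sq_int_def)
  then show ?thesis by simp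
qed

lemma L2sq_cong_AE:
  assumes "sq_int M v" "sq_int M w" "AE x in M. v x = w x" shows "L2sq M v = L2sq M w"
proof -
  have [measurable]: "v \<in> borel_measurable M" "w \<in> borel_measurable M" using assms by (auto simp: sq_int_def)
  show ?thesis unfolding L2sq_def by (rule integral_cong_AE) (use assms(3) in auto)
qed

lemma cmod_sq_diff_le:
  assumes "0 < \<eta>"
  shows "\<bar>(cmod a)^2 - (cmod b)^2\<bar> \<le> (1 + 1/\<eta>) * (cmod (a - b))^2 + \<eta> * (cmod b)^2"
proof -
  define d where "d = cmod (a - b)"
  have d: "0 \<le> d" "\<bar>cmod a - cmod b\<bar> \<le> d" by (simp_all add: d_def norm_triangle_ineq3)
  have "(cmod a)^2 - (cmod b)^2 = (cmod a - cmod b) * ((cmod a - cmod b) + 2 * cmod b)"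
    by (simp add: algebra_simps power2_eq_square)
  then have "\<bar>(cmod a)^2 - (cmod b)^2\<bar> = \<bar>cmod a - cmod b\<bar> * \<bar>(cmod a - cmod b) + 2 * cmod b\<bar>"
    by (simp only: abs_mult)
  also have "\<dots> \<le> d * (d + 2 * cmod b)"
  proof (rule mult_mono[OF d(2)])
    have "\<bar>2 * cmod b\<bar> = 2 * cmod b" by simp
    then show "\<bar>(cmod a - cmod b) + 2 * cmod b\<bar> \<le> d + 2 * cmod b" using d(2) by linarith
  qed (use d in auto)
  also have "\<dots> \<le> (1 + 1/\<eta>) * d^2 + \<eta> * (cmod b)^2"
  proof -
    have "0 \<le> (d - \<eta> * cmod b)^2 / \<eta>" using assms by simp
    also have "\<dots> = d^2 / \<eta> - 2 * d * cmod b + \<eta> * (cmod b)^2"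
      using assms by (simp add: power2_diff field_simps power2_eq_square)
    finally show ?thesis by (simp add: algebra_simps power2_eq_square)
  qed
  finally show ?thesis unfolding d_def .
qed

lemma L2sq_tendsto:
  assumes v: "\<And>i. sq_int M (v i)" and w: "sq_int M w"
    and lim: "((\<lambda>i. L2sq M (\<lambda>x. v i x - w x)) \<longlongrightarrow> 0) F"
  shows "((\<lambda>i. L2sq M (v i)) \<longlongrightarrow> L2sq M w) F"
proof (rule tendstoI)
  fix e :: real assume e: "0 < e"
  define \<eta> where "\<eta> = e / (2 * (L2sq M w + 1))"
  have \<eta>: "0 < \<eta>" using e by (simp add: \<eta>_def add_nonneg_pos)
  have \<eta>w: "\<eta> * L2sq M w \<le> e / 2"
  proof -
    have "\<eta> * L2sq M w \<le> \<eta> * (L2sq M w + 1)" using \<eta> by (intro mult_left_mono) auto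
    also have "\<dots> = e / 2"
      unfolding \<eta>_def by (rule divide_mult_cancel) (use L2sq_nonneg[of M w] in linarith)
    finally show ?thesis .
  qed
  have k: "0 < e / 2 / (1 + 1/\<eta>)" using e \<eta> by (simp add: add_pos_pos)
  have bound: "\<bar>L2sq M (v i) - L2sq M w\<bar> \<le> (1 + 1/\<eta>) * L2sq M (\<lambda>x. v i x - w x) + \<eta> * L2sq M w" for i
  proof -
    have iv: "integrable M (\<lambda>x. (cmod (v i x))^2)" "integrable M (\<lambda>x. (cmod (w x))^2)"
      "integrable M (\<lambda>x. (cmod (v i x - w x))^2)"
      using v[of i] w sq_int_diff[OF v[of i] w] by (auto simp: sq_int_def)
    have "\<bar>L2sq M (v i) - L2sq M w\<bar> = \<bar>\<integral>x. (cmod (v i x))^2 - (cmod (w x))^2 \<partial>M\<bar>"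
      unfolding L2sq_def using iv by simp
    also have "\<dots> \<le> (\<integral>x. \<bar>(cmod (v i x))^2 - (cmod (w x))^2\<bar> \<partial>M)" by (rule integral_abs_bound)
    also have "\<dots> \<le> (\<integral>x. (1 + 1/\<eta>) * (cmod (v i x - w x))^2 + \<eta> * (cmod (w x))^2 \<partial>M)"
      using iv by (intro integral_mono cmod_sq_diff_le[OF \<eta>]) auto
    also have "\<dots> = (1 + 1/\<eta>) * L2sq M (\<lambda>x. v i x - w x) + \<eta> * L2sq M w"
      unfolding L2sq_def using iv by simp
    finally show ?thesis .
  qed
  have "\<forall>\<^sub>F i in F. L2sq M (\<lambda>x. v i x - w x) < e / 2 / (1 + 1/\<eta>)"
    using order_tendstoD(2)[OF lim k] .
  then show "\<forall>\<^sub>F i in F. dist (L2sq M (v i)) (L2sq M w) < e"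
  proof eventually_elim
    case (elim i)
    have p: "0 < 1 + 1/\<eta>" using \<eta> by (simp add: add_pos_pos)
    have "L2sq M (\<lambda>x. v i x - w x) * (1 + 1/\<eta>) < e / 2"
      using elim by (subst (asm) pos_less_divide_eq[OF p])
    then show ?case unfolding dist_real_def using bound[of i] \<eta>w by (simp add: mult.commute)
  qed
qed

text \<open>Fatou's lemma, also providing the square integrability of the limit.\<close>

lemma L2_Fatou:
  assumes v: "\<And>k. sq_int M (v k)" and w: "w \<in> borel_measurable M"
    and lim: "AE x in M. (\<lambda>k. v k x) \<longlonglongrightarrow> w x"
    and b: "\<And>k. K \<le> k \<Longrightarrow> L2sq M (v k) \<le> B"
  shows "sq_int M w" "L2sq M w \<le> B"
proof -
  have [measurable]: "\<And>k. v k \<in> borel_measurable M" using v by (simp add: sq_int_def)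
  note [measurable] = w
  have B: "0 \<le> B" by (rule order_trans[OF L2sq_nonneg b[OF order_refl]])
  have nn: "(\<integral>\<^sup>+x. ennreal ((cmod (v k x))^2) \<partial>M) = ennreal (L2sq M (v k))" for k
    unfolding L2sq_def using v by (intro nn_integral_eq_integral) (auto simp: sq_int_def)
  have "(\<integral>\<^sup>+x. ennreal ((cmod (w x))^2) \<partial>M) = (\<integral>\<^sup>+x. liminf (\<lambda>k. ennreal ((cmod (v k x))^2)) \<partial>M)"
  proof (rule nn_integral_cong_AE)
    show "AE x in M. ennreal ((cmod (w x))^2) = liminf (\<lambda>k. ennreal ((cmod (v k x))^2))"
      using lim
    proof eventually_elim
      case (elim x)
      have "(\<lambda>k. ennreal ((cmod (v k x))^2)) \<longlonglongrightarrow> ennreal ((cmod (w x))^2)"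
        by (intro tendsto_ennrealI tendsto_intros elim)
      then show ?case by (intro lim_imp_Liminf[symmetric]) auto
    qed
  qed
  also have "\<dots> \<le> liminf (\<lambda>k. \<integral>\<^sup>+x. ennreal ((cmod (v k x))^2) \<partial>M)"
    by (rule nn_integral_liminf) simp
  also have "\<dots> \<le> ennreal B"
  proof -
    have "\<forall>\<^sub>F k in sequentially. (\<integral>\<^sup>+x. ennreal ((cmod (v k x))^2) \<partial>M) \<le> ennreal B"
      unfolding nn using b by (auto simp: eventually_sequentially intro!: exI[of _ K] ennreal_leI)
    then have "Limsup sequentially (\<lambda>k. \<integral>\<^sup>+x. ennreal ((cmod (v k x))^2) \<partial>M) \<le> ennreal B"
      by (rule Limsup_bounded)
    then show ?thesis by (rule order_trans[OF Liminf_le_Limsup[OF sequentially_bot]])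
  qed
  finally have le: "(\<integral>\<^sup>+x. ennreal ((cmod (w x))^2) \<partial>M) \<le> ennreal B" .
  then have "(\<integral>\<^sup>+x. ennreal ((cmod (w x))^2) \<partial>M) < \<infinity>" by (rule order_le_less_trans) simp
  then have i: "integrable M (\<lambda>x. (cmod (w x))^2)"
    by (intro integrableI_nonneg) auto
  then show "sq_int M w" by (simp add: sq_int_def)
  have "ennreal (L2sq M w) \<le> ennreal B"
    using le nn_integral_eq_integral[OF i] by (simp add: L2sq_def)
  then show "L2sq M w \<le> B" using B by (simp add: ennreal_le_iff)
qed

text \<open>Riesz--Fischer. Along a subsequence with increments of squared norm at most \<open>(1/4)^k\<close> the
increments are summable almost everywhere, because on a finite measure space their integrals are
\<open>O((1/2)^k)\<close>; Fatou's lemma turns the pointwise limit into a limit in the mean.\<close>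

lemma L2_complete:
  assumes fin: "finite_measure M" and v: "\<And>n. sq_int M (v n)"
    and Cauchy: "\<And>e. 0 < e \<Longrightarrow> \<exists>N. \<forall>m\<ge>N. \<forall>n\<ge>N. L2sq M (\<lambda>x. v m x - v n x) < e"
  obtains w where "sq_int M w" "(\<lambda>n. L2sq M (\<lambda>x. v n x - w x)) \<longlonglongrightarrow> 0"
proof -
  interpret finite_measure M by (rule fin)
  have [measurable]: "\<And>k. v k \<in> borel_measurable M" using v by (simp add: sq_int_def)
  have "\<exists>N. \<forall>m\<ge>N. \<forall>n\<ge>N. L2sq M (\<lambda>x. v m x - v n x) < (1/4)^k" for k :: nat
    by (rule Cauchy) simp
  then obtain N where N: "\<And>k m n. N k \<le> m \<Longrightarrow> N k \<le> n \<Longrightarrow> L2sq M (\<lambda>x. v m x - v n x) < (1/4)^k"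
    by metis
  define r where "r k = (\<Sum>j\<le>k. N j)" for k
  have rN: "N k \<le> r k" for k unfolding r_def by (rule member_le_sum) auto
  have rmono: "r j \<le> r k" if "j \<le> k" for j k
    unfolding r_def using that by (intro sum_mono2) auto
  define D where "D k x = v (r (Suc k)) x - v (r k) x" for k x
  have Dq: "sq_int M (D k)" for k unfolding D_def by (rule sq_int_diff[OF v v])
  have [measurable]: "\<And>k. D k \<in> borel_measurable M" using Dq by (simp add: sq_int_def)
  have Dn: "L2sq M (D k) \<le> (1/4)^k" for k
    unfolding D_def using N[of k "r (Suc k)" "r k"] rN[of k] rmono[of k "Suc k"] by simp
  define \<mu> where "\<mu> = measure M (space M)"
  \<comment> \<open>From \<open>\<bar>D\<bar> \<le> (1/2)^k + 2^k \<bar>D\<bar>\<^sup>2\<close>, a weighted Young inequality.\<close>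
  have nnD: "(\<integral>\<^sup>+x. ennreal (cmod (D k x)) \<partial>M) \<le> ennreal ((\<mu> + 1) * (1/2)^k)" for k
  proof -
    have i: "integrable M (\<lambda>x. (1/2)^k + 2^k * (cmod (D k x))^2)"
      using Dq[of k] by (auto simp: sq_int_def)
    have "cmod (D k x) \<le> (1/2)^k + 2^k * (cmod (D k x))^2" for x
    proof -
      have "0 \<le> 2^k * (cmod (D k x) - (1/2)^k)^2" by simp
      also have "\<dots> = 2^k * (cmod (D k x))^2 - 2 * cmod (D k x) + (1/2)^k"
        by (simp add: power2_diff power2_eq_square algebra_simps power_divide)
      finally show ?thesis using norm_ge_zero[of "D k x"] by linarith
    qed
    then have "(\<integral>\<^sup>+x. ennreal (cmod (D k x)) \<partial>M) \<le> (\<integral>\<^sup>+x. ennreal ((1/2)^k + 2^k * (cmod (D k x))^2) \<partial>M)"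
      by (intro nn_integral_mono ennreal_leI)
    also have "\<dots> = ennreal (\<integral>x. (1/2)^k + 2^k * (cmod (D k x))^2 \<partial>M)"
      by (rule nn_integral_eq_integral[OF i]) simp
    also have "(\<integral>x. (1/2)^k + 2^k * (cmod (D k x))^2 \<partial>M) = (1/2)^k * \<mu> + 2^k * L2sq M (D k)"
      using Dq[of k] by (simp add: sq_int_def L2sq_def \<mu>_def)
    also have "ennreal \<dots> \<le> ennreal ((\<mu> + 1) * (1/2)^k)"
    proof (rule ennreal_leI)
      have "2^k * L2sq M (D k) \<le> 2^k * (1/4)^k" using Dn by (intro mult_left_mono) auto
      also have "2^k * (1/4)^k = ((1/2)^k :: real)" by (simp flip: power_mult_distrib)
      finally show "(1/2)^k * \<mu> + 2^k * L2sq M (D k) \<le> (\<mu> + 1) * (1/2)^k"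
        by (simp add: algebra_simps)
    qed
    finally show ?thesis .
  qed
  have "(\<integral>\<^sup>+x. (\<Sum>k. ennreal (cmod (D k x))) \<partial>M) = (\<Sum>k. \<integral>\<^sup>+x. ennreal (cmod (D k x)) \<partial>M)"
    by (rule nn_integral_suminf) simp
  also have "\<dots> \<le> (\<Sum>k. ennreal ((\<mu> + 1) * (1/2)^k))"
    by (intro suminf_le nnD) auto
  also have "\<dots> < top"
  proof -
    have "summable (\<lambda>k. (\<mu> + 1) * (1/2)^k :: real)" by (intro summable_mult summable_geometric) simp
    then have "(\<Sum>k. ennreal ((\<mu> + 1) * (1/2)^k)) = ennreal (\<Sum>k. (\<mu> + 1) * (1/2)^k)"
      by (intro suminf_ennreal2) (auto simp: \<mu>_def)
    then show ?thesis by simp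
  qed
  finally have "(\<integral>\<^sup>+x. (\<Sum>k. ennreal (cmod (D k x))) \<partial>M) \<noteq> \<infinity>" by simp
  then have "AE x in M. (\<Sum>k. ennreal (cmod (D k x))) \<noteq> \<infinity>"
    by (intro nn_integral_noteq_infinite) auto
  then have conv: "AE x in M. (\<lambda>k. v (r k) x) \<longlonglongrightarrow> lim (\<lambda>k. v (r k) x)"
  proof eventually_elim
    case (elim x)
    have "summable (\<lambda>k. cmod (D k x))" by (rule summable_suminf_not_top) (use elim in auto)
    then have "summable (\<lambda>k. D k x)" by (rule summable_norm_cancel)
    then have "convergent (\<lambda>k. \<Sum>j<k. D j x)" by (simp add: summable_iff_convergent)
    moreover have "(\<Sum>j<k. D j x) = v (r k) x - v (r 0) x" for k
      unfolding D_def by (rule sum_lessThan_telescope)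
    ultimately have "convergent (\<lambda>k. v (r k) x - v (r 0) x)" by simp
    then have "convergent (\<lambda>k. (v (r k) x - v (r 0) x) + v (r 0) x)"
      by (intro convergent_add convergent_const)
    then show ?case by (simp add: convergent_LIMSEQ_iff)
  qed
  define w where "w x = lim (\<lambda>k. v (r k) x)" for x
  have w: "w \<in> borel_measurable M" unfolding w_def by (rule borel_measurable_lim_metric) simp
  have close: "sq_int M (\<lambda>x. v n x - w x) \<and> L2sq M (\<lambda>x. v n x - w x) \<le> (1/4)^j" if n: "N j \<le> n" for j n
  proof -
    have 1: "\<And>k. sq_int M (\<lambda>x. v n x - v (r k) x)" by (rule sq_int_diff[OF v v])
    have 2: "(\<lambda>x. v n x - w x) \<in> borel_measurable M" using w by simp
    have 3: "AE x in M. (\<lambda>k. v n x - v (r k) x) \<longlonglongrightarrow> v n x - w x"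
      using conv by eventually_elim (auto simp: w_def intro: tendsto_intros)
    have 4: "L2sq M (\<lambda>x. v n x - v (r k) x) \<le> (1/4)^j" if "j \<le> k" for k
      using N[OF n, of "r k"] rN[of j] rmono[OF that] by simp
    show ?thesis using L2_Fatou[OF 1 2 3 4] by blast
  qed
  have "sq_int M w"
    using sq_int_diff[OF v[of "N 0"] conjunct1[OF close[of 0 "N 0"]]] by simp
  moreover have "(\<lambda>n. L2sq M (\<lambda>x. v n x - w x)) \<longlonglongrightarrow> 0"
  proof (rule LIMSEQ_I)
    fix e :: real assume "0 < e"
    then obtain j where "(1/4)^j < e" using real_arch_pow_inv[of e "1/4"] by auto
    then have "norm (L2sq M (\<lambda>x. v n x - w x) - 0) < e" if "N j \<le> n" for n
      using close[OF that] by simp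
    then show "\<exists>no. \<forall>n\<ge>no. norm (L2sq M (\<lambda>x. v n x - w x) - 0) < e" by blast
  qed
  ultimately show ?thesis by (rule that)
qed

section \<open>The Fourier transform on the lattice\<close>

definition torus :: "(real ^ 'n) measure" where "torus = restrict_space lborel torus_cube"

lemma torus_cube_sets [simp]: "torus_cube \<in> sets borel"
  by (simp add: torus_cube_def)

lemma space_torus: "space torus = torus_cube"
  by (simp add: torus_def space_restrict_space)

lemma finite_measure_torus: "finite_measure (torus :: (real ^ 'n) measure)"
proof -
  have "emeasure lborel (torus_cube :: (real ^ 'n) set) < \<infinity>"
    unfolding torus_cube_def by (rule emeasure_lborel_cbox_finite)
  then show ?thesis
    unfolding torus_def by (intro finite_measure_restrict_space finite_measureI) (auto simp: emeasure_restrict_space space_restrict_space)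
qed

lemma measurable_torus: "f \<in> borel_measurable borel \<Longrightarrow> f \<in> borel_measurable torus"
  unfolding torus_def by (rule measurable_restrict_space1) simp

lemma LINT_torus: "(LINT \<theta>:torus_cube|lborel. f \<theta>) = (\<integral>\<theta>. f \<theta> \<partial>torus)"
  for f :: "real ^ 'n \<Rightarrow> 'b::{banach,second_countable_topology}"
  unfolding torus_def set_lebesgue_integral_def by (rule integral_restrict_space[symmetric]) simp

lemma set_integrable_torus: "set_integrable lborel torus_cube f \<longleftrightarrow> integrable torus f"
  for f :: "real ^ 'n \<Rightarrow> 'b::{banach,second_countable_topology}"
  unfolding torus_def set_integrable_def by (rule integrable_restrict_space[symmetric]) simp

lemma set_measurable_torus: "set_borel_measurable lborel torus_cube f \<longleftrightarrow> f \<in> borel_measurable torus"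
  for f :: "real ^ 'n \<Rightarrow> 'b::{real_normed_vector}"
  unfolding torus_def set_borel_measurable_def by (rule borel_measurable_restrict_space_iff[symmetric]) simp

lemma AE_torus: "(AE \<theta>\<in>torus_cube in lborel. P \<theta>) \<longleftrightarrow> (AE \<theta> in torus. P \<theta>)"
  unfolding torus_def by (rule AE_restrict_space_iff[symmetric]) simp

lemma fourier_char_add: "fourier_char (x + y) \<theta> = fourier_char x \<theta> * fourier_char y \<theta>"
  by (simp add: fourier_char_def distrib_right sum.distrib distrib_left exp_add)

lemma fourier_char_0 [simp]: "fourier_char 0 \<theta> = 1"
  by (simp add: fourier_char_def)

lemma norm_fourier_char [simp]: "cmod (fourier_char x \<theta>) = 1"
  by (simp add: fourier_char_def)

lemma cnj_fourier_char: "cnj (fourier_char x \<theta>) = fourier_char (- x) \<theta>"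
  by (simp add: fourier_char_def exp_cnj sum_negf)

lemma fourier_char_cont: "continuous_on UNIV (fourier_char x)"
  unfolding fourier_char_def by (intro continuous_intros)

lemma fourier_char_measurable: "fourier_char x \<in> borel_measurable torus"
  by (intro measurable_torus borel_measurable_continuous_onI fourier_char_cont)

lemma integral_exp_interval:
  fixes k :: int
  shows "(\<integral>t. indicator {-pi..pi} t *\<^sub>R exp (\<i> * complex_of_real (of_int k * t)) \<partial>lborel)
    = (if k = 0 then complex_of_real (2 * pi) else 0)"
proof (cases "k = 0")
  case True
  have "(\<integral>t. indicator {-pi..pi} t *\<^sub>R (1 :: complex) \<partial>lborel) = complex_of_real pi - complex_of_real (- pi)"
    by (rule integral_FTC_atLeastAtMost) (auto intro!: derivative_eq_intros has_vector_derivative_of_real continuous_intros)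
  then show ?thesis using True by simp
next
  case False
  let ?F = "\<lambda>t::real. exp (\<i> * complex_of_real (of_int k * t)) / (\<i> * of_int k)"
  have "(\<integral>t. indicator {-pi..pi} t *\<^sub>R exp (\<i> * complex_of_real (of_int k * t)) \<partial>lborel) = ?F pi - ?F (- pi)"
  proof (rule integral_FTC_atLeastAtMost)
    fix t :: real
    have "((\<lambda>z. exp (\<i> * (of_int k * z)) / (\<i> * of_int k)) has_field_derivative exp (\<i> * (of_int k * of_real t))) (at (of_real t))"
      using False by (auto intro!: derivative_eq_intros simp: mult_ac)
    from has_vector_derivative_real_field[OF this]
    show "(?F has_vector_derivative exp (\<i> * complex_of_real (of_int k * t))) (at t within {-pi..pi})"
      by (simp add: o_def)
  qed (auto intro!: continuous_intros)
  also have "exp (\<i> * complex_of_real (of_int k * pi)) = exp (\<i> * complex_of_real (of_int k * (- pi)))"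
  proof -
    have "exp (\<i> * complex_of_real (of_int k * pi)) = exp (\<i> * complex_of_real (of_int k * (- pi)) + of_int k * (2 * of_real pi * \<i>))"
      by (simp add: algebra_simps)
    also have "\<dots> = exp (\<i> * complex_of_real (of_int k * (- pi)))"
      using exp_plus_2pin[of "\<i> * complex_of_real (of_int k * (- pi))" k] by (simp add: mult_ac)
    finally show ?thesis .
  qed
  finally show ?thesis using False by simp
qed

text \<open>The version of \<open>nn_integral_lborel_prod\<close> for complex-valued integrands.\<close>

lemma integral_prod_lborel:
  fixes f :: "'a::euclidean_space \<Rightarrow> real \<Rightarrow> complex"
  assumes "\<And>b. b \<in> Basis \<Longrightarrow> integrable lborel (f b)"
  shows "(\<integral>x. (\<Prod>b\<in>Basis. f b (x \<bullet> b)) \<partial>lborel) = (\<Prod>b\<in>Basis. \<integral>t. f b t \<partial>lborel)"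
proof -
  interpret product_sigma_finite "\<lambda>_::'a. lborel :: real measure" by standard
  have [measurable]: "\<And>b. b \<in> Basis \<Longrightarrow> f b \<in> borel_measurable borel"
    using assms borel_measurable_integrable by fastforce
  have "(\<integral>x. (\<Prod>b\<in>Basis. f b (x \<bullet> b)) \<partial>lborel)
      = (\<integral>x. (\<Prod>b\<in>Basis. f b (x \<bullet> b)) \<partial>distr (\<Pi>\<^sub>M b\<in>(Basis::'a set). lborel) borel (\<lambda>g. \<Sum>b\<in>Basis. g b *\<^sub>R b))"
    by (subst lborel_eq) simp
  also have "\<dots> = (\<integral>g. (\<Prod>b\<in>Basis. f b ((\<Sum>b\<in>Basis. g b *\<^sub>R b) \<bullet> b)) \<partial>(\<Pi>\<^sub>M b\<in>(Basis::'a set). lborel))"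
    by (rule integral_distr) simp_all
  also have "\<dots> = (\<integral>g. (\<Prod>b\<in>Basis. f b (g b)) \<partial>(\<Pi>\<^sub>M b\<in>(Basis::'a set). lborel))"
    by (intro Bochner_Integration.integral_cong refl prod.cong) simp_all
  also have "\<dots> = (\<Prod>b\<in>Basis. \<integral>t. f b t \<partial>lborel)"
    by (rule product_integral_prod) (use assms in auto)
  finally show ?thesis .
qed

text \<open>Orthogonality of the characters. Over the cube the integral factorizes into one-dimensional
integrals, and one of them vanishes if \<open>k \<noteq> 0\<close>.\<close>

lemma integral_fourier_char:
  fixes k :: "int ^ 'n"
  shows "(\<integral>\<theta>. fourier_char k \<theta> \<partial>torus) = (if k = 0 then complex_of_real ((2 * pi) ^ CARD('n)) else 0)"
proof -
  \<comment> \<open>The factors are indexed by basis vectors; the sum selects the coordinate that belongs to \<open>b\<close>.\<close>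
  define f :: "real ^ 'n \<Rightarrow> real \<Rightarrow> complex" where
    "f b t = indicator {-pi..pi} t *\<^sub>R exp (\<i> * complex_of_real (of_int (\<Sum>i\<in>UNIV. if b = axis i 1 then k $ i else 0) * t))" for b t
  have inj: "axis i (1::real) = axis j 1 \<longleftrightarrow> i = j" for i j :: 'n
    by (simp add: axis_eq_axis)
  have fa: "f (axis i 1) t = indicator {-pi..pi} t *\<^sub>R exp (\<i> * complex_of_real (of_int (k $ i) * t))" for i t
    unfolding f_def inj by simp
  have Basis: "(Basis :: (real ^ 'n) set) = (\<lambda>i. axis i 1) ` UNIV"
    by (auto simp: Basis_vec_def)
  have pr: "(\<Prod>b\<in>Basis. g b) = (\<Prod>i\<in>UNIV. g (axis i 1))" for g :: "real ^ 'n \<Rightarrow> complex"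
    unfolding Basis by (subst prod.reindex) (auto simp: inj_on_def inj)
  have fi: "integrable lborel (f b)" if "b \<in> Basis" for b
  proof -
    have "set_integrable lborel {-pi..pi} (\<lambda>t. exp (\<i> * complex_of_real (of_int (\<Sum>i\<in>UNIV. if b = axis i 1 then k $ i else 0) * t)))"
      by (rule borel_integrable_atLeastAtMost') (intro continuous_intros)
    then show ?thesis unfolding set_integrable_def f_def[abs_def] .
  qed
  have "(\<integral>\<theta>. fourier_char k \<theta> \<partial>torus) = (\<integral>\<theta>. indicator torus_cube \<theta> *\<^sub>R fourier_char k \<theta> \<partial>lborel)"
    unfolding torus_def by (rule integral_restrict_space) simp
  also have "\<dots> = (\<integral>\<theta>. (\<Prod>b\<in>Basis. f b (\<theta> \<bullet> b)) \<partial>lborel)"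
  proof (intro Bochner_Integration.integral_cong refl)
    fix \<theta> :: "real ^ 'n"
    have "(\<Prod>b\<in>Basis. f b (\<theta> \<bullet> b)) = (\<Prod>i\<in>UNIV. indicator {-pi..pi} (\<theta> $ i) *\<^sub>R exp (\<i> * complex_of_real (of_int (k $ i) * \<theta> $ i)))"
      unfolding pr fa by (simp add: inner_axis)
    also have "\<dots> = (\<Prod>i\<in>UNIV. complex_of_real (indicator {-pi..pi} (\<theta> $ i))) * (\<Prod>i\<in>UNIV. exp (\<i> * complex_of_real (of_int (k $ i) * \<theta> $ i)))"
      by (simp add: scaleR_conv_of_real prod.distrib)
    also have "(\<Prod>i\<in>UNIV. exp (\<i> * complex_of_real (of_int (k $ i) * \<theta> $ i))) = fourier_char k \<theta>"
      unfolding fourier_char_def of_real_sum sum_distrib_left by (rule exp_sum[symmetric]) simp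
    also have "(\<Prod>i\<in>UNIV. complex_of_real (indicator {-pi..pi} (\<theta> $ i))) = complex_of_real (indicator torus_cube \<theta>)"
    proof (cases "\<theta> \<in> torus_cube")
      case True
      then have "\<theta> $ i \<in> {-pi..pi}" for i by (auto simp: torus_cube_def mem_box_cart)
      then show ?thesis using True by simp
    next
      case False
      then obtain i where "\<theta> $ i \<notin> {-pi..pi}" by (auto simp: torus_cube_def mem_box_cart)
      then have "(\<Prod>i\<in>UNIV. complex_of_real (indicator {-pi..pi} (\<theta> $ i))) = 0"
        by (intro prod_zero bexI[of _ i]) auto
      then show ?thesis using False by simp
    qed
    finally show "indicator torus_cube \<theta> *\<^sub>R fourier_char k \<theta> = (\<Prod>b\<in>Basis. f b (\<theta> \<bullet> b))"
      by (simp add: scaleR_conv_of_real)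
  qed
  also have "\<dots> = (\<Prod>b\<in>Basis. \<integral>t. f b t \<partial>lborel)" by (rule integral_prod_lborel[OF fi])
  also have "\<dots> = (\<Prod>i\<in>UNIV. if k $ i = 0 then complex_of_real (2 * pi) else 0)"
    unfolding pr fa integral_exp_interval ..
  also have "\<dots> = (if k = 0 then complex_of_real ((2 * pi) ^ CARD('n)) else 0)"
  proof (cases "k = 0")
    case False
    then obtain i where "k $ i \<noteq> 0" by (auto simp: vec_eq_iff)
    then show ?thesis using False by (auto intro: prod_zero)
  qed simp
  finally show ?thesis .
qed

definition trig_sum :: "(int ^ 'n \<Rightarrow> real) \<Rightarrow> (int ^ 'n) set \<Rightarrow> real ^ 'n \<Rightarrow> complex" where
  "trig_sum u A \<theta> = (\<Sum>x\<in>A. complex_of_real (u x) * fourier_char x \<theta>)"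

lemma sq_int_char: "sq_int torus (fourier_char x)"
proof -
  interpret finite_measure torus by (rule finite_measure_torus)
  show ?thesis using fourier_char_measurable by (simp add: sq_int_def)
qed

lemma sq_int_trig_sum: "finite A \<Longrightarrow> sq_int torus (trig_sum u A)"
  unfolding trig_sum_def[abs_def] by (intro sq_int_sum sq_int_cmult sq_int_char)

lemma L2sq_trig_sum:
  fixes u :: "int ^ 'n \<Rightarrow> real"
  assumes A: "finite A"
  shows "L2sq torus (trig_sum u A) = (2 * pi) ^ CARD('n) * (\<Sum>x\<in>A. (u x)^2)"
proof -
  interpret finite_measure "torus :: (real ^ 'n) measure" by (rule finite_measure_torus)
  have int: "integrable torus (fourier_char (k :: int ^ 'n))" for k
    by (rule integrable_const_bound[of _ 1]) (auto intro: fourier_char_measurable)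
  have sq: "complex_of_real ((cmod (trig_sum u A \<theta>))^2)
      = (\<Sum>x\<in>A. \<Sum>y\<in>A. complex_of_real (u x * u y) * fourier_char (x - y) \<theta>)" for \<theta>
  proof -
    have "fourier_char x \<theta> * cnj (fourier_char y \<theta>) = fourier_char (x - y) \<theta>" for x y :: "int ^ 'n"
      unfolding cnj_fourier_char fourier_char_add[symmetric] by simp
    then have "(complex_of_real (u x) * fourier_char x \<theta>) * cnj (complex_of_real (u y) * fourier_char y \<theta>)
        = complex_of_real (u x * u y) * fourier_char (x - y) \<theta>" for x y
      by (simp add: mult_ac)
    then show ?thesis
      unfolding complex_norm_square trig_sum_def cnj_sum sum_product by (simp only:)
  qed
  have "complex_of_real (L2sq torus (trig_sum u A)) = (\<integral>\<theta>. complex_of_real ((cmod (trig_sum u A \<theta>))^2) \<partial>torus)"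
    unfolding L2sq_def by (rule integral_complex_of_real[symmetric])
  also have "\<dots> = (\<Sum>x\<in>A. \<Sum>y\<in>A. complex_of_real (u x * u y) * (\<integral>\<theta>. fourier_char (x - y) \<theta> \<partial>torus))"
    unfolding sq using int by (simp add: integrable_mult_right Bochner_Integration.integrable_sum)
  also have "\<dots> = (\<Sum>x\<in>A. complex_of_real ((u x)^2 * (2 * pi) ^ CARD('n)))"
  proof (intro sum.cong refl)
    fix x assume x: "x \<in> A"
    have "(\<Sum>y\<in>A. complex_of_real (u x * u y) * (\<integral>\<theta>. fourier_char (x - y) \<theta> \<partial>torus))
        = (\<Sum>y\<in>A. if y = x then complex_of_real (u x * u x) * complex_of_real ((2 * pi) ^ CARD('n)) else 0)"
      unfolding integral_fourier_char by (intro sum.cong) auto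
    also have "\<dots> = complex_of_real ((u x)^2 * (2 * pi) ^ CARD('n))"
      using A x by (simp add: power2_eq_square)
    finally show "(\<Sum>y\<in>A. complex_of_real (u x * u y) * (\<integral>\<theta>. fourier_char (x - y) \<theta> \<partial>torus))
        = complex_of_real ((u x)^2 * (2 * pi) ^ CARD('n))" .
  qed
  also have "\<dots> = complex_of_real ((2 * pi) ^ CARD('n) * (\<Sum>x\<in>A. (u x)^2))"
    by (simp only: of_real_sum[symmetric] sum_distrib_right[symmetric] mult.commute)
  finally show ?thesis by (simp only: of_real_eq_iff)
qed

abbreviation defect :: "(int ^ 'n \<Rightarrow> real) \<Rightarrow> (real ^ 'n \<Rightarrow> complex) \<Rightarrow> (int ^ 'n) set \<Rightarrow> real" where
  "defect u v A \<equiv> L2sq torus (\<lambda>\<theta>. v \<theta> - trig_sum u A \<theta>)"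

lemma is_dft_iff: "is_dft u v \<longleftrightarrow> sq_int torus v \<and>
    ((\<lambda>A. defect u v A) \<longlongrightarrow> 0) (finite_subsets_at_top UNIV)"
  unfolding is_dft_def sq_int_def L2sq_def set_measurable_torus set_integrable_torus LINT_torus trig_sum_def
  by simp

lemma eventually_finite_fsat: "eventually finite (finite_subsets_at_top UNIV)"
  by (rule eventually_finite_subsets_at_top_weakI)

lemma is_dft_trig_sum:
  assumes "finite B" "\<And>x. x \<notin> B \<Longrightarrow> u x = 0" shows "is_dft u (trig_sum u B)"
proof -
  have "L2sq torus (\<lambda>\<theta>. trig_sum u B \<theta> - trig_sum u A \<theta>) = 0" if "finite A" "B \<subseteq> A" for A
  proof -
    have "trig_sum u A = trig_sum u B"
      unfolding trig_sum_def by (rule ext, rule sum.mono_neutral_right) (use that assms(2) in auto)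
    then show ?thesis by (simp add: L2sq_def)
  qed
  then have "\<forall>\<^sub>F A in finite_subsets_at_top UNIV. L2sq torus (\<lambda>\<theta>. trig_sum u B \<theta> - trig_sum u A \<theta>) = 0"
    unfolding eventually_finite_subsets_at_top using assms(1) by blast
  then show ?thesis
    unfolding is_dft_iff using sq_int_trig_sum[OF assms(1)] by (auto intro: tendsto_eventually)
qed

text \<open>Up to the factor \<open>(2 \<pi>)\<^sup>d\<close> the squared norms of the partial sums are the partial sums of \<open>(u x)\<^sup>2\<close>,
and they converge to the squared norm of \<open>v\<close>; so \<open>u\<close> lies in \<open>l2\<close>.\<close>

theorem parseval:
  fixes u :: "int ^ 'n \<Rightarrow> real"
  assumes "is_dft u v"
  shows "u \<in> l2" "L2sq torus v = (2 * pi) ^ CARD('n) * l2sq u"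
proof -
  let ?F = "finite_subsets_at_top (UNIV :: (int ^ 'n) set)"
  let ?c = "(2 * pi) ^ CARD('n)"
  have v: "sq_int torus v" and lim: "((\<lambda>A. defect u v A) \<longlongrightarrow> 0) ?F"
    using assms by (auto simp: is_dft_iff)
  \<comment> \<open>The limit lemma for norms quantifies over all index sets, the filter sees only the finite ones.\<close>
  define S where "S A = (if finite A then trig_sum u A else (\<lambda>_. 0))" for A
  have S: "sq_int torus (S A)" for A using sq_int_trig_sum by (auto simp: S_def sq_int_def)
  have "((\<lambda>A. L2sq torus (\<lambda>\<theta>. S A \<theta> - v \<theta>)) \<longlongrightarrow> 0) ?F"
    by (rule Lim_transform_eventually[OF lim], rule eventually_mono[OF eventually_finite_fsat])
       (simp add: S_def L2sq_minus_commute)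
  from L2sq_tendsto[OF S v this] have "((\<lambda>A. L2sq torus (S A)) \<longlongrightarrow> L2sq torus v) ?F" .
  then have "((\<lambda>A. L2sq torus (S A) / ?c) \<longlongrightarrow> L2sq torus v / ?c) ?F"
    by (intro tendsto_intros) auto
  then have "((\<lambda>A. \<Sum>x\<in>A. (u x)^2) \<longlongrightarrow> L2sq torus v / ?c) ?F"
    by (rule Lim_transform_eventually, intro eventually_mono[OF eventually_finite_fsat])
       (simp add: S_def L2sq_trig_sum)
  then have hs: "((\<lambda>x. (u x)^2) has_sum (L2sq torus v / ?c)) UNIV" by (simp add: has_sum_def)
  then show "u \<in> l2" unfolding l2_def using has_sum_imp_summable by blast
  have "l2sq u = L2sq torus v / ?c" unfolding l2sq_def using hs by (rule infsumI)
  then show "L2sq torus v = ?c * l2sq u" by simp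
qed

lemma is_dft_sq_int: "is_dft u v \<Longrightarrow> sq_int torus v" by (simp add: is_dft_iff)

lemma is_dft_cong_AE:
  assumes "is_dft u v" "w \<in> borel_measurable torus" "AE \<theta> in torus. v \<theta> = w \<theta>" shows "is_dft u w"
proof -
  have v: "sq_int torus v" using assms(1) by (rule is_dft_sq_int)
  note [measurable] = assms(2) sq_int_measurable[OF v]
  have "integrable torus (\<lambda>\<theta>. (cmod (w \<theta>))^2) \<longleftrightarrow> integrable torus (\<lambda>\<theta>. (cmod (v \<theta>))^2)"
    by (rule integrable_cong_AE) (use assms(3) in auto)
  then have w: "sq_int torus w" using v assms(2) by (simp add: sq_int_def)
  have "defect u v A = defect u w A" if "finite A" for A
    by (rule L2sq_cong_AE[OF sq_int_diff[OF v] sq_int_diff[OF w]])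
       (use assms(3) sq_int_trig_sum[OF that] in auto)
  then have "\<forall>\<^sub>F A in finite_subsets_at_top UNIV.
      defect u v A = defect u w A"
    by (rule eventually_mono[OF eventually_finite_fsat])
  from Lim_transform_eventually[OF _ this] show ?thesis using assms(1) w by (simp add: is_dft_iff)
qed

lemma is_dft_scale:
  assumes "is_dft u v" shows "is_dft (\<lambda>x. k * u x) (\<lambda>\<theta>. complex_of_real k * v \<theta>)"
proof -
  have "(\<lambda>\<theta>. complex_of_real k * v \<theta> - trig_sum (\<lambda>x. k * u x) A \<theta>)
      = (\<lambda>\<theta>. complex_of_real k * (v \<theta> - trig_sum u A \<theta>))" for A
    by (simp add: trig_sum_def sum_distrib_left right_diff_distrib mult.assoc)
  then show ?thesis
    using assms unfolding is_dft_iff by (auto simp: sq_int_cmult L2sq_cmult intro: tendsto_mult_right_zero)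
qed

lemma is_dft_add:
  assumes "is_dft u v" "is_dft u' v'" shows "is_dft (\<lambda>x. u x + u' x) (\<lambda>\<theta>. v \<theta> + v' \<theta>)"
proof -
  let ?F = "finite_subsets_at_top UNIV"
  have v: "sq_int torus v" "sq_int torus v'" using assms by (auto dest: is_dft_sq_int)
  have lim: "((\<lambda>A. defect u v A) \<longlongrightarrow> 0) ?F"
    "((\<lambda>A. defect u' v' A) \<longlongrightarrow> 0) ?F"
    using assms by (simp_all add: is_dft_iff)
  have "((\<lambda>A. L2sq torus (\<lambda>\<theta>. (v \<theta> + v' \<theta>) - trig_sum (\<lambda>x. u x + u' x) A \<theta>)) \<longlongrightarrow> 0) ?F"
  proof (rule tendsto_sandwich[OF _ _ tendsto_const])
    show "((\<lambda>A. 2 * defect u v A + 2 * defect u' v' A) \<longlongrightarrow> 0) ?F"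
      using tendsto_add[OF tendsto_mult_right_zero[OF lim(1), of 2] tendsto_mult_right_zero[OF lim(2), of 2]] by simp
    show "\<forall>\<^sub>F A in ?F. L2sq torus (\<lambda>\<theta>. (v \<theta> + v' \<theta>) - trig_sum (\<lambda>x. u x + u' x) A \<theta>)
        \<le> 2 * defect u v A + 2 * defect u' v' A"
      using eventually_finite_fsat
    proof eventually_elim
      case (elim A)
      have "(\<lambda>\<theta>. (v \<theta> + v' \<theta>) - trig_sum (\<lambda>x. u x + u' x) A \<theta>)
          = (\<lambda>\<theta>. (v \<theta> - trig_sum u A \<theta>) + (v' \<theta> - trig_sum u' A \<theta>))"
        by (simp add: trig_sum_def distrib_right sum.distrib algebra_simps)
      then show ?case
        using L2sq_add_le[OF sq_int_diff[OF v(1) sq_int_trig_sum[OF elim]] sq_int_diff[OF v(2) sq_int_trig_sum[OF elim]], of u u']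
        by simp
    qed
  qed simp
  then show ?thesis using sq_int_add[OF v] by (simp add: is_dft_iff)
qed

lemma is_dft_diff:
  assumes "is_dft u v" "is_dft u' v'" shows "is_dft (\<lambda>x. u x - u' x) (\<lambda>\<theta>. v \<theta> - v' \<theta>)"
  using is_dft_add[OF assms(1) is_dft_scale[OF assms(2), of "-1"]] by simp

lemma is_dft_unique:
  assumes "is_dft u v" "is_dft u w" shows "AE \<theta> in torus. v \<theta> = w \<theta>"
proof -
  have d: "is_dft (\<lambda>x. u x - u x) (\<lambda>\<theta>. v \<theta> - w \<theta>)" by (rule is_dft_diff[OF assms])
  have "L2sq torus (\<lambda>\<theta>. v \<theta> - w \<theta>) = 0" using parseval(2)[OF d] by (simp add: l2sq_def)
  from L2sq_eq_0_AE[OF is_dft_sq_int[OF d] this] show ?thesis by simp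
qed

lemma is_dft_inj:
  assumes "is_dft u v" "is_dft w v" shows "u = w"
proof
  fix x
  have d: "is_dft (\<lambda>x. u x - w x) (\<lambda>\<theta>. v \<theta> - v \<theta>)" by (rule is_dft_diff[OF assms])
  have "l2sq (\<lambda>x. u x - w x) = 0" using parseval(2)[OF d] by (simp add: L2sq_def)
  then show "u x = w x" using l2_pointwise_le[OF parseval(1)[OF d], of x] by simp
qed

text \<open>Multiplication by a character preserves the modulus, so the error of a partial sum of the shifted
function is the error of the partial sum over the shifted index set.\<close>

lemma is_dft_shift:
  fixes y :: "int ^ 'n"
  assumes "is_dft u v" shows "is_dft (\<lambda>x. u (x - y)) (\<lambda>\<theta>. fourier_char y \<theta> * v \<theta>)"
proof -
  have v: "sq_int torus v" using assms by (rule is_dft_sq_int)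
  have eq: "L2sq torus (\<lambda>\<theta>. fourier_char y \<theta> * v \<theta> - trig_sum (\<lambda>x. u (x - y)) A \<theta>)
      = L2sq torus (\<lambda>\<theta>. v \<theta> - trig_sum u ((\<lambda>x. x - y) ` A) \<theta>)" for A
  proof -
    have "trig_sum (\<lambda>x. u (x - y)) A \<theta> = fourier_char y \<theta> * trig_sum u ((\<lambda>x. x - y) ` A) \<theta>" for \<theta>
    proof -
      have f: "fourier_char x \<theta> = fourier_char y \<theta> * fourier_char (x - y) \<theta>" for x
        unfolding fourier_char_add[symmetric] by simp
      have g: "complex_of_real (u (x - y)) * fourier_char x \<theta>
          = fourier_char y \<theta> * (complex_of_real (u (x - y)) * fourier_char (x - y) \<theta>)" for x
        by (subst f[of x]) (rule mult.left_commute)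
      have "trig_sum (\<lambda>x. u (x - y)) A \<theta> = (\<Sum>x\<in>A. fourier_char y \<theta> * (complex_of_real (u (x - y)) * fourier_char (x - y) \<theta>))"
        unfolding trig_sum_def by (intro sum.cong refl g)
      also have "\<dots> = fourier_char y \<theta> * trig_sum u ((\<lambda>x. x - y) ` A) \<theta>"
        unfolding trig_sum_def sum_distrib_left by (subst sum.reindex) (auto simp: inj_on_def)
      finally show ?thesis .
    qed
    then show ?thesis
      unfolding L2sq_def by (simp only: right_diff_distrib[symmetric] norm_mult norm_fourier_char mult_1_left)
  qed
  have bij: "filtermap (image (\<lambda>x. x - y)) (finite_subsets_at_top UNIV) = finite_subsets_at_top UNIV"
    using filtermap_image_finite_subsets_at_top[of "\<lambda>x. x - y" UNIV] by (simp add: inj_on_def surj_diff_right)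
  have "((\<lambda>A. defect u v A) \<longlongrightarrow> 0)
      (filtermap (image (\<lambda>x. x - y)) (finite_subsets_at_top UNIV))"
    unfolding bij using assms by (simp add: is_dft_iff)
  then have "((\<lambda>A. L2sq torus (\<lambda>\<theta>. v \<theta> - trig_sum u ((\<lambda>x. x - y) ` A) \<theta>)) \<longlongrightarrow> 0) (finite_subsets_at_top UNIV)"
    by (simp add: filterlim_filtermap)
  moreover have "sq_int torus (\<lambda>\<theta>. fourier_char y \<theta> * v \<theta>)"
    by (rule sq_int_mult(1)[OF v fourier_char_measurable, of y 1]) simp
  ultimately show ?thesis unfolding is_dft_iff eq by simp
qed

section \<open>Fourier multipliers and the fractional Laplacian\<close>

lemma L2sq_dft_diff:
  fixes u u' :: "int ^ 'n \<Rightarrow> real"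
  assumes "is_dft u v" "is_dft u' v'"
  shows "(\<lambda>x. u x - u' x) \<in> l2"
    and "L2sq torus (\<lambda>\<theta>. v \<theta> - v' \<theta>) = (2 * pi) ^ CARD('n) * l2sq (\<lambda>x. u x - u' x)"
  using parseval[OF is_dft_diff[OF assms]] by auto

text \<open>By Parseval the coefficients \<open>u n\<close> are Cauchy in \<open>l2\<close> with the same moduli as the \<open>v n\<close>. Hence the
partial sums of \<open>z\<close> over \<open>B\<close> differ from those of \<open>u n\<close> by at most \<open>2 * a n\<close> in squared norm, uniformly in \<open>B\<close>.\<close>

lemma is_dft_limit:
  fixes u :: "nat \<Rightarrow> int ^ 'n \<Rightarrow> real"
  assumes dft: "\<And>n. is_dft (u n) (v n)" and v: "sq_int torus w"
    and lim: "(\<lambda>n. L2sq torus (\<lambda>\<theta>. v n \<theta> - w \<theta>)) \<longlonglongrightarrow> 0"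
    and pt: "\<And>x. (\<lambda>n. u n x) \<longlonglongrightarrow> z x"
  shows "is_dft z w"
proof -
  let ?F = "finite_subsets_at_top (UNIV :: (int ^ 'n) set)"
  define a where "a n = L2sq torus (\<lambda>\<theta>. v n \<theta> - w \<theta>)" for n
  have vn: "sq_int torus (v n)" for n by (rule is_dft_sq_int[OF dft])
  have head: "(2 * pi) ^ CARD('n) * (\<Sum>x\<in>B. (u n x - z x)^2) \<le> 2 * a n" if B: "finite B" for B n
  proof (rule LIMSEQ_le)
    let ?S = "\<lambda>k. (2 * pi) ^ CARD('n) * (\<Sum>x\<in>B. (u n x - u k x)^2)"
    show "?S \<longlonglongrightarrow> (2 * pi) ^ CARD('n) * (\<Sum>x\<in>B. (u n x - z x)^2)"
      by (intro tendsto_intros pt)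
    show "(\<lambda>k. 2 * a n + 2 * a k) \<longlonglongrightarrow> 2 * a n"
      using tendsto_add[OF tendsto_const tendsto_mult_right_zero[OF lim, of 2], of "2 * a n"]
      by (simp add: a_def)
    have "?S k \<le> 2 * a n + 2 * a k" for k
    proof -
      have "(\<Sum>x\<in>B. (u n x - u k x)^2) \<le> l2sq (\<lambda>x. u n x - u k x)"
        unfolding l2sq_def using L2sq_dft_diff(1)[OF dft dft, of n k] B
        by (intro finite_sum_le_infsum) (auto simp: l2_def)
      then have "?S k \<le> L2sq torus (\<lambda>\<theta>. v n \<theta> - v k \<theta>)"
        unfolding L2sq_dft_diff(2)[OF dft dft, of n k] by (intro mult_left_mono) auto
      also have "\<dots> \<le> 2 * a n + 2 * a k"
        using L2sq_triangle[OF vn v vn, of n k] L2sq_minus_commute[of torus w "v k"] by (simp add: a_def)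
      finally show ?thesis .
    qed
    then show "\<exists>N. \<forall>k\<ge>N. ?S k \<le> 2 * a n + 2 * a k" by blast
  qed
  have bound: "defect z w B \<le> 10 * a n + 4 * defect (u n) (v n) B"
    if B: "finite B" for B n
  proof -
    note t = sq_int_trig_sum[OF B]
    have "L2sq torus (\<lambda>\<theta>. trig_sum (u n) B \<theta> - trig_sum z B \<theta>) = L2sq torus (trig_sum (\<lambda>x. u n x - z x) B)"
      by (simp add: trig_sum_def[abs_def] left_diff_distrib sum_subtractf)
    also have "\<dots> \<le> 2 * a n" unfolding L2sq_trig_sum[OF B] by (rule head[OF B])
    finally have 1: "L2sq torus (\<lambda>\<theta>. trig_sum (u n) B \<theta> - trig_sum z B \<theta>) \<le> 2 * a n" .
    have 2: "defect z (v n) B \<le> 2 * defect (u n) (v n) B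
        + 2 * L2sq torus (\<lambda>\<theta>. trig_sum (u n) B \<theta> - trig_sum z B \<theta>)"
      by (rule L2sq_triangle[OF vn t t])
    have 3: "defect z w B \<le> 2 * a n + 2 * defect z (v n) B"
      using L2sq_triangle[OF v vn t, of z n] L2sq_minus_commute[of torus w "v n"] by (simp add: a_def)
    have "0 \<le> a n" by (simp add: a_def)
    then show ?thesis using 1 2 3 by linarith
  qed
  have "((\<lambda>B. defect z w B) \<longlongrightarrow> 0) ?F"
  proof (rule order_tendstoI)
    fix e :: real assume e: "0 < e"
    have "\<forall>\<^sub>F n in sequentially. a n < e / 20"
      using order_tendstoD(2)[OF lim, of "e / 20"] e by (simp add: a_def)
    then obtain n where n: "a n < e / 20" by (auto simp: eventually_sequentially)
    have "((\<lambda>B. defect (u n) (v n) B) \<longlongrightarrow> 0) ?F"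
      using dft[of n] by (simp add: is_dft_iff)
    then have "\<forall>\<^sub>F B in ?F. defect (u n) (v n) B < e / 8"
      using order_tendstoD(2)[of _ 0 ?F "e / 8"] e by simp
    then show "\<forall>\<^sub>F B in ?F. defect z w B < e"
      using eventually_finite_fsat
    proof eventually_elim
      case (elim B)
      then show ?case using bound[OF elim(2), of n] n by linarith
    qed
  next
    fix e :: real assume "e < 0"
    then have "e < defect z w B" for B
      by (rule order_less_le_trans) simp
    then show "\<forall>\<^sub>F B in ?F. e < defect z w B" by simp
  qed
  then show ?thesis using v by (simp add: is_dft_iff)
qed

text \<open>The set of transforms is closed in the mean. With this, the operator with a given multiplier can be
constructed by approximating the multiplier.\<close>

lemma is_dft_limit_exists:
  fixes u :: "nat \<Rightarrow> int ^ 'n \<Rightarrow> real"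
  assumes dft: "\<And>n. is_dft (u n) (v n)" and v: "sq_int torus w"
    and lim: "(\<lambda>n. L2sq torus (\<lambda>\<theta>. v n \<theta> - w \<theta>)) \<longlonglongrightarrow> 0"
  shows "\<exists>z. is_dft z w"
proof -
  define a where "a n = L2sq torus (\<lambda>\<theta>. v n \<theta> - w \<theta>)" for n
  have vn: "sq_int torus (v n)" for n by (rule is_dft_sq_int[OF dft])
  have "convergent (\<lambda>n. u n x)" for x
  proof -
    have "Cauchy (\<lambda>n. u n x)"
    proof (rule CauchyI)
      fix e :: real assume e: "0 < e"
      define c where "c = (2 * pi) ^ CARD('n)"
      have c: "0 < c" by (simp add: c_def)
      have "\<forall>\<^sub>F n in sequentially. a n < c * e^2 / 4"
        using order_tendstoD(2)[OF lim, of "c * e^2 / 4"] e c by (simp add: a_def)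
      then obtain N where N: "\<And>n. n \<ge> N \<Longrightarrow> a n < c * e^2 / 4" by (auto simp: eventually_sequentially)
      have "\<bar>u m x - u n x\<bar> < e" if mn: "m \<ge> N" "n \<ge> N" for m n
      proof -
        have "c * l2sq (\<lambda>x. u m x - u n x) \<le> 2 * a m + 2 * a n"
          using L2sq_triangle[OF vn v vn, of m n] L2sq_minus_commute[of torus w "v n"]
          unfolding L2sq_dft_diff(2)[OF dft dft, of m n] by (simp add: a_def c_def)
        also have "\<dots> < c * e^2" using N[OF mn(1)] N[OF mn(2)] by linarith
        finally have "l2sq (\<lambda>x. u m x - u n x) < e^2" using c by simp
        then have "sqrt (l2sq (\<lambda>x. u m x - u n x)) < e" using e by (intro real_less_lsqrt) auto
        then show ?thesis using l2_pointwise_le[OF L2sq_dft_diff(1)[OF dft dft, of m n], of x] by linarith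
      qed
      then show "\<exists>M. \<forall>m\<ge>M. \<forall>n\<ge>M. norm (u m x - u n x) < e" by auto
    qed
    then show ?thesis by (rule Cauchy_convergent)
  qed
  then have "(\<lambda>n. u n x) \<longlonglongrightarrow> lim (\<lambda>n. u n x)" for x by (simp add: convergent_LIMSEQ_iff)
  from is_dft_limit[OF dft v lim this] show ?thesis by blast
qed

text \<open>The transforms of the truncations of \<open>u\<close> to an exhausting sequence of finite sets are trigonometric
sums, and they are Cauchy in the mean.\<close>

theorem dft_exists:
  fixes u :: "int ^ 'n \<Rightarrow> real"
  assumes u: "u \<in> l2" shows "\<exists>v. is_dft u v"
proof -
  define A where "A k = {x :: int ^ 'n. to_nat x < k}" for k
  have A: "finite (A k)" for k
    unfolding A_def using finite_vimageI[OF finite_lessThan inj_to_nat, of k] unfolding vimage_def lessThan_iff .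
  define t where "t k x = (if x \<in> A k then u x else 0)" for k x
  have t: "is_dft (t k) (trig_sum (t k) (A k))" for k
    by (rule is_dft_trig_sum[OF A]) (simp add: t_def)
  let ?v = "\<lambda>k. trig_sum (t k) (A k)"
  define c where "c = (2 * pi) ^ CARD('n)"
  have c: "0 < c" by (simp add: c_def)
  have Cauchy: "\<exists>N. \<forall>m\<ge>N. \<forall>n\<ge>N. L2sq torus (\<lambda>\<theta>. ?v m \<theta> - ?v n \<theta>) < e" if e: "0 < e" for e
  proof -
    obtain B where B: "finite B" "(\<lambda>x. if x \<in> B then 0 else u x) \<in> l2"
        "l2sq (\<lambda>x. if x \<in> B then 0 else u x) \<le> e / (2 * c)"
      using l2_truncate[OF u, of "e / (2 * c)"] e c by auto
    obtain N where N: "\<And>x. x \<in> B \<Longrightarrow> to_nat x < N"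
      using finite_nat_set_iff_bounded[THEN iffD1, OF finite_imageI[OF B(1), of to_nat]] by blast
    have "L2sq torus (\<lambda>\<theta>. ?v m \<theta> - ?v n \<theta>) < e" if mn: "m \<ge> N" "n \<ge> N" for m n
    proof -
      have "l2sq (\<lambda>x. t m x - t n x) \<le> l2sq (\<lambda>x. if x \<in> B then 0 else u x)"
        unfolding l2sq_def
      proof (rule infsum_mono)
        show "(\<lambda>x. (t m x - t n x)^2) summable_on UNIV"
          using L2sq_dft_diff(1)[OF t t] by (simp add: l2_def)
        show "(\<lambda>x. (if x \<in> B then 0 else u x)^2) summable_on UNIV" using B(2) by (simp add: l2_def)
        show "(t m x - t n x)^2 \<le> (if x \<in> B then 0 else u x)^2" for x
          using N[of x] mn by (auto simp: t_def A_def)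
      qed
      then have "c * l2sq (\<lambda>x. t m x - t n x) \<le> c * (e / (2 * c))" using B(3) c by (intro mult_left_mono) auto
      also have "\<dots> < e" using c e by simp
      finally show ?thesis unfolding L2sq_dft_diff(2)[OF t t] c_def .
    qed
    then show ?thesis by blast
  qed
  obtain w where w: "sq_int torus w" "(\<lambda>n. L2sq torus (\<lambda>\<theta>. ?v n \<theta> - w \<theta>)) \<longlonglongrightarrow> 0"
  proof (rule L2_complete[OF finite_measure_torus, of ?v])
    show "sq_int torus (?v n)" for n by (rule is_dft_sq_int[OF t])
    show "\<exists>N. \<forall>m\<ge>N. \<forall>n\<ge>N. L2sq torus (\<lambda>\<theta>. ?v m \<theta> - ?v n \<theta>) < e" if "0 < e" for e
      using that by (rule Cauchy)
  qed
  have "(\<lambda>k. t k x) \<longlonglongrightarrow> u x" for x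
  proof (rule tendsto_eventually)
    have "t k x = u x" if "Suc (to_nat x) \<le> k" for k using that by (simp add: t_def A_def)
    then show "\<forall>\<^sub>F k in sequentially. t k x = u x" unfolding eventually_sequentially by blast
  qed
  from is_dft_limit[OF t w this] show ?thesis by blast
qed

lemma is_dft_dft: "u \<in> l2 \<Longrightarrow> is_dft u (dft u)"
  unfolding dft_def by (rule someI_ex[OF dft_exists])

text \<open>The requirement includes that the resulting function on the lattice is real-valued, which
\<^const>\<open>is_dft\<close> has built in.\<close>

definition multiplier :: "(real ^ 'n \<Rightarrow> real) \<Rightarrow> bool" where
  "multiplier b \<longleftrightarrow> (\<forall>u v. is_dft u v \<longrightarrow> (\<exists>w. is_dft w (\<lambda>\<theta>. complex_of_real (b \<theta>) * v \<theta>)))"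

lemma multiplier_const: "multiplier (\<lambda>_. k)"
  unfolding multiplier_def using is_dft_scale by blast

lemma multiplier_add:
  fixes b b' :: "real ^ 'n \<Rightarrow> real"
  assumes "multiplier b" "multiplier b'" shows "multiplier (\<lambda>\<theta>. b \<theta> + b' \<theta>)"
  unfolding multiplier_def
proof (intro allI impI)
  fix u :: "int ^ 'n \<Rightarrow> real" and v assume "is_dft u v"
  then obtain w w' where "is_dft w (\<lambda>\<theta>. complex_of_real (b \<theta>) * v \<theta>)" "is_dft w' (\<lambda>\<theta>. complex_of_real (b' \<theta>) * v \<theta>)"
    using assms unfolding multiplier_def by blast
  from is_dft_add[OF this] show "\<exists>w. is_dft w (\<lambda>\<theta>. complex_of_real (b \<theta> + b' \<theta>) * v \<theta>)"
    by (auto simp: distrib_right)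
qed

lemma multiplier_mult:
  fixes b b' :: "real ^ 'n \<Rightarrow> real"
  assumes "multiplier b" "multiplier b'" shows "multiplier (\<lambda>\<theta>. b \<theta> * b' \<theta>)"
  unfolding multiplier_def
proof (intro allI impI)
  fix u :: "int ^ 'n \<Rightarrow> real" and v assume "is_dft u v"
  then obtain w where "is_dft w (\<lambda>\<theta>. complex_of_real (b' \<theta>) * v \<theta>)"
    using assms(2) unfolding multiplier_def by blast
  then obtain z where "is_dft z (\<lambda>\<theta>. complex_of_real (b \<theta>) * (complex_of_real (b' \<theta>) * v \<theta>))"
    using assms(1) unfolding multiplier_def by blast
  then show "\<exists>w. is_dft w (\<lambda>\<theta>. complex_of_real (b \<theta> * b' \<theta>) * v \<theta>)"
    by (auto simp: mult.assoc)
qed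

text \<open>By Euler's formula this multiplier averages the two translations in direction \<open>i\<close>.\<close>

lemma multiplier_cos: "multiplier (\<lambda>\<theta> :: real ^ 'n. cos (\<theta> $ i))"
  unfolding multiplier_def
proof (intro allI impI)
  fix u :: "int ^ 'n \<Rightarrow> real" and v assume d: "is_dft u v"
  have fc: "fourier_char (axis i k) \<theta> = exp (\<i> * complex_of_real (of_int k * \<theta> $ i))" for k and \<theta> :: "real ^ 'n"
  proof -
    have "(\<Sum>j\<in>UNIV. of_int (axis i k $ j) * \<theta> $ j) = (\<Sum>j\<in>UNIV. if j = i then of_int k * \<theta> $ i else 0)"
      by (intro sum.cong refl) (auto simp: axis_def)
    then show ?thesis unfolding fourier_char_def by simp
  qed
  have eq: "complex_of_real (1/2) * (fourier_char (axis i 1) \<theta> * v \<theta> + fourier_char (axis i (-1)) \<theta> * v \<theta>)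
      = complex_of_real (cos (\<theta> $ i)) * v \<theta>" for \<theta>
    unfolding fc by (simp add: cos_of_real[symmetric] cos_exp_eq field_simps)
  from is_dft_scale[OF is_dft_add[OF is_dft_shift[OF d] is_dft_shift[OF d]], of "1/2" "axis i 1" "axis i (-1)"]
  show "\<exists>w. is_dft w (\<lambda>\<theta>. complex_of_real (cos (\<theta> $ i)) * v \<theta>)"
    unfolding eq by blast
qed

lemma multiplier_sum: "finite A \<Longrightarrow> (\<And>i. i \<in> A \<Longrightarrow> multiplier (b i)) \<Longrightarrow> multiplier (\<lambda>\<theta>. \<Sum>i\<in>A. b i \<theta>)"
  by (induction A rule: finite_induct) (auto intro: multiplier_const multiplier_add)

lemma multiplier_symbol: "multiplier laplace_symbol"
proof -
  have "laplace_symbol \<theta> = (\<Sum>i\<in>UNIV. 2 + (- 2) * cos (\<theta> $ i))" for \<theta> :: "real ^ 'n"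
  proof -
    have "4 * (sin (t / 2))^2 = 2 + (- 2) * cos t" for t :: real
      using cos_double_sin[of "t / 2"] by simp
    then show ?thesis unfolding laplace_symbol_def by (simp only:)
  qed
  then have eq: "laplace_symbol = (\<lambda>\<theta> :: real ^ 'n. \<Sum>i\<in>UNIV. 2 + (- 2) * cos (\<theta> $ i))" by blast
  show ?thesis unfolding eq
    by (intro multiplier_sum multiplier_add multiplier_const multiplier_mult multiplier_cos) simp
qed

lemma multiplier_polynomial:
  fixes q :: "real \<Rightarrow> real"
  assumes "multiplier b" "real_polynomial_function q" shows "multiplier (\<lambda>\<theta>. q (b \<theta>))"
  using assms(2)
proof (induction q rule: real_polynomial_function.induct)
  case (linear q)
  then have "q s = q 1 * s" for s using linear_cmul[of q s 1] by (simp add: bounded_linear.linear)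
  then have "(\<lambda>\<theta>. q (b \<theta>)) = (\<lambda>\<theta>. q 1 * b \<theta>)" by blast
  then show ?case using multiplier_mult[OF multiplier_const assms(1)] by simp
qed (auto intro: multiplier_const multiplier_add multiplier_mult)

lemma multiplier_uniform_limit:
  fixes b :: "real ^ 'n \<Rightarrow> real"
  assumes b: "b \<in> borel_measurable torus" "\<And>\<theta>. \<theta> \<in> torus_cube \<Longrightarrow> \<bar>b \<theta>\<bar> \<le> C"
    and ap: "\<And>e. 0 < e \<Longrightarrow> \<exists>b'. multiplier b' \<and> (\<forall>\<theta>\<in>torus_cube. \<bar>b \<theta> - b' \<theta>\<bar> < e)"
  shows "multiplier b"
  unfolding multiplier_def
proof (intro allI impI)
  fix u :: "int ^ 'n \<Rightarrow> real" and v assume d: "is_dft u v"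
  have v: "sq_int torus v" by (rule is_dft_sq_int[OF d])
  have bc: "(\<lambda>\<theta>. complex_of_real (b \<theta>)) \<in> borel_measurable torus" using b(1) by simp
  have bv: "sq_int torus (\<lambda>\<theta>. complex_of_real (b \<theta>) * v \<theta>)"
    by (rule sq_int_mult(1)[OF v bc, of C]) (use b(2) in \<open>simp add: space_torus\<close>)
  have "\<exists>b'. multiplier b' \<and> (\<forall>\<theta>\<in>torus_cube. \<bar>b \<theta> - b' \<theta>\<bar> < inverse (real (Suc n)))" for n
    by (rule ap) simp
  then have "\<exists>B. \<forall>n. multiplier (B n) \<and> (\<forall>\<theta>\<in>torus_cube. \<bar>b \<theta> - B n \<theta>\<bar> < inverse (real (Suc n)))"
    by (intro choice allI)
  then obtain B where B: "\<And>n. multiplier (B n)" "\<And>n \<theta>. \<theta> \<in> torus_cube \<Longrightarrow> \<bar>b \<theta> - B n \<theta>\<bar> < inverse (real (Suc n))"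
    by blast
  have "\<exists>w. is_dft w (\<lambda>\<theta>. complex_of_real (B n \<theta>) * v \<theta>)" for n
    using B(1) d unfolding multiplier_def by blast
  then have "\<exists>w. \<forall>n. is_dft (w n) (\<lambda>\<theta>. complex_of_real (B n \<theta>) * v \<theta>)"
    by (intro choice allI)
  then obtain w where w: "\<And>n. is_dft (w n) (\<lambda>\<theta>. complex_of_real (B n \<theta>) * v \<theta>)" by blast
  let ?D = "\<lambda>n \<theta>. complex_of_real (B n \<theta>) * v \<theta> - complex_of_real (b \<theta>) * v \<theta>"
  have le: "L2sq torus (?D n)
      \<le> (inverse (real (Suc n)))^2 * L2sq torus v" for n
  proof -
    have i: "integrable torus (\<lambda>\<theta>. (inverse (real (Suc n)))^2 * (cmod (v \<theta>))^2)"
      using v by (auto simp: sq_int_def)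
    have "L2sq torus (?D n)
        \<le> (\<integral>\<theta>. (inverse (real (Suc n)))^2 * (cmod (v \<theta>))^2 \<partial>torus)"
      unfolding L2sq_def
    proof (rule integral_mono[OF _ i])
      show "integrable torus (\<lambda>\<theta>. (cmod (?D n \<theta>))^2)"
        using sq_int_diff[OF is_dft_sq_int[OF w] bv] by (simp add: sq_int_def)
      fix \<theta> :: "real ^ 'n" assume "\<theta> \<in> space torus"
      then have "\<bar>B n \<theta> - b \<theta>\<bar> \<le> inverse (real (Suc n))"
        using B(2)[of \<theta> n] by (simp add: space_torus abs_minus_commute)
      moreover have "cmod (?D n \<theta>) = \<bar>B n \<theta> - b \<theta>\<bar> * cmod (v \<theta>)"
        unfolding left_diff_distrib[symmetric] of_real_diff[symmetric] norm_mult norm_of_real ..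
      ultimately show "(cmod (?D n \<theta>))^2
          \<le> (inverse (real (Suc n)))^2 * (cmod (v \<theta>))^2"
        unfolding power_mult_distrib[symmetric] by (simp only:) (intro power_mono mult_right_mono, auto)
    qed
    then show ?thesis by (simp add: L2sq_def)
  qed
  have "(\<lambda>n. L2sq torus (?D n)) \<longlonglongrightarrow> 0"
  proof (rule tendsto_sandwich[OF _ _ tendsto_const])
    have "(\<lambda>n. (inverse (real (Suc n)))^2) \<longlonglongrightarrow> 0"
      using tendsto_power[OF LIMSEQ_inverse_real_of_nat, of 2] by simp
    then show "(\<lambda>n. (inverse (real (Suc n)))^2 * L2sq torus v) \<longlonglongrightarrow> 0"
      by (rule tendsto_mult_left_zero)
  qed (use le in auto)
  from is_dft_limit_exists[OF w bv this] show "\<exists>w. is_dft w (\<lambda>\<theta>. complex_of_real (b \<theta>) * v \<theta>)" .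
qed

lemma symbol_bounds: "0 \<le> laplace_symbol \<theta>" "laplace_symbol (\<theta> :: real ^ 'n) \<le> 4 * CARD('n)"
proof -
  show "0 \<le> laplace_symbol \<theta>" unfolding laplace_symbol_def by (intro sum_nonneg) simp
  have "laplace_symbol \<theta> \<le> (\<Sum>i\<in>(UNIV :: 'n set). 4)"
    unfolding laplace_symbol_def by (intro sum_mono) (simp add: abs_square_le_1)
  then show "laplace_symbol \<theta> \<le> 4 * CARD('n)" by simp
qed

lemma symbol_measurable: "laplace_symbol \<in> borel_measurable (torus :: (real ^ 'n) measure)"
proof (intro measurable_torus borel_measurable_continuous_onI)
  show "continuous_on UNIV (laplace_symbol :: real ^ 'n \<Rightarrow> real)"
    unfolding laplace_symbol_def[abs_def] by (intro continuous_intros) auto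
qed

lemma symbol_powr_measurable: "(\<lambda>\<theta> :: real ^ 'n. laplace_symbol \<theta> powr \<alpha>) \<in> borel_measurable torus"
  by (rule powr_real_measurable[OF symbol_measurable borel_measurable_const])

lemma symbol_powr_le:
  assumes "0 < \<alpha>" shows "\<bar>laplace_symbol (\<theta> :: real ^ 'n) powr \<alpha>\<bar> \<le> (4 * CARD('n)) powr \<alpha>"
  using symbol_bounds[of \<theta>] assms by (simp add: powr_mono2)

text \<open>The symbol takes values in \<open>[0, 4 d]\<close>, where \<open>s powr \<alpha>\<close> is a uniform limit of polynomials by the
Weierstrass theorem, and polynomials in the symbol are multipliers.\<close>

theorem multiplier_symbol_powr:
  assumes "0 < \<alpha>" shows "multiplier (\<lambda>\<theta> :: real ^ 'n. laplace_symbol \<theta> powr \<alpha>)"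
proof (rule multiplier_uniform_limit[OF symbol_powr_measurable symbol_powr_le[OF assms]])
  fix e :: real assume e: "0 < e"
  have cont: "continuous_on {0..real (4 * CARD('n))} (\<lambda>s. s powr \<alpha>)"
    by (rule continuous_on_powr'[OF continuous_on_id continuous_on_const]) (use assms in auto)
  obtain q where q: "real_polynomial_function q" "\<And>s. s \<in> {0..real (4 * CARD('n))} \<Longrightarrow> \<bar>s powr \<alpha> - q s\<bar> < e"
    by (rule Stone_Weierstrass_real_polynomial_function[OF compact_Icc cont e]) (rule that; blast)
  show "\<exists>b'. multiplier b' \<and> (\<forall>\<theta>\<in>torus_cube. \<bar>laplace_symbol (\<theta> :: real ^ 'n) powr \<alpha> - b' \<theta>\<bar> < e)"
    by (intro exI[of _ "\<lambda>\<theta>. q (laplace_symbol \<theta>)"] conjI ballI multiplier_polynomial[OF multiplier_symbol q(1)] q(2))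
       (use symbol_bounds in auto)
qed

lemma l2_eq_lattice_l2: "lattice_l2 = l2"
  by (simp add: lattice_l2_def l2_def)

text \<open>The definite description is justified: existence is the multiplier theorem, uniqueness is
injectivity of the transform.\<close>

theorem is_dft_frac_laplacian:
  fixes u :: "int ^ 'n \<Rightarrow> real"
  assumes \<alpha>: "0 < \<alpha>" and u: "u \<in> l2"
  shows "is_dft (frac_laplacian \<alpha> u) (\<lambda>\<theta>. complex_of_real (laplace_symbol \<theta> powr \<alpha>) * dft u \<theta>)"
proof -
  let ?v = "\<lambda>\<theta>. complex_of_real (laplace_symbol \<theta> powr \<alpha>) * dft u \<theta>"
  obtain w where w: "is_dft w ?v"
    using multiplier_symbol_powr[OF \<alpha>, unfolded multiplier_def, rule_format, OF is_dft_dft[OF u]] ..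
  have "frac_laplacian \<alpha> u = w"
    unfolding frac_laplacian_def AE_torus l2_eq_lattice_l2
  proof (rule the_equality)
    show "w \<in> l2 \<and> (AE \<theta> in torus. dft w \<theta> = ?v \<theta>)"
      using parseval(1)[OF w] is_dft_unique[OF is_dft_dft w] by blast
    fix z assume z: "z \<in> l2 \<and> (AE \<theta> in torus. dft z \<theta> = ?v \<theta>)"
    have "is_dft z ?v"
      by (rule is_dft_cong_AE[OF is_dft_dft sq_int_measurable[OF is_dft_sq_int[OF w]]]) (use z in auto)
    then show "z = w" using w by (rule is_dft_inj)
  qed
  then show ?thesis using w by simp
qed

text \<open>The constant 4 is that of the polarization identity for \<open>v + v'\<close> and \<open>v - v'\<close>.\<close>

lemma parseval_polarized:
  fixes u u' :: "int ^ 'n \<Rightarrow> real"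
  assumes "is_dft u v" "is_dft u' v'"
  shows "4 * (2 * pi) ^ CARD('n) * l2ip u u' = (\<integral>\<theta>. 4 * Re (v \<theta> * cnj (v' \<theta>)) \<partial>torus)"
proof -
  have l: "u \<in> l2" "u' \<in> l2" using parseval(1) assms by auto
  have sum: "L2sq torus (\<lambda>\<theta>. v \<theta> + v' \<theta>) = (2 * pi) ^ CARD('n) * (l2sq u + 2 * l2ip u u' + l2sq u')"
    unfolding parseval(2)[OF is_dft_add[OF assms]] l2sq_add[OF l] ..
  have "l2ip u (\<lambda>x. - 1 * u' x) = - 1 * l2ip u u'" "l2sq (\<lambda>x. - 1 * u' x) = (-1)^2 * l2sq u'"
    by (rule l2ip_scale_right, rule l2sq_scale)
  then have diff: "L2sq torus (\<lambda>\<theta>. v \<theta> - v' \<theta>) = (2 * pi) ^ CARD('n) * (l2sq u - 2 * l2ip u u' + l2sq u')"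
    using parseval(2)[OF is_dft_diff[OF assms]] l2sq_add[OF l(1) l2_scale[OF l(2), of "-1"]] by simp
  have "4 * (2 * pi) ^ CARD('n) * l2ip u u' = L2sq torus (\<lambda>\<theta>. v \<theta> + v' \<theta>) - L2sq torus (\<lambda>\<theta>. v \<theta> - v' \<theta>)"
    unfolding sum diff by (simp add: algebra_simps)
  also have "\<dots> = (\<integral>\<theta>. (cmod (v \<theta> + v' \<theta>))^2 - (cmod (v \<theta> - v' \<theta>))^2 \<partial>torus)"
    unfolding L2sq_def using is_dft_sq_int[OF is_dft_add[OF assms]] is_dft_sq_int[OF is_dft_diff[OF assms]]
    by (intro Bochner_Integration.integral_diff[symmetric]) (auto simp: sq_int_def)
  also have "\<dots> = (\<integral>\<theta>. 4 * Re (v \<theta> * cnj (v' \<theta>)) \<partial>torus)"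
    by (intro Bochner_Integration.integral_cong refl) (simp add: cmod_power2, simp add: power2_eq_square algebra_simps)
  finally show ?thesis .
qed

lemma frac_laplacian_l2: "0 < \<alpha> \<Longrightarrow> u \<in> l2 \<Longrightarrow> frac_laplacian \<alpha> u \<in> l2"
  using parseval(1)[OF is_dft_frac_laplacian] by blast

lemma frac_laplacian_symmetric:
  assumes "0 < \<alpha>" "u \<in> l2" "u' \<in> l2"
  shows "l2ip (frac_laplacian \<alpha> u) u' = l2ip u (frac_laplacian \<alpha> u')"
proof -
  note d = is_dft_dft[OF assms(2)] is_dft_dft[OF assms(3)]
    is_dft_frac_laplacian[OF assms(1,2)] is_dft_frac_laplacian[OF assms(1,3)]
  have "(\<integral>\<theta>. 4 * Re ((complex_of_real (laplace_symbol \<theta> powr \<alpha>) * dft u \<theta>) * cnj (dft u' \<theta>)) \<partial>torus)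
      = (\<integral>\<theta>. 4 * Re (dft u \<theta> * cnj (complex_of_real (laplace_symbol \<theta> powr \<alpha>) * dft u' \<theta>)) \<partial>torus)"
    by (intro Bochner_Integration.integral_cong refl) (simp add: algebra_simps)
  then show ?thesis
    unfolding parseval_polarized[OF d(3,2), symmetric] parseval_polarized[OF d(1,4), symmetric] by simp
qed

text \<open>Stated for an arbitrary representative \<open>v\<close> of the transform, as needed for translates, whose
transform is only known up to null sets.\<close>

lemma frac_laplacian_form:
  fixes u :: "int ^ 'n \<Rightarrow> real"
  assumes "0 < \<alpha>" "u \<in> l2" "is_dft u v"
  shows "l2ip (frac_laplacian \<alpha> u) u
    = 1 / (2 * pi) ^ CARD('n) * (\<integral>\<theta>. laplace_symbol \<theta> powr \<alpha> * (cmod (v \<theta>))^2 \<partial>torus)"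
proof -
  have mv: "v \<in> borel_measurable torus" "dft u \<in> borel_measurable torus"
    using is_dft_sq_int[OF assms(3)] is_dft_sq_int[OF is_dft_dft[OF assms(2)]] by (auto simp: sq_int_def)
  note m = symbol_powr_measurable[of \<alpha>]
  let ?g = "\<lambda>\<theta>. laplace_symbol \<theta> powr \<alpha> * (Re (dft u \<theta>) * Re (v \<theta>) + Im (dft u \<theta>) * Im (v \<theta>))"
  have "4 * (2 * pi) ^ CARD('n) * l2ip (frac_laplacian \<alpha> u) u
      = (\<integral>\<theta>. 4 * Re ((complex_of_real (laplace_symbol \<theta> powr \<alpha>) * dft u \<theta>) * cnj (v \<theta>)) \<partial>torus)"
    by (rule parseval_polarized[OF is_dft_frac_laplacian[OF assms(1,2)] assms(3)])
  also have "\<dots> = (\<integral>\<theta>. 4 * ?g \<theta> \<partial>torus)"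
    by (intro Bochner_Integration.integral_cong refl) (simp add: algebra_simps)
  also have "\<dots> = (\<integral>\<theta>. 4 * (laplace_symbol \<theta> powr \<alpha> * (cmod (v \<theta>))^2) \<partial>torus)"
  proof (rule integral_cong_AE)
    show "(\<lambda>\<theta>. 4 * ?g \<theta>) \<in> borel_measurable torus"
      by (intro borel_measurable_times borel_measurable_add borel_measurable_const m
          measurable_compose[OF mv(1) borel_measurable_Re] measurable_compose[OF mv(2) borel_measurable_Re]
          measurable_compose[OF mv(1) borel_measurable_Im] measurable_compose[OF mv(2) borel_measurable_Im])
    show "(\<lambda>\<theta>. 4 * (laplace_symbol \<theta> powr \<alpha> * (cmod (v \<theta>))^2)) \<in> borel_measurable torus"
      by (intro borel_measurable_times borel_measurable_const m borel_measurable_power measurable_compose[OF mv(1) borel_measurable_norm])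
    show "AE \<theta> in torus. 4 * ?g \<theta>
        = 4 * (laplace_symbol \<theta> powr \<alpha> * (cmod (v \<theta>))^2)"
      using is_dft_unique[OF is_dft_dft[OF assms(2)] assms(3)]
      by eventually_elim (simp add: cmod_power2, simp add: power2_eq_square algebra_simps)
  qed
  finally show ?thesis by (simp add: field_simps)
qed

lemma symbol_weighted_integrable:
  fixes v :: "real ^ 'n \<Rightarrow> complex"
  assumes "0 < \<alpha>" "sq_int torus v"
  shows "integrable torus (\<lambda>\<theta>. laplace_symbol \<theta> powr \<alpha> * (cmod (v \<theta>))^2)"
proof -
  have i: "integrable torus (\<lambda>\<theta> :: real ^ 'n. (4 * CARD('n)) powr \<alpha> * (cmod (v \<theta>))^2)"
    using assms(2) by (auto simp: sq_int_def)
  show ?thesis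
  proof (rule Bochner_Integration.integrable_bound[OF i])
    show "(\<lambda>\<theta>. laplace_symbol \<theta> powr \<alpha> * (cmod (v \<theta>))^2) \<in> borel_measurable torus"
      by (intro borel_measurable_times borel_measurable_const symbol_powr_measurable
          borel_measurable_power measurable_compose[OF sq_int_measurable[OF assms(2)] borel_measurable_norm])
    have "\<bar>laplace_symbol \<theta> powr \<alpha> * (cmod (v \<theta>))^2\<bar> \<le> \<bar>(4 * CARD('n)) powr \<alpha> * (cmod (v \<theta>))^2\<bar>" for \<theta>
      unfolding abs_mult using symbol_powr_le[OF assms(1), of \<theta>] by (intro mult_right_mono) auto
    then show "AE \<theta> in torus. norm (laplace_symbol \<theta> powr \<alpha> * (cmod (v \<theta>))^2) \<le> norm ((4 * CARD('n)) powr \<alpha> * (cmod (v \<theta>))^2)"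
      by simp
  qed
qed

lemma frac_laplacian_form_nonneg:
  assumes "0 < \<alpha>" "u \<in> l2" shows "0 \<le> l2ip (frac_laplacian \<alpha> u) u"
  unfolding frac_laplacian_form[OF assms is_dft_dft[OF assms(2)]]
  by (intro mult_nonneg_nonneg Bochner_Integration.integral_nonneg) auto

lemma frac_laplacian_form_shift:
  fixes u :: "int ^ 'n \<Rightarrow> real"
  assumes "0 < \<alpha>" "u \<in> l2"
  shows "l2ip (frac_laplacian \<alpha> (\<lambda>x. u (x + y))) (\<lambda>x. u (x + y)) = l2ip (frac_laplacian \<alpha> u) u"
proof -
  have s: "(\<lambda>x. u (x + y)) \<in> l2" using assms(2) by (simp add: l2_shift)
  have "is_dft (\<lambda>x. u (x + y)) (\<lambda>\<theta>. fourier_char (- y) \<theta> * dft u \<theta>)"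
    using is_dft_shift[OF is_dft_dft[OF assms(2)], of "- y"] by simp
  from frac_laplacian_form[OF assms(1) s this] frac_laplacian_form[OF assms is_dft_dft[OF assms(2)]]
  show ?thesis unfolding norm_mult norm_fourier_char mult_1_left by (simp only:)
qed

section \<open>Ground states\<close>

text \<open>Every lattice point is a sum of multiples of unit vectors, so a function of period 1 in every
coordinate is constant.\<close>

lemma periodic_imp_constant:
  fixes g :: "int ^ 'n \<Rightarrow> 'b"
  assumes per: "\<And>x i. g (x + axis i 1) = g x"
  shows "g x = g 0"
proof -
  have nat: "g (x + axis i (int n)) = g x" for x i n
  proof (induction n)
    case 0
    have "axis i 0 = (0 :: int ^ 'n)" by (simp add: axis_def vec_eq_iff)
    then show ?case by (simp only: of_nat_0 add_0_right)
  next
    case (Suc n)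
    have eq: "x + axis i (int (Suc n)) = (x + axis i (int n)) + axis i 1"
      by (simp add: axis_def vec_eq_iff)
    show ?case unfolding eq per by (rule Suc)
  qed
  have int: "g (x + axis i k) = g x" for x i k
  proof (cases "0 \<le> k")
    case True
    then show ?thesis using nat[of x i "nat k"] by simp
  next
    case False
    have eq: "(x + axis i k) + axis i (int (nat (- k))) = x"
      using False by (simp add: axis_def vec_eq_iff)
    show ?thesis using nat[of "x + axis i k" i "nat (- k)"] unfolding eq by simp
  qed
  have "g (\<Sum>i\<in>A. axis i (x $ i)) = g 0" if "finite A" for A
    using that
  proof (induction A rule: finite_induct)
    case (insert i A)
    then show ?case using int[of "\<Sum>i\<in>A. axis i (x $ i)" i "x $ i"] by (simp add: add.commute)
  qed simp
  from this[of UNIV] have "g (\<Sum>i\<in>UNIV. axis i (x $ i)) = g 0" by simp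
  moreover have "(\<Sum>i\<in>UNIV. axis i (x $ i)) = x"
    by (simp add: vec_eq_iff axis_def sum_component)
  ultimately show ?thesis by simp
qed

text \<open>Division by zero gives \<open>g 0 / 0 = 0\<close>, which is the limit at 0; this makes the quotient continuous
everywhere. Monotonicity on the two open half-lines extends to rays from the origin by this continuity.\<close>

lemma superquadratic_potentialI:
  fixes g G :: "real \<Rightarrow> real"
  assumes g: "continuous_on UNIV g" and small: "((\<lambda>s. g s / s) \<longlongrightarrow> 0) (at 0)"
    and neg: "strict_mono_on {..<0} (\<lambda>s. g s / \<bar>s\<bar>)" and pos: "strict_mono_on {0<..} (\<lambda>s. g s / \<bar>s\<bar>)"
    and G0: "G 0 = 0" and deriv: "\<And>s. (G has_real_derivative g s) (at s)"
    and super: "\<And>C. eventually (\<lambda>s. C < G s / s^2) at_infinity"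
  shows "superquadratic_potential (\<lambda>s. g s / s) G"
proof -
  define m where "m s = g s / s" for s
  have g0: "g 0 = 0"
  proof -
    have "((\<lambda>s. g s / s * s) \<longlongrightarrow> 0 * 0) (at 0)" by (intro tendsto_mult small tendsto_ident_at)
    moreover have "\<forall>\<^sub>F s in at 0. g s / s * s = g s" by (auto simp: eventually_at intro!: exI[of _ 1])
    ultimately have "(g \<longlongrightarrow> 0 * 0) (at 0)" by (rule Lim_transform_eventually)
    moreover have "(g \<longlongrightarrow> g 0) (at 0)"
      using g by (simp add: continuous_on_eq_continuous_at isCont_def)
    ultimately show ?thesis using tendsto_unique[OF at_neq_bot, of g "0 * 0" 0 "g 0"] by simp
  qed
  have m0: "m 0 = 0" by (simp add: m_def)
  have mc: "isCont m s" for s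
  proof (cases "s = 0")
    case True
    then show ?thesis using small unfolding isCont_def True m0 m_def[abs_def] by simp
  next
    case False
    then show ?thesis unfolding m_def[abs_def]
      using g by (intro continuous_intros) (auto simp: continuous_on_eq_continuous_at)
  qed
  have up: "m s < m t" if "0 < s" "s < t" for s t
    using strict_mono_onD[OF pos, of s t] that by (simp add: m_def)
  have down: "m t < m s" if "s < t" "t < 0" for s t
    using strict_mono_onD[OF neg, of s t] that by (simp add: m_def)
  have m_tendsto: "(\<lambda>n. m (s * inverse (real (Suc n)))) \<longlonglongrightarrow> 0" for s
  proof -
    have "(\<lambda>n. s * inverse (real (Suc n))) \<longlonglongrightarrow> 0"
      by (rule tendsto_mult_right_zero[OF LIMSEQ_inverse_real_of_nat])
    from isCont_tendsto_compose[OF mc this] show ?thesis unfolding m0 .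
  qed
  have pos0: "0 < m s" if "s \<noteq> 0" for s
  proof -
    have "m (s / 2) < m s" using up[of "s/2" s] down[of s "s/2"] that by (cases "0 < s") auto
    moreover have "0 \<le> m (s / 2)"
    proof (rule LIMSEQ_le_const2[OF m_tendsto[of "s / 2"]], intro exI[of _ 1] allI impI)
      fix n :: nat assume n: "1 \<le> n"
      define q where "q = inverse (real (Suc n))"
      have q: "0 < q" "q < 1" using n by (auto simp: q_def inverse_eq_divide)
      have "m (s / 2 * q) < m (s / 2)"
      proof (cases "0 < s")
        case True
        then show ?thesis using q by (intro up) auto
      next
        case False
        with that have s: "s < 0" by simp
        have "s / 2 * 1 < s / 2 * q" using s q(2) by (intro mult_strict_left_mono_neg) auto
        then show ?thesis using s q by (intro down) (auto intro: mult_neg_pos)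
      qed
      then show "m (s / 2 * inverse (real (Suc n))) \<le> m (s / 2)" by (simp add: q_def)
    qed
    ultimately show ?thesis by linarith
  qed
  have "superquadratic_potential m G"
  proof
    show "continuous_on UNIV m" using mc by (simp add: continuous_on_eq_continuous_at)
    show "m 0 = 0" by (rule m0)
    show "G 0 = 0" by (rule G0)
    show "(G has_real_derivative s * m s) (at s)" for s
      using deriv[of s] g0 by (cases "s = 0") (simp_all add: m_def)
    show "m (t1 * s) < m (t2 * s)" if s: "s \<noteq> 0" and t: "0 \<le> t1" "t1 < t2" for s t1 t2
    proof (cases "t1 = 0")
      case True
      then show ?thesis using pos0[of "t2 * s"] s t by (simp add: m0)
    next
      case False
      then have t1: "0 < t1" using t by simp
      show ?thesis
      proof (cases "0 < s")
        case True
        then show ?thesis using t1 t by (intro up) auto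
      next
        case False
        with s have s: "s < 0" by simp
        then show ?thesis using t1 t by (intro down) (auto intro: mult_pos_neg)
      qed
    qed
    show "\<exists>R. \<forall>s. R \<le> \<bar>s\<bar> \<longrightarrow> C * s^2 \<le> G s" for C
    proof -
      obtain R where R: "\<And>s. R \<le> norm s \<Longrightarrow> C < G s / s^2"
        using super[of C] unfolding eventually_at_infinity by blast
      have "C * s^2 \<le> G s" if "R \<le> \<bar>s\<bar>" for s
      proof (cases "s = 0")
        case False
        then have "0 < s^2" by simp
        then show ?thesis using R[of s] that by (simp add: pos_less_divide_eq)
      qed (simp add: G0)
      then show ?thesis by blast
    qed
  qed
  then show ?thesis by (simp add: m_def[abs_def])
qed

lemma primitive_0: "primitive f x 0 = 0"
  by (simp add: primitive_def zero_ereal_def[symmetric])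

text \<open>The fundamental theorem on an interval that contains both 0 and \<open>s\<close> in its interior.\<close>

lemma primitive_has_derivative:
  assumes "continuous_on UNIV (f x)"
  shows "(primitive f x has_real_derivative f x s) (at s)"
proof -
  let ?a = "- \<bar>s\<bar> - 1" and ?b = "\<bar>s\<bar> + 1"
  have "((\<lambda>u. LBINT t=0..u. f x t) has_vector_derivative f x s) (at s within {?a..?b})"
    unfolding zero_ereal_def
    by (rule interval_integral_FTC2) (auto intro: continuous_on_subset[OF assms])
  then have "((\<lambda>u. LBINT t=0..u. f x t) has_vector_derivative f x s) (at s)"
    by (subst (asm) at_within_interior) auto
  then show ?thesis
    unfolding primitive_def[abs_def] by (simp add: has_real_derivative_iff_has_vector_derivative)
qed

definition schroedinger :: "real \<Rightarrow> real \<Rightarrow> ((int ^ 'n) \<Rightarrow> real) \<Rightarrow> (int ^ 'n) \<Rightarrow> real" where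
  "schroedinger \<alpha> c u x = frac_laplacian \<alpha> u x + c * u x"

lemma schroedinger_l2:
  assumes "0 < \<alpha>" "u \<in> l2" shows "schroedinger \<alpha> c u \<in> l2"
  unfolding schroedinger_def[abs_def] by (intro l2_add l2_scale frac_laplacian_l2 assms)

lemma schroedinger_ip:
  assumes "0 < \<alpha>" "u \<in> l2" "v \<in> l2"
  shows "l2ip (schroedinger \<alpha> c u) v = l2ip (frac_laplacian \<alpha> u) v + c * l2ip u v"
proof -
  have "l2ip v (\<lambda>x. frac_laplacian \<alpha> u x + c * u x) = l2ip v (frac_laplacian \<alpha> u) + c * l2ip v u"
    using l2ip_add_right[OF assms(3) frac_laplacian_l2[OF assms(1,2)] l2_scale[OF assms(2)]]
    by (simp add: l2ip_scale_right)
  then show ?thesis unfolding schroedinger_def[abs_def] by (simp only: l2ip_commute[of v])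
qed

lemma l2sq_shift: "l2sq (\<lambda>x. u (x + y)) = l2sq (u :: 'a::group_add \<Rightarrow> real)"
  using infsum_shift[of "\<lambda>x. (u x)^2" y] by (simp add: l2sq_def)

lemma nehari_problem_schroedinger:
  assumes "superquadratic_potential m G" "0 < \<alpha>" "0 < c"
  shows "nehari_problem m G (schroedinger \<alpha> c :: (int ^ 'n \<Rightarrow> real) \<Rightarrow> _) c"
proof -
  interpret superquadratic_potential m G by (rule assms(1))
  note ip = schroedinger_ip[OF assms(2), of _ _ c]
  show ?thesis
  proof
    show "0 < c" by (rule assms(3))
    fix u :: "int ^ 'n \<Rightarrow> real" assume u: "u \<in> l2"
    show "schroedinger \<alpha> c u \<in> l2" by (rule schroedinger_l2[OF assms(2) u])
    show "c * l2sq u \<le> l2ip (schroedinger \<alpha> c u) u"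
      using frac_laplacian_form_nonneg[OF assms(2) u] unfolding ip[OF u u] l2ip_self by simp
    show "l2ip (schroedinger \<alpha> c (\<lambda>x. u (x + y))) (\<lambda>x. u (x + y)) = l2ip (schroedinger \<alpha> c u) u" for y
    proof -
      have s: "(\<lambda>x. u (x + y)) \<in> l2" using u by (simp add: l2_shift)
      show ?thesis
        unfolding ip[OF u u] ip[OF s s] l2ip_self l2sq_shift frac_laplacian_form_shift[OF assms(2) u] ..
    qed
    fix v :: "int ^ 'n \<Rightarrow> real" assume v: "v \<in> l2"
    show "l2ip (schroedinger \<alpha> c u) v = l2ip u (schroedinger \<alpha> c v)"
      unfolding l2ip_commute[of u "schroedinger \<alpha> c v"] ip[OF u v] ip[OF v u]
      using frac_laplacian_symmetric[OF assms(2) u v]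
      by (simp add: l2ip_commute[of "frac_laplacian \<alpha> v" u] l2ip_commute[of v u])
  qed
qed

lemma alpha_norm_sq_eq:
  fixes u :: "int ^ 'n \<Rightarrow> real"
  assumes "0 < \<alpha>" "u \<in> l2" "\<And>x. h x = c"
  shows "alpha_norm_sq \<alpha> h u = l2ip (schroedinger \<alpha> c u) u"
proof -
  have "(\<Sum>\<^sub>\<infinity>x. h x * \<bar>u x\<bar>^2) = c * l2sq u"
    unfolding assms(3) power2_abs l2sq_def by (rule infsum_cmult_right')
  then show ?thesis
    unfolding alpha_norm_sq_def LINT_torus schroedinger_ip[OF assms(1,2,2)] l2ip_self
      frac_laplacian_form[OF assms(1,2) is_dft_dft[OF assms(2)]] by simp
qed

lemma H_alpha_eq:
  assumes "0 < \<alpha>" "\<And>x. h x = c" shows "H_alpha \<alpha> h = l2"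
proof -
  have "set_integrable lborel torus_cube (\<lambda>\<theta>. laplace_symbol \<theta> powr \<alpha> * (cmod (dft u \<theta>))^2)" if "u \<in> l2" for u
    unfolding set_integrable_torus by (rule symbol_weighted_integrable[OF assms(1) is_dft_sq_int[OF is_dft_dft[OF that]]])
  moreover have "(\<lambda>x. h x * \<bar>u x\<bar>^2) summable_on UNIV" if "u \<in> l2" for u
    unfolding assms(2) power2_abs by (rule summable_on_cmult_right[OF l2_summable[OF that]])
  ultimately show ?thesis unfolding H_alpha_def l2_eq_lattice_l2 by blast
qed

text \<open>By periodicity \<open>h\<close> is a constant \<open>c\<close> and \<open>f x\<close> is the same function \<open>g\<close> for all \<open>x\<close>. Thus the energy, its
norm and the Nehari manifold become those of the abstract problem for \<open>(-\<Delta>)\<^sup>\<alpha> + c\<close>, whose minimizer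
is the ground state.\<close>

theorem theorem1p1:
  fixes \<alpha> c1 c2 a p :: real
    and h :: "(int ^ 'n) \<Rightarrow> real"
    and f :: "(int ^ 'n) \<Rightarrow> real \<Rightarrow> real"
  assumes alpha: "0 < \<alpha>" "\<alpha> < 1"
    and h1: "0 < c1" "0 < c2" "\<And>x. c1 \<le> h x \<and> h x \<le> c2"
    and f1: "\<And>x. continuous_on UNIV (f x)"
    and f2: "0 < a" "2 < p" "\<And>x u. \<bar>f x u\<bar> \<le> a * (1 + \<bar>u\<bar> powr (p - 1))"
    and f3: "uniform_limit UNIV (\<lambda>u x. f x u / u) (\<lambda>_. 0) (at 0)"
    and f4: "\<And>x. strict_mono_on {..<0} (\<lambda>u. f x u / \<bar>u\<bar>)"
            "\<And>x. strict_mono_on {0<..} (\<lambda>u. f x u / \<bar>u\<bar>)"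
    and f5: "\<And>K. eventually (\<lambda>u. \<forall>x. primitive f x u / u\<^sup>2 > K) at_infinity"
    and f6: "\<And>x i. h (x + axis i 1) = h x"
            "\<And>x i u. f (x + axis i 1) u = f x u"
  shows "\<exists>u. ground_state \<alpha> h f u \<and>
           (\<forall>x. frac_laplacian \<alpha> u x + h x * u x = f x (u x))"
proof -
  define c where "c = h 0"
  define g where "g = f 0"
  define G where "G = primitive f 0"
  define m where "m = (\<lambda>s. g s / s)"
  have hc: "h x = c" for x unfolding c_def by (rule periodic_imp_constant) (rule f6(1))
  have fg: "f x = g" for x
    unfolding g_def by (rule periodic_imp_constant) (rule ext, rule f6(2))
  have FG: "primitive f x = G" for x
    unfolding G_def primitive_def[abs_def] fg ..
  have c: "0 < c" using h1(1) h1(3)[of 0] by (simp add: c_def)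
  have pot: "superquadratic_potential m G"
    unfolding m_def
  proof (rule superquadratic_potentialI)
    show "continuous_on UNIV g" unfolding g_def by (rule f1)
    show "((\<lambda>s. g s / s) \<longlongrightarrow> 0) (at 0)"
      using tendsto_uniform_limitI[OF f3, of 0] unfolding fg by simp
    show "strict_mono_on {..<0} (\<lambda>s. g s / \<bar>s\<bar>)" "strict_mono_on {0<..} (\<lambda>s. g s / \<bar>s\<bar>)"
      using f4[of 0] unfolding fg by auto
    show "G 0 = 0" unfolding G_def by (rule primitive_0)
    show "(G has_real_derivative g s) (at s)" for s
      unfolding G_def g_def by (rule primitive_has_derivative[OF f1])
    show "eventually (\<lambda>s. C < G s / s\<^sup>2) at_infinity" for C
      using f5[of C] unfolding FG by simp
  qed
  interpret nehari_problem m G "schroedinger \<alpha> c :: (int ^ 'n \<Rightarrow> real) \<Rightarrow> _" c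
    by (rule nehari_problem_schroedinger[OF pot alpha(1) c])
  have H: "H_alpha \<alpha> h = l2" by (rule H_alpha_eq[OF alpha(1) hc])
  have normQ: "alpha_norm_sq \<alpha> h u = Q u" if "u \<in> l2" for u
    unfolding Q_def by (rule alpha_norm_sq_eq[OF alpha(1) that hc])
  have energyI: "energy \<alpha> h f u = I u" if "u \<in> l2" for u
    unfolding energy_def normQ[OF that] I_def quad_sum_gq FG by simp
  have "g s * s = s\<^sup>2 * m s" for s
    using m_def by (cases "s = 0") (simp_all add: power2_eq_square)
  then have nehariN: "nehari \<alpha> h f = N"
    unfolding nehari_def H N_def J_def quad_sum_def fg by (auto simp: normQ)
  obtain u where u: "u \<in> N" and min: "\<And>w. w \<in> N \<Longrightarrow> I u \<le> I w" using minimizer_exists by blast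
  have ul: "u \<in> l2" using u by (simp add: N_def)
  have "critical_point \<alpha> h f u"
    unfolding critical_point_def H alpha_norm_def
  proof (intro conjI ul allI impI)
    fix e :: real assume e: "0 < e"
    obtain d where d: "0 < d" "\<And>v. v \<in> l2 \<Longrightarrow> sqrt (Q v) < d \<Longrightarrow> \<bar>I (\<lambda>x. u x + v x) - I u\<bar> \<le> e * sqrt (Q v)"
      using stationary_differentiable[OF ul minimizer_critical[OF u min] e] by blast
    show "\<exists>\<delta>>0. \<forall>v\<in>l2. sqrt (alpha_norm_sq \<alpha> h v) < \<delta> \<longrightarrow>
        \<bar>energy \<alpha> h f (\<lambda>x. u x + v x) - energy \<alpha> h f u\<bar> \<le> e * sqrt (alpha_norm_sq \<alpha> h v)"
      using d by (intro exI[of _ d]) (simp add: normQ energyI ul l2_add)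
  qed
  moreover have "u \<noteq> (\<lambda>_. 0)" using u by (simp add: N_def)
  moreover have "ereal (energy \<alpha> h f u) = (INF v\<in>nehari \<alpha> h f. ereal (energy \<alpha> h f v))"
    unfolding nehariN
  proof (rule antisym)
    show "ereal (energy \<alpha> h f u) \<le> (INF v\<in>N. ereal (energy \<alpha> h f v))"
    proof (rule INF_greatest)
      fix v assume v: "v \<in> N"
      then have "v \<in> l2" by (simp add: N_def)
      then show "ereal (energy \<alpha> h f u) \<le> ereal (energy \<alpha> h f v)"
        using min[OF v] by (simp add: energyI ul)
    qed
  qed (rule INF_lower[OF u])
  moreover have "0 < energy \<alpha> h f u" using I_pos_on_N[OF u] by (simp add: energyI ul)
  ultimately have "ground_state \<alpha> h f u" by (simp add: ground_state_def)
  moreover have "frac_laplacian \<alpha> u x + h x * u x = f x (u x)" for x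
  proof -
    have "schroedinger \<alpha> c u x = u x * m (u x)" by (rule minimizer_equation[OF u min])
    also have "\<dots> = g (u x)"
    proof (cases "u x = 0")
      case True
      have "(G has_real_derivative g 0) (at 0)" unfolding G_def g_def by (rule primitive_has_derivative[OF f1])
      from DERIV_unique[OF this G_deriv[of 0]] show ?thesis using True by simp
    qed (simp add: m_def)
    finally show ?thesis by (simp add: schroedinger_def hc fg)
  qed
  ultimately show ?thesis by blast
qed

end
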